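(* In the setting described in the context, suppose that the following hypotheses are satisfied. (H1) There exists a Hilbert space $\mathbf{V}$ compactly embedded into $\mathbf{H}$ such that $S$ is twice continuously differentiable from $\mathcal{H}\times E$ to $\mathbf{V}\times M$ with bounded derivatives on bounded subsets. (H2) There is a point $\hat z\in\mathcal{X}$ such that for any $\varepsilon>0$ there is an integer $m\ge1$, depending only on $\varepsilon$, such that for any $z\in\mathcal{X}$ there are $\zeta_1,\dots,\zeta_m\in\mathcal{K}$ with $d_{\mathcal{H}}(S_m(z;\zeta_1,\dots,\zeta_m),\hat z)<\varepsilon$. (H3) For any $z\in\mathcal{X}$, the set $\mathcal{K}^z$ of all $\eta\in\mathcal{K}$ for which the derivative $(D_\eta S)(z,\eta):E\to\mathbf{H}\times T_yM$ (where $y$ is the $M$-component of $S(z,\eta)$) has dense image satisfies $\ell(\mathcal{K}^z)=1$. (H4) There exists an orthonormal basis $\{\varphi_j\}$ in $E$ such that $\eta_k=\sum_{j=1}^\infty b_j\xi_{jk}\varphi_j$, where $\{b_j\}$ are real numbers with $\sum_jb_j^2<\infty$ and $\{\xi_{jk}\}$ are independent random variables such that $\xi_{jk}$ has a Lipschitz-continuous density $\rho_j$ with respect to the Lebesgue measure on $\mathbb{R}$. Then the Markov process $\{z_n\}$ has a unique stationary measure $\mu\in\mathcal{P}(\mathcal{X})$, and there are numbers $C>0$ and $\gamma>0$ such that $$\|\mathfrak{P}_n^*\lambda-\mu\|_L^*\le Ce^{-\gamma n}$$ for all $n\ge0$ and $\lambda\in\mathcal{P}(\mathcal{X})$.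
   Context: Setting. $\mathbf{H}$ and $E$ are separable Hilbert spaces, $M$ is a smooth compact Riemannian manifold without boundary, $\mathcal{H}=\mathbf{H}\times M$ with product metric $d_{\mathcal{H}}$, and $S:\mathcal{H}\times E\to\mathcal{H}$ is continuous. $\{\eta_n\}_{n\ge1}$ is a sequence of i.i.d. random variables in $E$ on a probability space $(\Omega_0,\mathcal{F}_0,\mathbb{P}_0)$ whose common law $\ell$ has compact support $\mathcal{K}$. $\mathcal{X}\subset\mathcal{H}$ is a compact set with $S(\mathcal{X}\times\mathcal{K})\subset\mathcal{X}$. The process is $z_n=S(z_{n-1},\eta_n)$, $n\ge1$, $z_0=z\in\mathcal{X}$; it is a Markov process in $\mathcal{X}$ with transition function $P_n(z,\Gamma)=\mathbb{P}_0\{z_n\in\Gamma\}$ and dual semigroup $\mathfrak{P}_n^*\lambda(\Gamma)=\int_{\mathcal{X}}P_n(z,\Gamma)\lambda(dz)$ on the set $\mathcal{P}(\mathcal{X})$ of Borel probability measures. A measure $\mu$ is stationary if $\mathfrak{P}_1^*\mu=\mu$. For $z\in\mathcal{H}$ and $\zeta_1,\dots,\zeta_n\in E$, $S_n(z;\zeta_1,\dots,\zeta_n)$ denotes $z_n$ defined by $z_0=z$, $z_k=S(z_{k-1},\zeta_k)$. Dual-Lipschitz metric on $\mathcal{P}(\mathcal{X})$: $\|\mu_1-\mu_2\|_L^*=\sup_{\|f\|_L\le1}|\int f\,d\mu_1-\int f\,d\mu_2|$, with $\|f\|_L=\sup|f|+\sup_{0<d(z_1,z_2)\le1}|f(z_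1)-f(z_2)|/d(z_1,z_2)$.
   Formalization: In (H4) the numbers b_j are all required to be non-zero; if b_j = 0 is allowed the claim fails, e.g. S(z,η) = z − z³ + η on [−1/2,1/2] with b = 0 satisfies (H1)–(H4) but converges only like n^{-1/2}. *)

theory Defs
  imports "HOL-Probability.Probability"
begin

section \<open>Smooth manifolds modelled on a finite-dimensional space\<close>

text \<open>Continuity of all directional derivatives is the same as $C^k$-regularity here, because
  this is only used for open subsets of a finite-dimensional domain.\<close>

primrec Ck_on :: "nat \<Rightarrow> ('a::real_normed_vector \<Rightarrow> 'b::real_normed_vector) \<Rightarrow> 'a set \<Rightarrow> bool" where
  "Ck_on 0 f U \<longleftrightarrow> continuous_on U f"
| "Ck_on (Suc k) f U \<longleftrightarrow>
     (\<forall>x\<in>U. f differentiable (at x)) \<and> (\<forall>v. Ck_on k (\<lambda>x. frechet_derivative f (at x) v) U)"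

definition smooth_on :: "('a::real_normed_vector \<Rightarrow> 'b::real_normed_vector) \<Rightarrow> 'a set \<Rightarrow> bool" where
  "smooth_on f U \<longleftrightarrow> (\<forall>k. Ck_on k f U)"

text \<open>A chart is a pair (domain, coordinate map); the coordinate map is irrelevant outside the domain.\<close>

type_synonym ('m, 'd) chart = "'m set \<times> ('m \<Rightarrow> 'd)"

definition chart_inv :: "('m, 'd) chart \<Rightarrow> 'd \<Rightarrow> 'm" where
  "chart_inv c = inv_into (fst c) (snd c)"

definition charts_at :: "('m, 'd) chart set \<Rightarrow> 'm \<Rightarrow> ('m, 'd) chart set" where
  "charts_at A p = {c \<in> A. p \<in> fst c}"

text \<open>The model space is any finite-dimensional normed space rather than a type of class
  \<open>euclidean_space\<close>, since the latter excludes dimension 0 (a one-point manifold).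
  Charts have open images, so there is no boundary.\<close>

definition smooth_atlas :: "('m::topological_space, 'd::real_normed_vector) chart set \<Rightarrow> bool" where
  "smooth_atlas A \<longleftrightarrow>
     (\<exists>B::'d set. finite B \<and> span B = UNIV) \<and>
     (\<Union>c\<in>A. fst c) = UNIV \<and>
     (\<forall>c\<in>A. open (fst c) \<and> open (snd c ` fst c) \<and>
        homeomorphism (fst c) (snd c ` fst c) (snd c) (chart_inv c)) \<and>
     (\<forall>c\<in>A. \<forall>c'\<in>A. smooth_on (snd c' \<circ> chart_inv c) (snd c ` (fst c \<inter> fst c')))"

text \<open>A tangent vector at \<open>p\<close> is the family of its coordinate vectors in all charts at \<open>p\<close>, related by
  the derivatives of the transition maps (and 0 at the other charts, for extensionality).\<close>

definition tangent_space ::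
    "('m, 'd::real_normed_vector) chart set \<Rightarrow> 'm \<Rightarrow> (('m, 'd) chart \<Rightarrow> 'd) set" where
  "tangent_space A p =
     {v. (\<forall>c. c \<notin> charts_at A p \<longrightarrow> v c = 0) \<and>
         (\<forall>c\<in>charts_at A p. \<forall>c'\<in>charts_at A p.
            v c' = frechet_derivative (snd c' \<circ> chart_inv c) (at (snd c p)) (v c))}"

text \<open>The tangent vector at \<open>p\<close> with coordinates \<open>a\<close> in the chart \<open>c\<close>.\<close>

definition tangent_vec ::
    "('m, 'd::real_normed_vector) chart set \<Rightarrow> ('m, 'd) chart \<Rightarrow> 'm \<Rightarrow> 'd \<Rightarrow> ('m, 'd) chart \<Rightarrow> 'd" where
  "tangent_vec A c p a =
     (\<lambda>c'. if c' \<in> charts_at A p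
           then frechet_derivative (snd c' \<circ> chart_inv c) (at (snd c p)) a else 0)"

definition riemannian_metric ::
    "('m::topological_space, 'd::real_normed_vector) chart set \<Rightarrow>
     ('m \<Rightarrow> (('m, 'd) chart \<Rightarrow> 'd) \<Rightarrow> (('m, 'd) chart \<Rightarrow> 'd) \<Rightarrow> real) \<Rightarrow> bool" where
  "riemannian_metric A g \<longleftrightarrow>
     (\<forall>p. \<forall>v\<in>tangent_space A p. \<forall>w\<in>tangent_space A p. g p v w = g p w v) \<and>
     (\<forall>p. \<forall>u\<in>tangent_space A p. \<forall>v\<in>tangent_space A p. \<forall>w\<in>tangent_space A p. \<forall>r.
        g p (\<lambda>c. r *\<^sub>R u c + v c) w = r * g p u w + g p v w) \<and>
     (\<forall>p. \<forall>v\<in>tangent_space A p. v \<noteq> (\<lambda>c. 0) \<longrightarrow> g p v v > 0) \<and>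
     (\<forall>c\<in>A. \<forall>a b. smooth_on
        (\<lambda>x. g (chart_inv c x) (tangent_vec A c (chart_inv c x) a) (tangent_vec A c (chart_inv c x) b))
        (snd c ` fst c))"

definition velocity ::
    "('m, 'd::real_normed_vector) chart set \<Rightarrow> (real \<Rightarrow> 'm) \<Rightarrow> real \<Rightarrow> real \<Rightarrow> real \<Rightarrow> ('m, 'd) chart \<Rightarrow> 'd" where
  "velocity A \<gamma> a b t =
     (\<lambda>c. if c \<in> charts_at A (\<gamma> t) then vector_derivative (snd c \<circ> \<gamma>) (at t within {a..b}) else 0)"

definition C1_curve ::
    "('m::topological_space, 'd::real_normed_vector) chart set \<Rightarrow> (real \<Rightarrow> 'm) \<Rightarrow> real \<Rightarrow> real \<Rightarrow> bool" where
  "C1_curve A \<gamma> a b \<longleftrightarrow>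
     continuous_on {a..b} \<gamma> \<and>
     (\<forall>c\<in>A.
        (\<forall>t\<in>{a..b}. \<gamma> t \<in> fst c \<longrightarrow> (snd c \<circ> \<gamma>) differentiable (at t within {a..b})) \<and>
        continuous_on {t\<in>{a..b}. \<gamma> t \<in> fst c}
          (\<lambda>t. vector_derivative (snd c \<circ> \<gamma>) (at t within {a..b})))"

definition curve_length ::
    "('m, 'd::real_normed_vector) chart set \<Rightarrow>
     ('m \<Rightarrow> (('m, 'd) chart \<Rightarrow> 'd) \<Rightarrow> (('m, 'd) chart \<Rightarrow> 'd) \<Rightarrow> real) \<Rightarrow>
     (real \<Rightarrow> 'm) \<Rightarrow> real \<Rightarrow> real \<Rightarrow> real" where
  "curve_length A g \<gamma> a b =
     integral {a..b} (\<lambda>t. sqrt (g (\<gamma> t) (velocity A \<gamma> a b t) (velocity A \<gamma> a b t)))"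

text \<open>The lengths of all piecewise $C^1$ curves from \<open>x\<close> to \<open>y\<close>; the curve is $C^1$ up to the end points
  on each piece \<open>[\<tau> i, \<tau> (i + 1)]\<close>.\<close>

definition path_lengths ::
    "('m::topological_space, 'd::real_normed_vector) chart set \<Rightarrow>
     ('m \<Rightarrow> (('m, 'd) chart \<Rightarrow> 'd) \<Rightarrow> (('m, 'd) chart \<Rightarrow> 'd) \<Rightarrow> real) \<Rightarrow> 'm \<Rightarrow> 'm \<Rightarrow> real set" where
  "path_lengths A g x y =
     {\<Sum>i<n. curve_length A g \<gamma> (\<tau> i) (\<tau> (Suc i)) | (\<gamma>::real \<Rightarrow> 'm) (\<tau>::nat \<Rightarrow> real) n.
        \<gamma> (\<tau> 0) = x \<and> \<gamma> (\<tau> n) = y \<and>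
        (\<forall>i<n. \<tau> i < \<tau> (Suc i) \<and> C1_curve A \<gamma> (\<tau> i) (\<tau> (Suc i)))}"

text \<open>The metric of the type is the Riemannian distance on each connected component. Points of
  different components are joined by no curve; their distance is only constrained by the metric
  axioms and by \<open>dist\<close> inducing the manifold topology.\<close>

definition compact_riemannian_manifold ::
    "('m::metric_space, 'd::real_normed_vector) chart set \<Rightarrow>
     ('m \<Rightarrow> (('m, 'd) chart \<Rightarrow> 'd) \<Rightarrow> (('m, 'd) chart \<Rightarrow> 'd) \<Rightarrow> real) \<Rightarrow> bool" where
  "compact_riemannian_manifold A g \<longleftrightarrow>
     compact (UNIV :: 'm set) \<and> smooth_atlas A \<and> riemannian_metric A g \<and>
     (\<forall>x y. path_lengths A g x y \<noteq> {} \<longrightarrow> dist x y = Inf (path_lengths A g x y))"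

section \<open>Regularity of maps between products of Hilbert spaces and manifolds\<close>

definition compact_embedding :: "('v::real_normed_vector \<Rightarrow> 'h::real_normed_vector) \<Rightarrow> bool" where
  "compact_embedding \<iota> \<longleftrightarrow> bounded_linear \<iota> \<and> inj \<iota> \<and> compact (closure (\<iota> ` ball 0 1))"

definition coord_dom ::
    "(('h \<times> 'm) \<times> 'e \<Rightarrow> 'v \<times> 'm) \<Rightarrow> ('m, 'd) chart \<Rightarrow> ('m, 'd) chart \<Rightarrow> (('h \<times> 'd) \<times> 'e) set" where
  "coord_dom F c c' =
     {((u, x), e) | u x e. x \<in> snd c ` fst c \<and> snd (F ((u, chart_inv c x), e)) \<in> fst c'}"

definition coord_rep ::
    "(('h \<times> 'm) \<times> 'e \<Rightarrow> 'v \<times> 'm) \<Rightarrow> ('m, 'd) chart \<Rightarrow> ('m, 'd) chart \<Rightarrow> ('h \<times> 'd) \<times> 'e \<Rightarrow> 'v \<times> 'd" where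
  "coord_rep F c c' =
     (\<lambda>((u, x), e). let y = F ((u, chart_inv c x), e) in (fst y, snd c' (snd y)))"

text \<open>Twice continuously differentiable with derivatives bounded on bounded subsets. Derivatives in
  local coordinates may blow up at the boundary of a chart, so boundedness is required only while the
  \<open>M\<close>-components of the argument and of the value stay in compact parts of the charts; this does
  not depend on the atlas.\<close>

definition C2_bounded ::
    "('m::topological_space, 'd::real_normed_vector) chart set \<Rightarrow>
     (('h::real_normed_vector \<times> 'm) \<times> 'e::real_normed_vector \<Rightarrow> 'v::real_normed_vector \<times> 'm) \<Rightarrow> bool" where
  "C2_bounded A F \<longleftrightarrow>
     (\<forall>c\<in>A. \<forall>c'\<in>A.
       \<exists>(D1 :: ('h \<times> 'd) \<times> 'e \<Rightarrow> (('h \<times> 'd) \<times> 'e) \<Rightarrow>\<^sub>L ('v \<times> 'd))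
        (D2 :: ('h \<times> 'd) \<times> 'e \<Rightarrow> (('h \<times> 'd) \<times> 'e) \<Rightarrow>\<^sub>L ((('h \<times> 'd) \<times> 'e) \<Rightarrow>\<^sub>L ('v \<times> 'd))).
         (\<forall>p\<in>coord_dom F c c'.
            (coord_rep F c c' has_derivative blinfun_apply (D1 p)) (at p) \<and>
            (D1 has_derivative blinfun_apply (D2 p)) (at p)) \<and>
         continuous_on (coord_dom F c c') D2 \<and>
         (\<forall>B K K'. bounded B \<and> compact K \<and> K \<subseteq> snd c ` fst c \<and> compact K' \<and> K' \<subseteq> fst c' \<longrightarrow>
            (let Q = {((u, x), e) | u x e.
                        ((u, x), e) \<in> B \<and> x \<in> K \<and> snd (F ((u, chart_inv c x), e)) \<in> K'}
             in bounded (D1 ` Q) \<and> bounded (D2 ` Q))))"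

definition noise_deriv ::
    "('m, 'd::real_normed_vector) chart set \<Rightarrow>
     (('h::real_normed_vector \<times> 'm) \<times> 'e::real_normed_vector \<Rightarrow> 'h \<times> 'm) \<Rightarrow>
     'h \<times> 'm \<Rightarrow> 'e \<Rightarrow> 'e \<Rightarrow> 'h \<times> (('m, 'd) chart \<Rightarrow> 'd)" where
  "noise_deriv A S z \<eta> v =
     (frechet_derivative (\<lambda>e. fst (S (z, e))) (at \<eta>) v,
      \<lambda>c. if c \<in> charts_at A (snd (S (z, \<eta>)))
          then frechet_derivative (\<lambda>e. snd c (snd (S (z, e)))) (at \<eta>) v else 0)"

text \<open>Density of the image of the derivative in \<open>H \<times> T\<^sub>yM\<close>, with the norm of \<open>T\<^sub>yM\<close> given by \<open>g y\<close>.\<close>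

definition noise_deriv_dense ::
    "('m, 'd::real_normed_vector) chart set \<Rightarrow>
     ('m \<Rightarrow> (('m, 'd) chart \<Rightarrow> 'd) \<Rightarrow> (('m, 'd) chart \<Rightarrow> 'd) \<Rightarrow> real) \<Rightarrow>
     (('h::real_normed_vector \<times> 'm) \<times> 'e::real_normed_vector \<Rightarrow> 'h \<times> 'm) \<Rightarrow>
     'h \<times> 'm \<Rightarrow> 'e \<Rightarrow> bool" where
  "noise_deriv_dense A g S z \<eta> \<longleftrightarrow>
     (let y = snd (S (z, \<eta>)) in
      \<forall>u. \<forall>w\<in>tangent_space A y. \<forall>\<epsilon>>0. \<exists>v.
        norm (fst (noise_deriv A S z \<eta> v) - u) < \<epsilon> \<and>
        (let d = (\<lambda>c. snd (noise_deriv A S z \<eta> v) c - w c) in sqrt (g y d d) < \<epsilon>))"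

section \<open>Measures, the Markov process and its dual semigroup\<close>

definition measure_support :: "'a::topological_space measure \<Rightarrow> 'a set" where
  "measure_support \<mu> = {x. \<forall>U. open U \<and> x \<in> U \<longrightarrow> emeasure \<mu> U > 0}"

definition orthonormal_basis :: "'i set \<Rightarrow> ('i \<Rightarrow> 'e::real_inner) \<Rightarrow> bool" where
  "orthonormal_basis J \<phi> \<longleftrightarrow>
     (\<forall>i\<in>J. \<forall>j\<in>J. inner (\<phi> i) (\<phi> j) = (if i = j then 1 else 0)) \<and>
     closure (span (\<phi> ` J)) = UNIV"

text \<open>The expansion of the noise in an orthonormal basis with independent coefficients. The index set
  \<open>J\<close> covers both infinite-dimensional and finite-dimensional \<open>E\<close>. The coefficients have to be non-zero:
  for \<open>b = 0\<close> the noise is \<open>\<eta> k = 0\<close>, and $z \mapsto z - z^3 + \eta$ on $[-1/2, 1/2]$ with $\eta = 0$ is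
  controllable to 0 and has surjective derivative in $\eta$, but converges only like $n^{-1/2}$.\<close>

definition decomposable_noise :: "'w measure \<Rightarrow> (nat \<Rightarrow> 'w \<Rightarrow> 'e::real_inner) \<Rightarrow> bool" where
  "decomposable_noise P \<eta> \<longleftrightarrow>
     (\<exists>(J :: nat set) \<phi> (b :: nat \<Rightarrow> real) (\<xi> :: nat \<Rightarrow> nat \<Rightarrow> 'w \<Rightarrow> real) (\<rho> :: nat \<Rightarrow> real \<Rightarrow> real).
        orthonormal_basis J \<phi> \<and>
        (\<forall>j\<in>J. b j \<noteq> 0) \<and> (\<lambda>j. (b j)\<^sup>2) summable_on J \<and>
        prob_space.indep_vars P (\<lambda>_. borel) (\<lambda>(j, k). \<xi> j k) (J \<times> {1..}) \<and>
        (\<forall>j\<in>J. (\<forall>x. 0 \<le> \<rho> j x) \<and> (\<exists>L. L-lipschitz_on UNIV (\<rho> j)) \<and>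
           (\<forall>k\<ge>1. distributed P lborel (\<xi> j k) (\<lambda>x. ennreal (\<rho> j x)))) \<and>
        (\<forall>k\<ge>1. AE \<omega> in P. ((\<lambda>j. (b j * \<xi> j k \<omega>) *\<^sub>R \<phi> j) has_sum \<eta> k \<omega>) J))"

text \<open>\<open>traj S z \<zeta> n\<close> is $S_n(z;\zeta_1,\dots,\zeta_n)$; the value \<open>\<zeta> 0\<close> is not used.\<close>

primrec traj :: "('x \<times> 'e \<Rightarrow> 'x) \<Rightarrow> 'x \<Rightarrow> (nat \<Rightarrow> 'e) \<Rightarrow> nat \<Rightarrow> 'x" where
  "traj S z \<zeta> 0 = z"
| "traj S z \<zeta> (Suc n) = S (traj S z \<zeta> n, \<zeta> (Suc n))"

definition transition ::
    "'w measure \<Rightarrow> (nat \<Rightarrow> 'w \<Rightarrow> 'e) \<Rightarrow> ('x \<times> 'e \<Rightarrow> 'x) \<Rightarrow> nat \<Rightarrow> 'x \<Rightarrow> 'x set \<Rightarrow> ennreal" where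
  "transition P \<eta> S n z \<Gamma> = emeasure P {\<omega> \<in> space P. traj S z (\<lambda>k. \<eta> k \<omega>) n \<in> \<Gamma>}"

definition borel_probs :: "'x::topological_space set \<Rightarrow> 'x measure set" where
  "borel_probs X = {\<mu>. prob_space \<mu> \<and> sets \<mu> = sets (restrict_space borel X)}"

definition dual_semigroup ::
    "'w measure \<Rightarrow> (nat \<Rightarrow> 'w \<Rightarrow> 'e) \<Rightarrow> ('x::topological_space \<times> 'e \<Rightarrow> 'x) \<Rightarrow> 'x set \<Rightarrow>
     nat \<Rightarrow> 'x measure \<Rightarrow> 'x measure" where
  "dual_semigroup P \<eta> S X n \<mu> =
     measure_of X (sets (restrict_space borel X)) (\<lambda>\<Gamma>. \<integral>\<^sup>+ z. transition P \<eta> S n z \<Gamma> \<partial>\<mu>)"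

definition stationary ::
    "'w measure \<Rightarrow> (nat \<Rightarrow> 'w \<Rightarrow> 'e) \<Rightarrow> ('x::topological_space \<times> 'e \<Rightarrow> 'x) \<Rightarrow> 'x set \<Rightarrow> 'x measure \<Rightarrow> bool" where
  "stationary P \<eta> S X \<mu> \<longleftrightarrow> dual_semigroup P \<eta> S X 1 \<mu> = \<mu>"

text \<open>Valued in \<open>ennreal\<close>: the supremum is infinite for functions that are not bounded Lipschitz, and the
  supremum over no pairs at all is 0.\<close>

definition L_norm :: "'x::metric_space set \<Rightarrow> ('x \<Rightarrow> real) \<Rightarrow> ennreal" where
  "L_norm X f =
     (SUP z\<in>X. ennreal \<bar>f z\<bar>) +
     (SUP (z1, z2)\<in>{(z1, z2). z1 \<in> X \<and> z2 \<in> X \<and> 0 < dist z1 z2 \<and> dist z1 z2 \<le> 1}.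
        ennreal (\<bar>f z1 - f z2\<bar> / dist z1 z2))"

definition dual_lipschitz :: "'x::metric_space set \<Rightarrow> 'x measure \<Rightarrow> 'x measure \<Rightarrow> real" where
  "dual_lipschitz X \<mu>1 \<mu>2 =
     (SUP f\<in>{f. L_norm X f \<le> 1}. \<bar>integral\<^sup>L \<mu>1 f - integral\<^sup>L \<mu>2 f\<bar>)"

end

theory Submission
  imports Defs
begin

text \<open>Let \<open>Q f z = \<integral> f (S (z, e)) d\<l>(e)\<close>. The heart of the matter is an inequality of Lasota-Yorke type:
  for every \<open>\<epsilon> > 0\<close> there is \<open>C\<close> with \<open>\<bar>Q f z - Q f z'\<bar> \<le> (C sup \<bar>f\<bar> + \<epsilon> Lip f) d(z, z')\<close>.
  Near a noise value where the derivative in the noise has dense image, a displacement from \<open>z\<close> to \<open>z'\<close>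
  can be compensated up to \<open>\<epsilon> d(z, z')\<close> by a constant shift of the noise. By compactness of the
  embedding finitely many shift directions suffice, and they may be taken in the span of the basis, where
  shifting the noise by \<open>t v\<close> changes expectations by \<open>O(\<bar>t\<bar> sup \<bar>f\<bar>)\<close> because the densities are Lipschitz.
  Lipschitz cutoffs in the noise glue these local estimates; the remaining noise values have small probability.

  With the distance \<open>min 1 (d / \<theta>)\<close> for small \<open>\<theta>\<close>, the inequality makes \<open>Q\<close> contract close points, and
  controllability makes a power of \<open>Q\<close> contract distant ones. Hence the oscillation of \<open>Q^n f\<close> on \<open>X\<close> decays
  exponentially, uniformly over the unit ball of Lipschitz functions, and the limit of \<open>Q^n f\<close> is a
  positive functional, represented by the stationary measure.\<close>

section \<open>Finite-dimensional normed spaces\<close>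

text \<open>Since the noise derivative has only a dense image, a displacement of the state need not
  be compensated exactly, and a remainder proportional to the Lipschitz constant of \<open>f\<close>
  survives every step. Its small factor is what rescues the argument: for the distance
  \<open>min 1 (d / \<theta>)\<close> a test function has Lipschitz constant 1/\<theta> and, after
  subtraction of a constant, supremum at most 1, so with \<epsilon> = 1/4 and C at most
  1/(4\<theta>) the bound becomes d/(2\<theta>). A compensating shift that varied with the noise
  would bring in Jacobians. A shift that is constant near one noise value needs only estimates for
  translations, and the cutoffs pay for its being local. Choosing it from a finite set gives uniform
  constants without any measurable selection. Derivatives live in charts while \<open>dist\<close>
  is an infimum of curve lengths, so the two have to be compared locally. The limit of
  \<open>Q ^^ n\<close> is available on bounded Lipschitz functions, hence the stationary measure is
  constructed from these.\<close>

lemma compact_pointwise: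
  fixes K :: "'a \<Rightarrow> 'b::topological_space set"
  assumes "\<And>i. compact (K i)"
  shows "compact {c. \<forall>i. c i \<in> K i}"
proof -
  have "compactin (product_topology (\<lambda>_. euclidean) UNIV) (Pi\<^sub>E UNIV K)"
    using assms by (subst compactin_PiE) auto
  moreover have "Pi\<^sub>E UNIV K = {c. \<forall>i. c i \<in> K i}" by auto
  ultimately show ?thesis by (simp add: euclidean_product_topology)
qed

text \<open>The norm of a combination attains a minimum on the compact set of coefficient families
  with absolute sum 1, and independence keeps this minimum positive. Scaling then bounds the
  coefficients of every vector.\<close>

lemma representation_bounded:
  fixes B :: "'d::real_normed_vector set"
  assumes B: "finite B" "independent B" "span B = UNIV"
  shows "\<exists>C>0. \<forall>v b. \<bar>representation B v b\<bar> \<le> C * norm v"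
proof -
  define Q where "Q = {c :: 'd \<Rightarrow> real. \<forall>b. c b \<in> (if b \<in> B then {-1..1} else {0})}"
  define S where "S = Q \<inter> {c. (\<Sum>b\<in>B. \<bar>c b\<bar>) = 1}"
  define F where "F = (\<lambda>c :: 'd \<Rightarrow> real. \<Sum>b\<in>B. c b *\<^sub>R b)"
  have contF: "continuous_on UNIV F" unfolding F_def by (intro continuous_intros) auto
  have "compact Q" unfolding Q_def by (rule compact_pointwise) auto
  moreover have "closed {c :: 'd \<Rightarrow> real. (\<Sum>b\<in>B. \<bar>c b\<bar>) = 1}"
    by (intro closed_Collect_eq continuous_intros) auto
  ultimately have "compact S" unfolding S_def by (rule compact_Int_closed)
  have nz: "F c \<noteq> 0" if "c \<in> S" for c
  proof
    assume "F c = 0"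
    then have "\<forall>b\<in>B. c b = 0" using B independentD[of B B c] unfolding F_def by auto
    then have "(\<Sum>b\<in>B. \<bar>c b\<bar>) = 0" by simp
    then show False using that unfolding S_def by simp
  qed
  have "\<exists>m>0. \<forall>c\<in>S. m \<le> norm (F c)"
  proof (cases "S = {}")
    case False
    have "\<exists>c\<in>S. \<forall>y\<in>S. norm (F c) \<le> norm (F y)"
      using \<open>compact S\<close> False contF
      by (intro continuous_attains_inf continuous_intros) (auto intro: continuous_on_subset)
    then show ?thesis using nz by (meson zero_less_norm_iff)
  qed (auto intro: exI[of _ 1])
  then obtain m where m: "m > 0" "\<And>c. c \<in> S \<Longrightarrow> m \<le> norm (F c)" by blast
  have "\<bar>representation B v b\<bar> \<le> (1/m) * norm v" for v b
  proof -
    define c where "c = representation B v"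
    define N where "N = (\<Sum>b\<in>B. \<bar>c b\<bar>)"
    have c0: "c b = 0" if "b \<notin> B" for b
      using that representation_ne_zero unfolding c_def by metis
    have cN: "\<bar>c b\<bar> \<le> N" for b
    proof (cases "b \<in> B")
      case True then show ?thesis unfolding N_def using B(1) by (intro member_le_sum) auto
    qed (auto simp: c0 N_def sum_nonneg)
    have Fc: "F c = v" unfolding F_def c_def using B by (intro sum_representation_eq) auto
    have "N \<le> norm v / m"
    proof (cases "N = 0")
      case False
      then have N: "N > 0" by (smt (verit) N_def sum_nonneg abs_ge_zero)
      have "(\<lambda>b. c b / N) \<in> S"
        using N c0 cN by (auto simp: S_def Q_def abs_le_iff field_simps sum_divide_distrib[symmetric] N_def[symmetric])
           (smt (verit) cN)+
      from m(2)[OF this] have "m \<le> norm (F c) / N"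
        using N unfolding F_def by (simp add: divide_inverse_commute mult.commute
          scaleR_scaleR[symmetric] scaleR_right.sum[symmetric] del: scaleR_scaleR)
      then show ?thesis using N m Fc by (simp add: field_simps)
    qed (use m in auto)
    then show ?thesis using cN[of b] unfolding c_def by simp
  qed
  then show ?thesis using m by (intro exI[of _ "1/m"]) auto
qed

lemma finite_span_basis:
  assumes "finite (B0 :: 'd::real_vector set)" "span B0 = UNIV"
  obtains B where "finite B" "independent B" "span B = (UNIV :: 'd set)"
proof -
  obtain B where "B \<subseteq> B0" "independent B" "B0 \<subseteq> span B"
    using maximal_independent_subset[of B0] by blast
  moreover have "span B = UNIV"
    using assms span_mono[OF \<open>B0 \<subseteq> span B\<close>] by (metis span_span top.extremum_uniqueI)
  ultimately show ?thesis using that finite_subset assms by blast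
qed

text \<open>Heine-Borel from a finite spanning set, which is all that is known of the model space:
  the ball lies in the continuous image of a compact box of coefficients.\<close>

lemma compact_cball_finite_span:
  fixes B0 :: "'d::real_normed_vector set"
  assumes "finite B0" "span B0 = UNIV"
  shows "compact (cball (x::'d) R)"
proof -
  obtain B where B: "finite B" "independent B" "span B = (UNIV :: 'd set)"
    using finite_span_basis assms by blast
  obtain C where C: "C > 0" "\<And>v b. \<bar>representation B v b\<bar> \<le> C * norm v"
    using representation_bounded[OF B] by blast
  define R' where "R' = norm x + \<bar>R\<bar>"
  define Q where "Q = {c :: 'd \<Rightarrow> real. \<forall>b. c b \<in> {-(C * R')..C*R'}}"
  define F where "F = (\<lambda>c :: 'd \<Rightarrow> real. \<Sum>b\<in>B. c b *\<^sub>R b)"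
  have "compact (F ` Q)"
  proof (rule compact_continuous_image)
    show "continuous_on Q F" unfolding F_def
      by (intro continuous_intros continuous_on_subset[OF continuous_on_product_coordinates]) auto
    show "compact Q" unfolding Q_def by (rule compact_pointwise) auto
  qed
  moreover have "cball x R \<subseteq> F ` Q"
  proof
    fix v assume "v \<in> cball x R"
    then have "norm v \<le> R'" unfolding R'_def dist_norm mem_cball
      by (smt (verit) norm_triangle_ineq4 norm_minus_commute norm_triangle_sub)
    then have "C * norm v \<le> C * R'" using C by simp
    then have "representation B v \<in> Q" unfolding Q_def using C(2)[of v]
      by (auto simp: abs_le_iff) (smt (verit))+
    moreover have "F (representation B v) = v"
      unfolding F_def using B by (intro sum_representation_eq) auto
    ultimately show "v \<in> F ` Q" by force
  qed
  ultimately show ?thesis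
    by (metis closed_cball compact_Int_closed inf.absorb2)
qed

text \<open>Expansion in a basis turns continuity in \<open>x\<close> for each fixed pair of vectors
  into joint continuity. At \<open>x0\<close> the bounds come from compactness of the unit sphere.
  They persist nearby because only finitely many coefficients of the form have to stay close, and
  they extend to all vectors by homogeneity.\<close>

lemma
  fixes B0 :: "'d::real_normed_vector set" and q :: "'d \<Rightarrow> 'd \<Rightarrow> 'd \<Rightarrow> real"
  assumes fd: "finite B0" "span B0 = UNIV"
    and V: "open V" "x0 \<in> V"
    and lin: "\<And>x u v w r. x \<in> V \<Longrightarrow> q x (r *\<^sub>R u + v) w = r * q x u w + q x v w"
    and sym: "\<And>x v w. x \<in> V \<Longrightarrow> q x v w = q x w v"
    and pos: "\<And>x v. x \<in> V \<Longrightarrow> v \<noteq> 0 \<Longrightarrow> q x v v > 0"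
    and cont: "\<And>a b. continuous_on V (\<lambda>x. q x a b)"
  shows quadratic_form_bounds: "\<exists>r>0. \<exists>k1>0. \<exists>k2>0. ball x0 r \<subseteq> V \<and>
      (\<forall>x\<in>ball x0 r. \<forall>a. k1 * norm a \<le> sqrt (q x a a) \<and> sqrt (q x a a) \<le> k2 * norm a)"
    and quadratic_form_continuous: "continuous_on (V \<times> UNIV) (\<lambda>(x, a). q x a a)"
proof -
  obtain B where B: "finite B" "independent B" "span B = (UNIV :: 'd set)"
    using finite_span_basis fd by blast
  obtain C where C: "C > 0" "\<And>v b. \<bar>representation B v b\<bar> \<le> C * norm v"
    using representation_bounded[OF B] by blast
  define rp where "rp = representation B"
  have zero: "q x 0 w = 0" if "x \<in> V" for x w
    using lin[OF that, of 1 0 0 w] by simp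
  have lin1: "q x (\<Sum>b\<in>I. f b *\<^sub>R b) w = (\<Sum>b\<in>I. f b * q x b w)" if "x \<in> V" "finite I" for x I f w
    using that(2) by (induction) (auto simp: zero that(1) lin)
  have expand: "q x a a = (\<Sum>b\<in>B. \<Sum>b'\<in>B. rp a b * rp a b' * q x b b')" if x: "x \<in> V" for x a
  proof -
    have a: "(\<Sum>b\<in>B. rp a b *\<^sub>R b) = a"
      unfolding rp_def using B by (intro sum_representation_eq) auto
    have "q x a a = q x (\<Sum>b\<in>B. rp a b *\<^sub>R b) a" by (simp add: a)
    also have "\<dots> = (\<Sum>b\<in>B. rp a b * q x a b)" using lin1 x B sym by simp
    also have "\<dots> = (\<Sum>b\<in>B. rp a b * q x (\<Sum>b'\<in>B. rp a b' *\<^sub>R b') b)" by (simp add: a)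
    also have "\<dots> = (\<Sum>b\<in>B. rp a b * (\<Sum>b'\<in>B. rp a b' * q x b b'))" using lin1 x B sym by simp
    finally show ?thesis by (simp add: sum_distrib_left mult.assoc)
  qed
  have bl: "bounded_linear (\<lambda>a. rp a b)" for b
    using B C unfolding rp_def
    by (intro bounded_linear_intro[of _ C]) (auto simp: representation_add representation_scale mult.commute)
  note crp[continuous_intros] = bounded_linear.continuous_on[OF bl]
  show joint: "continuous_on (V \<times> UNIV) (\<lambda>(x, a). q x a a)"
  proof -
    have "continuous_on (V \<times> UNIV) (\<lambda>y. \<Sum>b\<in>B. \<Sum>b'\<in>B. rp (snd y) b * rp (snd y) b' * q (fst y) b b')"
      by (intro continuous_intros continuous_on_compose2[OF cont]) auto
    then show ?thesis
      by (rule continuous_on_eq) (auto simp: expand)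
  qed
  have hom: "q x (r *\<^sub>R a) (r *\<^sub>R a) = r\<^sup>2 * q x a a" if "x \<in> V" for x r a
    using lin[OF that, of r a 0] lin[OF that, of r a 0 a] sym[OF that] zero[OF that]
    by (simp add: power2_eq_square)
  have qcont: "continuous_on S (\<lambda>a. q x0 a a)" for S
  proof -
    have "continuous_on S (\<lambda>a. (x0, a))" by (intro continuous_intros)
    from continuous_on_compose2[OF joint this] show ?thesis using V by auto
  qed
  define Sp where "Sp = (sphere 0 1 :: 'd set)"
  have cSp: "compact Sp"
  proof -
    have "Sp = cball 0 1 \<inter> {x. norm x = 1}" by (auto simp: Sp_def)
    moreover have "compact (cball (0::'d) 1)" by (rule compact_cball_finite_span[OF fd])
    moreover have "closed {x::'d. norm x = 1}" by (intro closed_Collect_eq continuous_intros)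
    ultimately show ?thesis by (simp add: compact_Int_closed)
  qed
  have "\<exists>m M. m > 0 \<and> M > 0 \<and> (\<forall>a\<in>Sp. m \<le> q x0 a a \<and> q x0 a a \<le> M)"
  \<comment> \<open>In dimension 0 the sphere is empty and any positive \<open>m\<close> and
    \<open>M\<close> will do.\<close>
  proof (cases "Sp = {}")
    case False
    obtain a1 where a1: "a1 \<in> Sp" "\<forall>a\<in>Sp. q x0 a1 a1 \<le> q x0 a a"
      using continuous_attains_inf[OF cSp False qcont] by blast
    obtain a2 where a2: "a2 \<in> Sp" "\<forall>a\<in>Sp. q x0 a a \<le> q x0 a2 a2"
      using continuous_attains_sup[OF cSp False qcont] by blast
    have "q x0 a1 a1 > 0" "q x0 a2 a2 > 0"
      using a1(1) a2(1) by (auto intro!: pos[OF V(2)] simp: Sp_def)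
    then show ?thesis using a1 a2 by blast
  qed (auto intro: exI[of _ 1])
  then obtain m M where mM: "m > 0" "M > 0" "\<And>a. a \<in> Sp \<Longrightarrow> m \<le> q x0 a a \<and> q x0 a a \<le> M" by blast
  \<comment> \<open>On a unit vector the expansions at \<open>x\<close> and at \<open>x0\<close>
    differ by at most the sum of \<open>C * C * d\<close> over all pairs of basis elements, so the
    \<open>d\<close> below limits the change to half of \<open>min m M\<close>. The summand 1 keeps
    \<open>N\<close> positive if \<open>B\<close> is empty.\<close>
  define N where "N = (real (card B))\<^sup>2 * C\<^sup>2 + 1"
  have N: "N > 0" unfolding N_def by (smt (verit) zero_le_power2 mult_nonneg_nonneg)
  define d where "d = min m M / (2 * N)"
  have d: "d > 0" unfolding d_def using mM N by simp
  have "\<forall>\<^sub>F x in nhds x0. \<forall>b\<in>B. \<forall>b'\<in>B. dist (q x b b') (q x0 b b') < d"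
  proof (intro eventually_ball_finite B ballI)
    fix b b'
    have "isCont (\<lambda>x. q x b b') x0" using cont V continuous_on_eq_continuous_at by blast
    then have "((\<lambda>x. q x b b') \<longlongrightarrow> q x0 b b') (nhds x0)"
      using tendsto_at_iff_tendsto_nhds[of "\<lambda>x. q x b b'" x0] by (simp add: isCont_def)
    then show "\<forall>\<^sub>F x in nhds x0. dist (q x b b') (q x0 b b') < d" using d tendstoD by blast
  qed
  moreover have "\<forall>\<^sub>F x in nhds x0. x \<in> V" using V by (rule eventually_nhds_in_open)
  ultimately have "\<forall>\<^sub>F x in nhds x0. x \<in> V \<and> (\<forall>b\<in>B. \<forall>b'\<in>B. dist (q x b b') (q x0 b b') < d)"
    by eventually_elim auto
  then obtain r where r: "r > 0"
      "\<And>x. dist x x0 < r \<Longrightarrow> x \<in> V \<and> (\<forall>b\<in>B. \<forall>b'\<in>B. dist (q x b b') (q x0 b b') < d)"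
    unfolding eventually_nhds_metric by blast
  have main: "m / 2 \<le> q x a a \<and> q x a a \<le> 2 * M" if x: "x \<in> ball x0 r" and a: "a \<in> Sp" for x a
  proof -
    have xV: "x \<in> V" and close: "\<And>b b'. b \<in> B \<Longrightarrow> b' \<in> B \<Longrightarrow> \<bar>q x b b' - q x0 b b'\<bar> \<le> d"
      using r(2)[of x] x by (auto simp: dist_commute[of x] dist_real_def less_imp_le)
    have rpa: "\<bar>rp a b\<bar> \<le> C" for b using C(2)[of a b] a by (simp add: rp_def Sp_def)
    have "\<bar>q x a a - q x0 a a\<bar> = \<bar>\<Sum>b\<in>B. \<Sum>b'\<in>B. rp a b * rp a b' * (q x b b' - q x0 b b')\<bar>"
      using expand[OF xV] expand[OF V(2)] by (simp add: sum_subtractf right_diff_distrib)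
    also have "\<dots> \<le> (\<Sum>b\<in>B. \<bar>\<Sum>b'\<in>B. rp a b * rp a b' * (q x b b' - q x0 b b')\<bar>)" by (rule sum_abs)
    also have "\<dots> \<le> (\<Sum>b\<in>B. \<Sum>b'\<in>B. C * C * d)"
    proof (intro sum_mono order.trans[OF sum_abs])
      fix b b' assume b: "b \<in> B" "b' \<in> B"
      have "\<bar>rp a b\<bar> * \<bar>rp a b'\<bar> \<le> C * C" using rpa C by (intro mult_mono) auto
      then show "\<bar>rp a b * rp a b' * (q x b b' - q x0 b b')\<bar> \<le> C * C * d"
        unfolding abs_mult by (rule mult_mono) (use close[OF b] C in auto)
    qed
    also have "\<dots> = (real (card B))\<^sup>2 * C\<^sup>2 * d" by (simp add: power2_eq_square mult.assoc)
    also have "\<dots> \<le> N * d" using d by (simp add: N_def)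
    also have "\<dots> = min m M / 2" using N by (simp add: d_def)
    finally have "\<bar>q x a a - q x0 a a\<bar> \<le> min m M / 2" .
    then show ?thesis using mM(3)[OF a] mM(1,2) by linarith
  qed
  have "sqrt (m/2) * norm a \<le> sqrt (q x a a) \<and> sqrt (q x a a) \<le> sqrt (2*M) * norm a"
    if x: "x \<in> ball x0 r" for x a
  proof (cases "a = 0")
    case True
    have "x \<in> V" using r(2)[of x] x by (auto simp: dist_commute)
    with True show ?thesis by (simp add: zero)
  next
    case False
    have xV: "x \<in> V" using r(2)[of x] x by (auto simp: dist_commute)
    define e where "e = (1 / norm a) *\<^sub>R a"
    have "e \<in> Sp" using False by (simp add: e_def Sp_def)
    moreover have "a = norm a *\<^sub>R e" using False by (simp add: e_def)
    then have "q x a a = (norm a)\<^sup>2 * q x e e" using hom[OF xV] by metis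
    then have "sqrt (q x a a) = norm a * sqrt (q x e e)" by (simp add: real_sqrt_mult)
    ultimately show ?thesis using main[OF x, of e] by (simp add: mult.commute mult_left_mono)
  qed
  moreover have "ball x0 r \<subseteq> V" using r(2) by (auto simp: dist_commute)
  ultimately show "\<exists>r>0. \<exists>k1>0. \<exists>k2>0. ball x0 r \<subseteq> V \<and>
      (\<forall>x\<in>ball x0 r. \<forall>a. k1 * norm a \<le> sqrt (q x a a) \<and> sqrt (q x a a) \<le> k2 * norm a)"
    using r(1) mM by (intro exI[of _ r] conjI exI[of _ "sqrt (m/2)"] exI[of _ "sqrt (2*M)"]) auto
qed

section \<open>Charts and the Riemannian distance\<close>

locale smooth_manifold =
  fixes A :: "('m::metric_space, 'd::real_normed_vector) chart set"
  assumes atlas: "smooth_atlas A"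
begin

lemma finite_dim: "\<exists>B::'d set. finite B \<and> span B = UNIV"
  using atlas by (simp add: smooth_atlas_def)

lemma chart_exists: "\<exists>c\<in>A. p \<in> fst c"
  using atlas by (auto simp: smooth_atlas_def)

lemma chart_facts:
  assumes "c \<in> A"
  shows open_dom: "open (fst c)" and open_coords: "open (snd c ` fst c)"
    and continuous_chart: "continuous_on (fst c) (snd c)"
    and continuous_chart_inv: "continuous_on (snd c ` fst c) (chart_inv c)"
    and chart_inv_left: "\<And>p. p \<in> fst c \<Longrightarrow> chart_inv c (snd c p) = p"
  using atlas assms by (auto simp: smooth_atlas_def homeomorphism_def)

lemma chart_inv_right:
  assumes "c \<in> A" "x \<in> snd c ` fst c"
  shows "snd c (chart_inv c x) = x" "chart_inv c x \<in> fst c"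
  using chart_inv_left[OF assms(1)] assms(2) by force+

definition transition_deriv where
  "transition_deriv c c' p = frechet_derivative (snd c' \<circ> chart_inv c) (at (snd c p))"

lemma transition_has_derivative:
  assumes "c \<in> A" "c' \<in> A" "p \<in> fst c" "p \<in> fst c'"
  shows "((snd c' \<circ> chart_inv c) has_derivative transition_deriv c c' p) (at (snd c p))"
proof -
  have "Ck_on (Suc 0) (snd c' \<circ> chart_inv c) (snd c ` (fst c \<inter> fst c'))"
    using atlas assms unfolding smooth_atlas_def smooth_on_def by blast
  then have "(snd c' \<circ> chart_inv c) differentiable (at (snd c p))" using assms by auto
  then show ?thesis by (simp add: transition_deriv_def frechet_derivative_works)
qed

lemma transition_deriv_continuous:
  assumes "c \<in> A" "c' \<in> A"
  shows "continuous_on (snd c ` (fst c \<inter> fst c')) (\<lambda>x. frechet_derivative (snd c' \<circ> chart_inv c) (at x) v)"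
proof -
  have "Ck_on (Suc 0) (snd c' \<circ> chart_inv c) (snd c ` (fst c \<inter> fst c'))"
    using atlas assms unfolding smooth_atlas_def smooth_on_def by blast
  then show ?thesis by simp
qed

text \<open>The chain rule for a change of chart, in a form that serves transition maps, curves and
  the dependence on the noise alike. Continuity of \<open>\<psi>\<close> is required because
  \<open>chart_inv c\<close> inverts the chart only as long as \<open>\<psi>\<close> stays in its
  domain.\<close>

lemma chart_change_derivative:
  assumes c: "c \<in> A" "c' \<in> A" "\<psi> t \<in> fst c" "\<psi> t \<in> fst c'"
    and D: "((\<lambda>s. snd c (\<psi> s)) has_derivative D) (at t within T)"
    and cont: "continuous (at t within T) \<psi>" and t: "t \<in> T"
  shows "((\<lambda>s. snd c' (\<psi> s)) has_derivative (\<lambda>v. transition_deriv c c' (\<psi> t) (D v))) (at t within T)"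
proof -
  have 1: "((\<lambda>s. (snd c' \<circ> chart_inv c) (snd c (\<psi> s))) has_derivative
      (\<lambda>v. transition_deriv c c' (\<psi> t) (D v))) (at t within T)"
    by (rule has_derivative_compose[OF D transition_has_derivative]) (use c in auto)
  have "\<forall>\<^sub>F s in at t within T. \<psi> s \<in> fst c"
    using cont open_dom[OF c(1)] c(3) by (auto simp: continuous_within intro: topological_tendstoD)
  then have "\<forall>\<^sub>F s in at t within T. (snd c' \<circ> chart_inv c) (snd c (\<psi> s)) = snd c' (\<psi> s)"
    by eventually_elim (simp add: chart_inv_left c)
  then show ?thesis
    by (rule has_derivative_transform_eventually[OF 1]) (simp_all add: chart_inv_left c t)
qed

lemma transition_deriv_linear:
  assumes "c \<in> A" "c' \<in> A" "p \<in> fst c" "p \<in> fst c'"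
  shows "bounded_linear (transition_deriv c c' p)"
  using transition_has_derivative[OF assms] has_derivative_bounded_linear by blast

lemma transition_deriv_self:
  assumes "c \<in> A" "p \<in> fst c"
  shows "transition_deriv c c p a = a"
proof -
  have "\<forall>\<^sub>F x in nhds (snd c p). x \<in> snd c ` fst c"
    using open_coords assms by (intro eventually_nhds_in_open) auto
  then have "\<forall>\<^sub>F x in at (snd c p). x = (snd c \<circ> chart_inv c) x"
    unfolding eventually_at_filter by eventually_elim (auto simp: chart_inv_right assms)
  then have "((snd c \<circ> chart_inv c) has_derivative (\<lambda>x. x)) (at (snd c p))"
    by (rule has_derivative_transform_eventually[OF has_derivative_ident])
       (simp_all add: chart_inv_left assms)
  then show ?thesis
    using has_derivative_unique transition_has_derivative[OF assms(1,1,2,2)] by metis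
qed

lemma chart_inv_isCont:
  assumes "c \<in> A" "p \<in> fst c"
  shows "isCont (chart_inv c) (snd c p)"
  using continuous_chart_inv[OF assms(1)] open_coords[OF assms(1)] assms(2)
  by (auto simp: continuous_on_eq_continuous_at)

text \<open>The cocycle rule; it is what makes the families \<open>tangent_vec\<close> satisfy the
  compatibility condition in \<open>tangent_space\<close>.\<close>

lemma transition_deriv_trans:
  assumes "c \<in> A" "c1 \<in> A" "c2 \<in> A" "p \<in> fst c" "p \<in> fst c1" "p \<in> fst c2"
  shows "transition_deriv c c2 p a = transition_deriv c1 c2 p (transition_deriv c c1 p a)"
proof -
  have "((\<lambda>x. snd c1 (chart_inv c x)) has_derivative transition_deriv c c1 p) (at (snd c p))"
    using transition_has_derivative[of c c1 p] assms by (simp add: o_def)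
  then have "((\<lambda>x. snd c2 (chart_inv c x)) has_derivative
      (\<lambda>v. transition_deriv c1 c2 (chart_inv c (snd c p)) (transition_deriv c c1 p v))) (at (snd c p))"
    by (rule chart_change_derivative[rotated 4])
       (use assms chart_inv_isCont in \<open>auto simp: chart_inv_left\<close>)
  moreover have "((\<lambda>x. snd c2 (chart_inv c x)) has_derivative transition_deriv c c2 p) (at (snd c p))"
    using transition_has_derivative[of c c2 p] assms by (simp add: o_def)
  ultimately show ?thesis
    using has_derivative_unique assms by (metis chart_inv_left)
qed

lemma tangent_vec_apply:
  "c' \<in> A \<Longrightarrow> p \<in> fst c' \<Longrightarrow> tangent_vec A c p a c' = transition_deriv c c' p a"
  by (simp add: tangent_vec_def charts_at_def transition_deriv_def)

lemma tangent_vec_outside: "c' \<notin> charts_at A p \<Longrightarrow> tangent_vec A c p a c' = 0"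
  by (simp add: tangent_vec_def)

lemma tangent_vec_in_tangent_space:
  assumes "c \<in> A" "p \<in> fst c"
  shows "tangent_vec A c p a \<in> tangent_space A p"
  unfolding tangent_space_def
proof (intro CollectI conjI allI ballI impI)
  fix c1 c2 assume "c1 \<in> charts_at A p" "c2 \<in> charts_at A p"
  then have *: "c1 \<in> A" "p \<in> fst c1" "c2 \<in> A" "p \<in> fst c2" by (auto simp: charts_at_def)
  show "tangent_vec A c p a c2 =
      frechet_derivative (snd c2 \<circ> chart_inv c1) (at (snd c1 p)) (tangent_vec A c p a c1)"
    using transition_deriv_trans[OF assms(1) *(1,3) assms(2) *(2,4)] *
    by (simp only: tangent_vec_apply transition_deriv_def)
qed (rule tangent_vec_outside)

lemma tangent_space_eq:
  assumes "c \<in> A" "p \<in> fst c" "v \<in> tangent_space A p"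
  shows "v = tangent_vec A c p (v c)"
proof
  fix c'
  have "c \<in> charts_at A p" using assms by (simp add: charts_at_def)
  show "v c' = tangent_vec A c p (v c) c'"
  proof (cases "c' \<in> charts_at A p")
    case True
    then have "v c' = frechet_derivative (snd c' \<circ> chart_inv c) (at (snd c p)) (v c)"
      using assms(3) \<open>c \<in> charts_at A p\<close> unfolding tangent_space_def by blast
    with True show ?thesis by (simp add: tangent_vec_def)
  next
    case False
    then have "v c' = 0" using assms(3) unfolding tangent_space_def by blast
    with False show ?thesis by (simp add: tangent_vec_def)
  qed
qed

lemma tangent_vec_linear:
  assumes "c \<in> A" "p \<in> fst c"
  shows "tangent_vec A c p (r *\<^sub>R a + b) = (\<lambda>c'. r *\<^sub>R tangent_vec A c p a c' + tangent_vec A c p b c')"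
proof
  fix c'
  show "tangent_vec A c p (r *\<^sub>R a + b) c' = r *\<^sub>R tangent_vec A c p a c' + tangent_vec A c p b c'"
  proof (cases "c' \<in> charts_at A p")
    case True
    then have c': "c' \<in> A" "p \<in> fst c'" by (auto simp: charts_at_def)
    interpret bounded_linear "transition_deriv c c' p" by (rule transition_deriv_linear) (use assms c' in auto)
    show ?thesis using c' by (simp add: tangent_vec_apply add scale)
  qed (simp add: tangent_vec_outside)
qed

end

section \<open>The Riemannian metric in coordinates\<close>

locale riemannian_mfd = smooth_manifold A for A :: "('m::metric_space, 'd::real_normed_vector) chart set" +
  fixes g :: "'m \<Rightarrow> (('m, 'd) chart \<Rightarrow> 'd) \<Rightarrow> (('m, 'd) chart \<Rightarrow> 'd) \<Rightarrow> real"
  assumes metric: "riemannian_metric A g"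
    and dist_Inf: "\<And>x y. path_lengths A g x y \<noteq> {} \<Longrightarrow> dist x y = Inf (path_lengths A g x y)"
begin

lemma metric_sym: "v \<in> tangent_space A p \<Longrightarrow> w \<in> tangent_space A p \<Longrightarrow> g p v w = g p w v"
  using metric unfolding riemannian_metric_def by blast

lemma metric_lin:
  "u \<in> tangent_space A p \<Longrightarrow> v \<in> tangent_space A p \<Longrightarrow> w \<in> tangent_space A p \<Longrightarrow>
    g p (\<lambda>c. r *\<^sub>R u c + v c) w = r * g p u w + g p v w"
  using metric unfolding riemannian_metric_def by blast

text \<open>The metric tensor in the chart \<open>c\<close>, as a form on the model space; this
  brings the finite-dimensional estimates to bear on \<open>g\<close>.\<close>

definition gram where
  "gram c x a b = g (chart_inv c x) (tangent_vec A c (chart_inv c x) a) (tangent_vec A c (chart_inv c x) b)"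

lemma gram_lin:
  assumes "c \<in> A" "x \<in> snd c ` fst c"
  shows "gram c x (r *\<^sub>R u + v) w = r * gram c x u w + gram c x v w"
proof -
  note p = assms(1) chart_inv_right(2)[OF assms]
  show ?thesis unfolding gram_def tangent_vec_linear[OF p]
    by (rule metric_lin) (rule tangent_vec_in_tangent_space[OF p])+
qed

lemma gram_sym:
  assumes "c \<in> A" "x \<in> snd c ` fst c"
  shows "gram c x v w = gram c x w v"
  unfolding gram_def by (rule metric_sym) (rule tangent_vec_in_tangent_space[OF assms(1) chart_inv_right(2)[OF assms]])+

lemma gram_pos:
  assumes "c \<in> A" "x \<in> snd c ` fst c" "v \<noteq> 0"
  shows "gram c x v v > 0"
proof -
  let ?p = "chart_inv c x"
  have p: "?p \<in> fst c" using assms chart_inv_right by auto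
  have "tangent_vec A c ?p v c = v"
    using assms(1) p by (simp add: tangent_vec_apply transition_deriv_self)
  then have "tangent_vec A c ?p v \<noteq> (\<lambda>c. 0)" using assms(3) by metis
  then show ?thesis
    using metric tangent_vec_in_tangent_space[OF assms(1) p, of v]
    unfolding gram_def riemannian_metric_def by blast
qed

lemma gram_continuous:
  assumes "c \<in> A" shows "continuous_on (snd c ` fst c) (\<lambda>x. gram c x a b)"
proof -
  have "Ck_on 0 (\<lambda>x. gram c x a b) (snd c ` fst c)"
    using metric assms unfolding gram_def riemannian_metric_def smooth_on_def by blast
  then show ?thesis by simp
qed

lemma gram_bounds:
  assumes "c \<in> A" "p \<in> fst c"
  shows "\<exists>r>0. \<exists>k1>0. \<exists>k2>0. ball (snd c p) r \<subseteq> snd c ` fst c \<and>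
      (\<forall>x\<in>ball (snd c p) r. \<forall>a. k1 * norm a \<le> sqrt (gram c x a a) \<and> sqrt (gram c x a a) \<le> k2 * norm a)"
proof -
  obtain B :: "'d set" where "finite B" "span B = UNIV" using finite_dim by blast
  then show ?thesis
    by (rule quadratic_form_bounds)
       (use assms in \<open>auto intro: open_coords gram_lin gram_sym gram_pos gram_continuous\<close>)
qed

lemma gram_joint_continuous:
  assumes "c \<in> A" "p \<in> fst c"
  shows "continuous_on (snd c ` fst c \<times> UNIV) (\<lambda>(x, a). gram c x a a)"
proof -
  obtain B :: "'d set" where "finite B" "span B = UNIV" using finite_dim by blast
  then show ?thesis
    by (rule quadratic_form_continuous[of _ _ "snd c p"])
       (use assms in \<open>auto intro: open_coords gram_lin gram_sym gram_pos gram_continuous\<close>)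
qed

text \<open>Density in \<open>noise_deriv_dense\<close> is measured by \<open>g\<close>; this
  converts it to density in coordinates.\<close>

lemma tangent_norm_lower:
  assumes "c \<in> A" "p \<in> fst c"
  shows "\<exists>k>0. \<forall>w\<in>tangent_space A p. k * norm (w c) \<le> sqrt (g p w w)"
proof -
  obtain r k1 where "r > 0" "k1 > 0"
      "\<And>x a. x\<in>ball (snd c p) r \<Longrightarrow> k1 * norm a \<le> sqrt (gram c x a a)"
    using gram_bounds[OF assms] by blast
  then have k: "k1 > 0" "\<And>a. k1 * norm a \<le> sqrt (gram c (snd c p) a a)" by auto
  have "k1 * norm (w c) \<le> sqrt (g p w w)" if "w \<in> tangent_space A p" for w
    using k(2)[of "w c"] tangent_space_eq[OF assms that] assms by (simp add: gram_def chart_inv_left)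
  then show ?thesis using k by blast
qed

section \<open>Speed and length of curves\<close>

definition speed where "speed \<gamma> a b t = sqrt (g (\<gamma> t) (velocity A \<gamma> a b t) (velocity A \<gamma> a b t))"

lemma curve_chart_derivative:
  assumes "C1_curve A \<gamma> a b" "c \<in> A" "t \<in> {a..b}" "\<gamma> t \<in> fst c"
  shows "((\<lambda>s. snd c (\<gamma> s)) has_vector_derivative vector_derivative (snd c \<circ> \<gamma>) (at t within {a..b}))
           (at t within {a..b})"
proof -
  have "(snd c \<circ> \<gamma>) differentiable (at t within {a..b})"
    using assms unfolding C1_curve_def by blast
  then show ?thesis by (simp add: vector_derivative_works o_def)
qed

text \<open>The coordinate velocities of a curve follow the transition rule by the chain rule. With
  \<open>a < b\<close> the derivative within the interval is unique also at the end points, where it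
  is one-sided.\<close>

lemma velocity_eq:
  assumes C: "C1_curve A \<gamma> a b" "a < b" and c: "c \<in> A" "t \<in> {a..b}" "\<gamma> t \<in> fst c"
  shows "velocity A \<gamma> a b t = tangent_vec A c (\<gamma> t) (vector_derivative (snd c \<circ> \<gamma>) (at t within {a..b}))"
proof
  fix c'
  let ?v = "\<lambda>c. vector_derivative (snd c \<circ> \<gamma>) (at t within {a..b})"
  show "velocity A \<gamma> a b t c' = tangent_vec A c (\<gamma> t) (?v c) c'"
  proof (cases "c' \<in> charts_at A (\<gamma> t)")
    case True
    then have c': "c' \<in> A" "\<gamma> t \<in> fst c'" by (auto simp: charts_at_def)
    have "((\<lambda>s. snd c (\<gamma> s)) has_derivative (\<lambda>x. x *\<^sub>R ?v c)) (at t within {a..b})"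
      using curve_chart_derivative[OF C(1) c] by (simp add: has_vector_derivative_def)
    then have "((\<lambda>s. snd c' (\<gamma> s)) has_derivative (\<lambda>x. transition_deriv c c' (\<gamma> t) (x *\<^sub>R ?v c))) (at t within {a..b})"
      using C c c' by (intro chart_change_derivative)
         (auto simp: C1_curve_def continuous_on_eq_continuous_within)
    moreover have "transition_deriv c c' (\<gamma> t) (x *\<^sub>R ?v c) = x *\<^sub>R transition_deriv c c' (\<gamma> t) (?v c)" for x
      using transition_deriv_linear[OF c(1) c'(1) c(3) c'(2)] by (simp add: bounded_linear.linear linear_scale)
    ultimately have "((snd c' \<circ> \<gamma>) has_vector_derivative transition_deriv c c' (\<gamma> t) (?v c)) (at t within {a..b})"
      by (simp add: has_vector_derivative_def o_def)
    then have "?v c' = transition_deriv c c' (\<gamma> t) (?v c)"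
      using C(2) c(2) vector_derivative_within_cbox[of a b t] by simp
    then show ?thesis using True c' by (simp add: velocity_def tangent_vec_apply)
  qed (simp add: velocity_def tangent_vec_outside)
qed

lemma speed_eq:
  assumes "C1_curve A \<gamma> a b" "a < b" "c \<in> A" "t \<in> {a..b}" "\<gamma> t \<in> fst c"
  shows "speed \<gamma> a b t = sqrt (gram c (snd c (\<gamma> t)) (vector_derivative (snd c \<circ> \<gamma>) (at t within {a..b}))
           (vector_derivative (snd c \<circ> \<gamma>) (at t within {a..b})))"
  unfolding speed_def gram_def using assms by (simp add: velocity_eq[OF assms] chart_inv_left)

lemma gram_nonneg: "c \<in> A \<Longrightarrow> x \<in> snd c ` fst c \<Longrightarrow> 0 \<le> gram c x v v"
  using gram_pos[of c x v] gram_lin[of c x 1 0 0 0] by (cases "v = 0") auto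

lemma speed_nonneg:
  assumes "C1_curve A \<gamma> a b" "a < b" "t \<in> {a..b}"
  shows "0 \<le> speed \<gamma> a b t"
proof -
  obtain c where "c \<in> A" "\<gamma> t \<in> fst c" using chart_exists by blast
  then show ?thesis using speed_eq[OF assms(1,2) _ assms(3)] gram_nonneg by auto
qed

lemma speed_continuous:
  assumes C: "C1_curve A \<gamma> a b" "a < b"
  shows "continuous_on {a..b} (speed \<gamma> a b)"
  unfolding continuous_on_eq_continuous_within
proof
  fix t0 assume t0: "t0 \<in> {a..b}"
  obtain c where c: "c \<in> A" "\<gamma> t0 \<in> fst c" using chart_exists by blast
  let ?v = "\<lambda>t. vector_derivative (snd c \<circ> \<gamma>) (at t within {a..b})"
  let ?N = "{t\<in>{a..b}. \<gamma> t \<in> fst c}"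
  have cg: "continuous_on {a..b} \<gamma>" and cv: "continuous_on ?N ?v"
    using C c by (auto simp: C1_curve_def)
  have "continuous_on ?N (\<lambda>t. (snd c (\<gamma> t), ?v t))"
    by (intro continuous_on_Pair cv continuous_on_compose2[OF continuous_chart[OF c(1)]]
        continuous_on_subset[OF cg]) auto
  then have "continuous_on ?N (\<lambda>t. case (snd c (\<gamma> t), ?v t) of (x, a) \<Rightarrow> gram c x a a)"
    by (rule continuous_on_compose2[OF gram_joint_continuous[OF c]]) auto
  then have "continuous_on ?N (\<lambda>t. sqrt (gram c (snd c (\<gamma> t)) (?v t) (?v t)))"
    by (auto intro: continuous_on_real_sqrt)
  then have "continuous_on ?N (speed \<gamma> a b)"
    by (rule continuous_on_eq) (auto simp: speed_eq[OF C c(1)])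
  then have 1: "continuous (at t0 within ?N) (speed \<gamma> a b)"
    using t0 c by (auto simp: continuous_on_eq_continuous_within)
  \<comment> \<open>\<open>?N\<close> is relatively open in the interval, so continuity within
    \<open>?N\<close> at \<open>t0\<close> is continuity within the whole interval.\<close>
  obtain U where U: "open U" "U \<inter> {a..b} = \<gamma> -` fst c \<inter> {a..b}"
    using cg open_dom[OF c(1)] unfolding continuous_on_open_invariant by blast
  have "{a..b} \<inter> U = ?N \<inter> U" using U(2) by blast
  moreover have "t0 \<in> U" using U(2) t0 c(2) by blast
  ultimately have "at t0 within {a..b} = at t0 within ?N"
    using at_within_nhd[of t0 U "{a..b}" ?N] U(1) by simp
  then show "continuous (at t0 within {a..b}) (speed \<gamma> a b)" using 1 by simp
qed

text \<open>Bisection: increments of \<open>u\<close> are subadditive and the integral of the speed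
  is additive, so the bound passes from adjacent intervals to their union, and it is enough to have
  it around each time.\<close>

lemma curve_length_lower:
  assumes C: "C1_curve A \<gamma> a b" "a < b"
    and loc: "\<And>t0. t0 \<in> {a..b} \<Longrightarrow> \<exists>d>0. \<forall>s t. a \<le> s \<and> s \<le> t0 \<and> t0 \<le> t \<and> t \<le> b \<and> t - s < d \<longrightarrow>
        k * \<bar>u (\<gamma> t) - u (\<gamma> s)\<bar> \<le> integral {s..t} (speed \<gamma> a b)"
    and k: "k \<ge> 0"
  shows "k * \<bar>u (\<gamma> b) - u (\<gamma> a)\<bar> \<le> curve_length A g \<gamma> a b"
proof -
  define Pr where "Pr = (\<lambda>s t. a \<le> s \<and> t \<le> b \<longrightarrow> k * \<bar>u (\<gamma> t) - u (\<gamma> s)\<bar> \<le> integral {s..t} (speed \<gamma> a b))"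
  have "Pr a b"
  proof (rule Bolzano)
    show "a \<le> b" using C by simp
  next
    fix x y z assume *: "Pr x y" "Pr y z" "x \<le> y" "y \<le> z"
    show "Pr x z" unfolding Pr_def
    proof
      assume xz: "a \<le> x \<and> z \<le> b"
      have "speed \<gamma> a b integrable_on {x..z}"
        using xz * by (intro integrable_continuous_interval continuous_on_subset[OF speed_continuous[OF C]]) auto
      then have "integral {x..y} (speed \<gamma> a b) + integral {y..z} (speed \<gamma> a b) = integral {x..z} (speed \<gamma> a b)"
        using * by (intro Henstock_Kurzweil_Integration.integral_combine) auto
      moreover have "k * \<bar>u (\<gamma> z) - u (\<gamma> x)\<bar> \<le> k * \<bar>u (\<gamma> y) - u (\<gamma> x)\<bar> + k * \<bar>u (\<gamma> z) - u (\<gamma> y)\<bar>"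
        using k by (simp add: distrib_left[symmetric] mult_left_mono)
      ultimately show "k * \<bar>u (\<gamma> z) - u (\<gamma> x)\<bar> \<le> integral {x..z} (speed \<gamma> a b)"
        using * xz unfolding Pr_def by linarith
    qed
  next
    fix x assume "a \<le> x" "x \<le> b"
    then obtain d where "d > 0" "\<forall>s t. a \<le> s \<and> s \<le> x \<and> x \<le> t \<and> t \<le> b \<and> t - s < d \<longrightarrow>
        k * \<bar>u (\<gamma> t) - u (\<gamma> s)\<bar> \<le> integral {s..t} (speed \<gamma> a b)" using loc[of x] by auto
    then show "\<exists>d>0. \<forall>s t. s \<le> x \<and> x \<le> t \<and> t - s < d \<longrightarrow> Pr s t"
      unfolding Pr_def by blast
  qed
  then show ?thesis unfolding Pr_def curve_length_def speed_def[abs_def] by simp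
qed

lemma curve_length_nonneg:
  assumes C: "C1_curve A \<gamma> a b" "a < b"
  shows "0 \<le> curve_length A g \<gamma> a b"
proof -
  have "0 \<le> integral {a..b} (speed \<gamma> a b)"
    using speed_nonneg[OF C] speed_continuous[OF C]
    by (intro Henstock_Kurzweil_Integration.integral_nonneg integrable_continuous_interval) auto
  then show ?thesis by (simp add: curve_length_def speed_def[abs_def])
qed

text \<open>A mean value inequality: by \<open>kb\<close> the coordinate velocity is at most the
  speed divided by \<open>k\<close>, so the primitive of the latter dominates the curve read in the
  chart.\<close>

lemma speed_chart_bound:
  assumes C: "C1_curve A \<gamma> a b" "a < b" and c: "c \<in> A" and k: "k > 0"
    and st: "a \<le> s" "s \<le> t" "t \<le> b"
    and W: "\<And>\<tau>. \<tau> \<in> {s..t} \<Longrightarrow> \<gamma> \<tau> \<in> fst c"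
    and kb: "\<And>\<tau> v. \<tau> \<in> {s..t} \<Longrightarrow> k * norm v \<le> sqrt (gram c (snd c (\<gamma> \<tau>)) v v)"
  shows "k * norm (snd c (\<gamma> t) - snd c (\<gamma> s)) \<le> integral {s..t} (speed \<gamma> a b)"
proof (cases "s = t")
  case False
  let ?v = "\<lambda>t. vector_derivative (snd c \<circ> \<gamma>) (at t within {a..b})"
  let ?F = "\<lambda>\<tau>. integral {s..\<tau>} (speed \<gamma> a b) / k"
  have sc: "continuous_on {s..t} (speed \<gamma> a b)"
    by (rule continuous_on_subset[OF speed_continuous[OF C]]) (use st in auto)
  have FD: "(?F has_vector_derivative speed \<gamma> a b x / k) (at x within {s..t})" if "x \<in> {s..t}" for x
  proof -
    have "((\<lambda>\<tau>. integral {s..\<tau>} (speed \<gamma> a b)) has_real_derivative speed \<gamma> a b x) (at x within {s..t})"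
      using integral_has_real_derivative[OF sc that] .
    from DERIV_cdivide[OF this, of k] show ?thesis
      by (simp add: has_real_derivative_iff_has_vector_derivative)
  qed
  have "norm (snd c (\<gamma> t) - snd c (\<gamma> s)) \<le> ?F t - ?F s"
  proof (rule differentiable_bound_general[where f' = ?v and \<phi>' = "\<lambda>x. speed \<gamma> a b x / k"])
    show "s < t" using False st by simp
    show "continuous_on {s..t} (\<lambda>a. snd c (\<gamma> a))"
    proof (rule continuous_on_compose2[OF continuous_chart[OF c]])
      have "continuous_on {a..b} \<gamma>" using C by (simp add: C1_curve_def)
      then show "continuous_on {s..t} \<gamma>" by (rule continuous_on_subset) (use st in auto)
    qed (use W in auto)
    show "continuous_on {s..t} ?F"
      using FD has_vector_derivative_continuous continuous_on_eq_continuous_within by blast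
    fix x assume x: "s < x" "x < t"
    then have xab: "x \<in> {a..b}" "at x within {a..b} = at x" "at x within {s..t} = at x"
      using st by (auto intro!: at_within_Icc_at)
    show "((\<lambda>a. snd c (\<gamma> a)) has_vector_derivative ?v x) (at x)"
      using curve_chart_derivative[OF C(1) c xab(1)] W x unfolding xab by auto
    show "(?F has_vector_derivative speed \<gamma> a b x / k) (at x)" using FD[of x] x xab by auto
    show "norm (?v x) \<le> speed \<gamma> a b x / k"
      using kb[of x "?v x"] speed_eq[OF C c xab(1)] W[of x] x k by (simp add: field_simps)
  qed
  then show ?thesis using k by (simp add: field_simps)
qed auto

text \<open>Coordinate segments are the competitors that bound the distance from above. Being a
  \<open>C1_curve\<close> refers to every chart of the atlas, so the velocity is computed through
  transition derivatives.\<close>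

lemma straight_curve:
  assumes c: "c \<in> A" and seg: "closed_segment x y \<subseteq> snd c ` fst c"
  defines "\<gamma> \<equiv> \<lambda>t. chart_inv c (x + t *\<^sub>R (y - x))"
  shows "C1_curve A \<gamma> 0 1"
    and "t \<in> {0..1} \<Longrightarrow> vector_derivative (snd c \<circ> \<gamma>) (at t within {0..1}) = y - x"
proof -
  let ?l = "\<lambda>t. x + t *\<^sub>R (y - x)"
  have l: "?l t \<in> snd c ` fst c" if "t \<in> {0..1}" for t
  proof -
    have "?l t = (1 - t) *\<^sub>R x + t *\<^sub>R y" by (simp add: algebra_simps)
    then have "?l t \<in> closed_segment x y" using that unfolding closed_segment_def by force
    then show ?thesis using seg by blast
  qed
  have gc: "\<gamma> t \<in> fst c" "snd c (\<gamma> t) = ?l t" if "t \<in> {0..1}" for t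
    using chart_inv_right[OF c l[OF that]] by (auto simp: \<gamma>_def)
  have cg: "continuous_on {0..1} \<gamma>" unfolding \<gamma>_def
    by (rule continuous_on_compose2[OF continuous_chart_inv[OF c]]) (use l in \<open>auto intro!: continuous_intros\<close>)
  have dc: "((\<lambda>s. snd c (\<gamma> s)) has_derivative (\<lambda>s. s *\<^sub>R (y - x))) (at t within {0..1})" if "t \<in> {0..1}" for t
  proof (rule has_derivative_transform[OF that])
    show "(?l has_derivative (\<lambda>s. s *\<^sub>R (y - x))) (at t within {0..1})"
      by (auto intro!: derivative_eq_intros)
  qed (use gc in auto)
  have vd: "((snd c' \<circ> \<gamma>) has_vector_derivative transition_deriv c c' (\<gamma> t) (y - x)) (at t within {0..1})"
    if t: "t \<in> {0..1}" and c': "c' \<in> A" "\<gamma> t \<in> fst c'" for t c'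
  proof -
    have "((\<lambda>s. snd c' (\<gamma> s)) has_derivative (\<lambda>v. transition_deriv c c' (\<gamma> t) (v *\<^sub>R (y - x)))) (at t within {0..1})"
      by (rule chart_change_derivative[OF c c'(1) _ c'(2) dc[OF t]])
         (use t gc cg in \<open>auto simp: continuous_on_eq_continuous_within\<close>)
    moreover have "transition_deriv c c' (\<gamma> t) (v *\<^sub>R (y - x)) = v *\<^sub>R transition_deriv c c' (\<gamma> t) (y - x)" for v
      using transition_deriv_linear[OF c c'(1) gc(1)[OF t] c'(2)] by (simp add: bounded_linear.linear linear_scale)
    ultimately show ?thesis by (simp add: has_vector_derivative_def o_def)
  qed
  have vdeq: "vector_derivative (snd c' \<circ> \<gamma>) (at t within {0..1}) = transition_deriv c c' (\<gamma> t) (y - x)"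
    if t: "t \<in> {0..1}" and c': "c' \<in> A" "\<gamma> t \<in> fst c'" for t c'
    using vd[OF that] t vector_derivative_within_cbox[of 0 1 t] by simp
  show "t \<in> {0..1} \<Longrightarrow> vector_derivative (snd c \<circ> \<gamma>) (at t within {0..1}) = y - x"
    using vdeq[of t c] gc c by (auto simp: transition_deriv_self)
  show "C1_curve A \<gamma> 0 1" unfolding C1_curve_def
  proof (intro conjI cg ballI impI)
    fix c' t assume "c' \<in> A" "t \<in> {0..1::real}" "\<gamma> t \<in> fst c'"
    then show "(snd c' \<circ> \<gamma>) differentiable at t within {0..1}"
      using vd by (meson differentiableI_vector)
  next
    fix c' assume c': "c' \<in> A"
    let ?N = "{t \<in> {0..1}. \<gamma> t \<in> fst c'}"
    have "continuous_on ?N (\<lambda>t. frechet_derivative (snd c' \<circ> chart_inv c) (at (?l t)) (y - x))"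
    proof (rule continuous_on_compose2[OF transition_deriv_continuous[OF c c'], of _ "?l"])
      show "?l ` ?N \<subseteq> snd c ` (fst c \<inter> fst c')"
      proof
        fix z assume "z \<in> ?l ` ?N"
        then obtain t where t: "t \<in> {0..1}" "\<gamma> t \<in> fst c'" "z = ?l t" by blast
        then have "z = snd c (\<gamma> t)" "\<gamma> t \<in> fst c \<inter> fst c'" using gc by auto
        then show "z \<in> snd c ` (fst c \<inter> fst c')" by blast
      qed
    qed (auto intro!: continuous_intros)
    then show "continuous_on ?N (\<lambda>t. vector_derivative (snd c' \<circ> \<gamma>) (at t within {0..1}))"
      by (rule continuous_on_eq) (auto simp: vdeq c' transition_deriv_def gc)
  qed
qed

text \<open>The lower bound on path lengths tracks the truncated coordinate distance to the starting point,
  which is locally constant where the path has left the chart.\<close>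

lemma path_length_lower:
  assumes c: "c \<in> A" and k: "k > 0" and rho: "\<rho> > 0"
    and sub: "ball x0 (2 * \<rho>) \<subseteq> snd c ` fst c"
    and kb: "\<And>x a. x \<in> ball x0 (2 * \<rho>) \<Longrightarrow> k * norm a \<le> sqrt (gram c x a a)"
    and xy: "x \<in> fst c" "y \<in> fst c" "snd c x \<in> ball x0 (\<rho> / 2)" "snd c y \<in> ball x0 (\<rho> / 2)"
    and L: "L \<in> path_lengths A g x y"
  shows "k * norm (snd c x - snd c y) \<le> L"
proof -
  define W where "W = fst c \<inter> snd c -` ball x0 (2 * \<rho>)"
  have oW: "open W" unfolding W_def
    using continuous_chart[OF c] open_dom[OF c] by (metis continuous_open_preimage open_ball)
  \<comment> \<open>\<open>K\<close> is compact, hence closed. A curve that is outside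
    \<open>W\<close> at some time therefore stays outside \<open>K\<close> for a while, and there
    \<open>u\<close> has the constant value \<rho>; this is how curves that leave the chart are
    handled.\<close>
  define K where "K = chart_inv c ` cball (snd c x) \<rho>"
  have cb: "cball (snd c x) \<rho> \<subseteq> ball x0 (2 * \<rho>)"
  proof
    fix z assume "z \<in> cball (snd c x) \<rho>"
    then show "z \<in> ball x0 (2 * \<rho>)"
      using xy(3) rho dist_triangle[of x0 z "snd c x"] by simp
  qed
  obtain B :: "'d set" where B: "finite B" "span B = UNIV" using finite_dim by blast
  have "compact K" unfolding K_def
    using cb sub by (intro compact_continuous_image compact_cball_finite_span[OF B]
        continuous_on_subset[OF continuous_chart_inv[OF c]]) auto
  then have oK: "open (- K)" by (simp add: compact_imp_closed open_Compl)
  have KW: "q \<in> W" if "q \<in> K" for q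
    using that cb sub c chart_inv_right[OF c] unfolding K_def W_def by (auto simp: subset_iff)
  \<comment> \<open>The end points lie within \<open>\<rho> / 2\<close> of \<open>x0\<close>, so
    their coordinate distance is below \<rho> and the truncation is inactive at \<open>y\<close>.
    The ball of radius \<rho> about \<open>snd c x\<close> still lies in the ball of radius
    \<open>2 * \<rho>\<close> on which \<open>kb\<close> holds.\<close>
  define u where "u = (\<lambda>q. if q \<in> W then min (norm (snd c q - snd c x)) \<rho> else \<rho>)"
  have u_out: "u q = \<rho>" if "q \<notin> K" for q
  proof -
    have "\<rho> \<le> norm (snd c q - snd c x)" if "q \<in> W"
    proof (rule ccontr)
      assume "\<not> ?thesis"
      then have "snd c q \<in> cball (snd c x) \<rho>" by (simp add: dist_norm norm_minus_commute)
      moreover have "chart_inv c (snd c q) = q" using that c by (simp add: W_def chart_inv_left)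
      ultimately show False using \<open>q \<notin> K\<close> unfolding K_def by force
    qed
    then show ?thesis by (simp add: u_def)
  qed
  have piece: "k * \<bar>u (\<gamma> b) - u (\<gamma> a)\<bar> \<le> curve_length A g \<gamma> a b"
    if C: "C1_curve A \<gamma> a b" "a < b" for \<gamma> a b
  proof (rule curve_length_lower[OF C])
    fix t0 assume t0: "t0 \<in> {a..b}"
    have cg: "continuous_on {a..b} \<gamma>" using C by (simp add: C1_curve_def)
    have nb: "\<exists>d>0. \<forall>t\<in>{a..b}. \<bar>t - t0\<bar> < d \<longrightarrow> \<gamma> t \<in> U" if "open U" "\<gamma> t0 \<in> U" for U
    proof -
      obtain V where V: "open V" "V \<inter> {a..b} = \<gamma> -` U \<inter> {a..b}"
        using cg \<open>open U\<close> unfolding continuous_on_open_invariant by blast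
      have "t0 \<in> \<gamma> -` U \<inter> {a..b}" using t0 that(2) by simp
      then have "t0 \<in> V" unfolding V(2)[symmetric] by blast
      have VU: "\<gamma> t \<in> U" if "t \<in> V" "t \<in> {a..b}" for t using V(2) that by blast
      from \<open>t0 \<in> V\<close> obtain d where "d > 0" "\<forall>t. dist t t0 < d \<longrightarrow> t \<in> V" using V(1) by (meson open_dist)
      then show ?thesis using VU by (auto simp: dist_real_def)
    qed
    show "\<exists>d>0. \<forall>s t. a \<le> s \<and> s \<le> t0 \<and> t0 \<le> t \<and> t \<le> b \<and> t - s < d \<longrightarrow>
        k * \<bar>u (\<gamma> t) - u (\<gamma> s)\<bar> \<le> integral {s..t} (speed \<gamma> a b)"
    proof (cases "\<gamma> t0 \<in> W")
      case True
      then obtain d where d: "d > 0" "\<And>t. t \<in> {a..b} \<Longrightarrow> \<bar>t - t0\<bar> < d \<Longrightarrow> \<gamma> t \<in> W"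
        using nb[OF oW] by blast
      have "k * \<bar>u (\<gamma> t) - u (\<gamma> s)\<bar> \<le> integral {s..t} (speed \<gamma> a b)"
        if st: "a \<le> s" "s \<le> t0" "t0 \<le> t" "t \<le> b" "t - s < d" for s t
      proof -
        have W: "\<gamma> \<tau> \<in> W" if "\<tau> \<in> {s..t}" for \<tau> using d(2)[of \<tau>] that st by auto
        have "k * norm (snd c (\<gamma> t) - snd c (\<gamma> s)) \<le> integral {s..t} (speed \<gamma> a b)"
          by (rule speed_chart_bound[OF C c k]) (use st W kb in \<open>auto simp: W_def\<close>)
        moreover have "\<bar>u (\<gamma> t) - u (\<gamma> s)\<bar> \<le> norm (snd c (\<gamma> t) - snd c (\<gamma> s))"
        proof -
          have "\<bar>norm (snd c (\<gamma> t) - snd c x) - norm (snd c (\<gamma> s) - snd c x)\<bar>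
              \<le> norm (snd c (\<gamma> t) - snd c (\<gamma> s))"
            using norm_triangle_ineq3[of "snd c (\<gamma> t) - snd c x" "snd c (\<gamma> s) - snd c x"] by simp
          then show ?thesis using W[of s] W[of t] st by (simp add: u_def)
        qed
        ultimately show ?thesis using k by (meson less_imp_le mult_left_mono order_trans)
      qed
      then show ?thesis using d(1) by blast
    next
      case False
      then have "\<gamma> t0 \<in> - K" using KW by auto
      then obtain d where d: "d > 0" "\<And>t. t \<in> {a..b} \<Longrightarrow> \<bar>t - t0\<bar> < d \<Longrightarrow> \<gamma> t \<in> - K"
        using nb[OF oK] by blast
      have "k * \<bar>u (\<gamma> t) - u (\<gamma> s)\<bar> \<le> integral {s..t} (speed \<gamma> a b)"
        if st: "a \<le> s" "s \<le> t0" "t0 \<le> t" "t \<le> b" "t - s < d" for s t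
      proof -
        have "u (\<gamma> t) = \<rho>" "u (\<gamma> s) = \<rho>" using d(2)[of s] d(2)[of t] st by (auto intro!: u_out)
        moreover have "0 \<le> integral {s..t} (speed \<gamma> a b)"
          using speed_nonneg[OF C] st
          by (intro Henstock_Kurzweil_Integration.integral_nonneg integrable_continuous_interval
              continuous_on_subset[OF speed_continuous[OF C]]) auto
        ultimately show ?thesis by simp
      qed
      then show ?thesis using d(1) by blast
    qed
  qed (use k in auto)
  obtain \<gamma> \<tau> n where P: "L = (\<Sum>i<n. curve_length A g \<gamma> (\<tau> i) (\<tau> (Suc i)))" "\<gamma> (\<tau> 0) = x" "\<gamma> (\<tau> n) = y"
      "\<And>i. i < n \<Longrightarrow> \<tau> i < \<tau> (Suc i) \<and> C1_curve A \<gamma> (\<tau> i) (\<tau> (Suc i))"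
    using L unfolding path_lengths_def by auto
  have "k * \<bar>u (\<gamma> (\<tau> j)) - u (\<gamma> (\<tau> 0))\<bar> \<le> (\<Sum>i<j. curve_length A g \<gamma> (\<tau> i) (\<tau> (Suc i)))" if "j \<le> n" for j
    using that
  proof (induction j)
    case (Suc j)
    have "k * \<bar>u (\<gamma> (\<tau> (Suc j))) - u (\<gamma> (\<tau> 0))\<bar>
        \<le> k * \<bar>u (\<gamma> (\<tau> (Suc j))) - u (\<gamma> (\<tau> j))\<bar> + k * \<bar>u (\<gamma> (\<tau> j)) - u (\<gamma> (\<tau> 0))\<bar>"
      using k by (simp add: distrib_left[symmetric] mult_left_mono)
    then show ?case using piece[of \<gamma> "\<tau> j" "\<tau> (Suc j)"] P(4)[of j] Suc by auto
  qed simp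
  from this[of n] have "k * \<bar>u y - u x\<bar> \<le> L" using P by simp
  moreover have "u x = 0" "u y = norm (snd c y - snd c x)"
  proof -
    have "norm (snd c y - snd c x) < \<rho>" using xy(3,4)
      by (metis dist_norm mem_ball dist_triangle_half_l dist_commute norm_minus_commute)
    moreover have "x \<in> W" "y \<in> W" using xy rho unfolding W_def by auto
    ultimately show "u x = 0" "u y = norm (snd c y - snd c x)" using rho by (auto simp: u_def)
  qed
  ultimately show ?thesis by (simp add: norm_minus_commute)
qed

text \<open>The coordinate segment bounds the distance from above and also shows that the set of
  path lengths is nonempty, as \<open>dist_Inf\<close> demands; \<open>path_length_lower\<close>
  bounds every competitor from below. The radius \<open>r / 4\<close> comes from applying the latter
  with \<rho> = \<open>r / 2\<close>.\<close>

lemma chart_bilipschitz: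
  assumes c: "c \<in> A" "p \<in> fst c"
  shows "\<exists>r>0. \<exists>C>0. ball (snd c p) r \<subseteq> snd c ` fst c \<and>
     (\<forall>x\<in>fst c. \<forall>y\<in>fst c. snd c x \<in> ball (snd c p) r \<longrightarrow> snd c y \<in> ball (snd c p) r \<longrightarrow>
        dist x y \<le> C * norm (snd c x - snd c y) \<and> norm (snd c x - snd c y) \<le> C * dist x y)"
proof -
  obtain r k1 k2 where r: "r > 0" "k1 > 0" "k2 > 0" "ball (snd c p) r \<subseteq> snd c ` fst c"
    and kb: "\<And>x a. x\<in>ball (snd c p) r \<Longrightarrow> k1 * norm a \<le> sqrt (gram c x a a)"
      "\<And>x a. x\<in>ball (snd c p) r \<Longrightarrow> sqrt (gram c x a a) \<le> k2 * norm a"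
    using gram_bounds[OF c] by blast
  have main: "dist x y \<le> k2 * norm (snd c x - snd c y) \<and> norm (snd c x - snd c y) \<le> dist x y / k1"
    if xy: "x \<in> fst c" "y \<in> fst c" "snd c x \<in> ball (snd c p) (r/4)" "snd c y \<in> ball (snd c p) (r/4)" for x y
  proof -
    let ?x = "snd c x" and ?y = "snd c y"
    define \<gamma> where "\<gamma> = (\<lambda>t. chart_inv c (?x + t *\<^sub>R (?y - ?x)))"
    have xyr: "?x \<in> ball (snd c p) r" "?y \<in> ball (snd c p) r" using xy r by auto
    have seg: "closed_segment ?x ?y \<subseteq> ball (snd c p) r" using closed_segment_subset[OF xyr convex_ball] .
    have seg': "closed_segment ?x ?y \<subseteq> snd c ` fst c" using seg r by blast
    note C = straight_curve[OF c(1) seg', folded \<gamma>_def]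
    have "curve_length A g \<gamma> 0 1 \<le> k2 * norm (?x - ?y)"
    proof -
      have "speed \<gamma> 0 1 t \<le> k2 * norm (?x - ?y)" if t: "t \<in> {0..1}" for t
      proof -
        have "?x + t *\<^sub>R (?y - ?x) = (1 - t) *\<^sub>R ?x + t *\<^sub>R ?y" by (simp add: algebra_simps)
        then have l: "?x + t *\<^sub>R (?y - ?x) \<in> closed_segment ?x ?y"
          using t unfolding closed_segment_def by force
        then have "\<gamma> t \<in> fst c" "snd c (\<gamma> t) = ?x + t *\<^sub>R (?y - ?x)"
          using chart_inv_right[OF c(1)] seg' unfolding \<gamma>_def by auto
        then show ?thesis
          using speed_eq[OF C(1) _ c(1) t] C(2)[OF t] l seg kb(2)[of "?x + t *\<^sub>R (?y - ?x)" "?y - ?x"]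
          by (auto simp: norm_minus_commute)
      qed
      then have "integral {0..1} (speed \<gamma> 0 1) \<le> integral {0..1} (\<lambda>_::real. k2 * norm (?x - ?y))"
        by (intro Henstock_Kurzweil_Integration.integral_le integrable_continuous_interval
            speed_continuous[OF C(1)] continuous_on_const) auto
      then show ?thesis by (simp add: curve_length_def speed_def[abs_def])
    qed
    moreover have mem: "curve_length A g \<gamma> 0 1 \<in> path_lengths A g x y"
    proof -
      have "\<gamma> 0 = x" "\<gamma> 1 = y" using xy c by (auto simp: \<gamma>_def chart_inv_left)
      then show ?thesis unfolding path_lengths_def mem_Collect_eq
        using C(1) by (intro exI[of _ \<gamma>] exI[of _ real] exI[of _ 1]) auto
    qed
    moreover have bdd: "bdd_below (path_lengths A g x y)"
    proof (rule bdd_belowI[of _ 0])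
      fix L assume "L \<in> path_lengths A g x y"
      then show "0 \<le> L" unfolding path_lengths_def by (auto intro!: sum_nonneg curve_length_nonneg)
    qed
    moreover have ne: "path_lengths A g x y \<noteq> {}" using mem by blast
    ultimately have 1: "dist x y \<le> k2 * norm (?x - ?y)"
      using dist_Inf[OF ne] cInf_lower[OF mem bdd] by linarith
    have "k1 * norm (?x - ?y) \<le> dist x y" unfolding dist_Inf[OF ne]
    proof (rule cInf_greatest[OF ne])
      fix L assume L: "L \<in> path_lengths A g x y"
      show "k1 * norm (?x - ?y) \<le> L"
        by (rule path_length_lower[where ?x0.0 = "snd c p" and \<rho> = "r/2"]) (use c r kb xy L in auto)
    qed
    with 1 show ?thesis using r by (simp add: field_simps)
  qed
  define C where "C = max k2 (1/k1)"
  have C: "C > 0" "k2 \<le> C" "1/k1 \<le> C" using r by (auto simp: C_def)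
  have "dist x y \<le> C * norm (snd c x - snd c y) \<and> norm (snd c x - snd c y) \<le> C * dist x y"
    if xy: "x \<in> fst c" "y \<in> fst c" "snd c x \<in> ball (snd c p) (r/4)" "snd c y \<in> ball (snd c p) (r/4)" for x y
  proof
    show "dist x y \<le> C * norm (snd c x - snd c y)"
      using main[OF xy] C(2) by (meson mult_right_mono norm_ge_zero order_trans)
    have "dist x y / k1 \<le> C * dist x y" using mult_right_mono[OF C(3), of "dist x y"] by simp
    then show "norm (snd c x - snd c y) \<le> C * dist x y" using main[OF xy] by linarith
  qed
  moreover have "ball (snd c p) (r/4) \<subseteq> snd c ` fst c"
    using r(4) by (rule order_trans[rotated]) (use r(1) in \<open>simp add: subset_ball\<close>)
  moreover have "r/4 > 0" using r by simp
  ultimately show ?thesis using C(1) by blast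
qed

end

section \<open>Local linearization\<close>

lemma open_Collect_mem:
  assumes "open U" "continuous_on UNIV f" shows "open {x. f x \<in> U}"
  using open_vimage[OF assms] by (simp add: vimage_def)

text \<open>After subtraction of the linear map \<open>D a\<close> the derivative has norm at most
  \<epsilon> on a small ball, and the mean value inequality applies to any two of its points.
  Differentiability at \<open>a\<close> alone would only compare points with
  \<open>a\<close>.\<close>

lemma strict_derivative:
  fixes f :: "'a::real_normed_vector \<Rightarrow> 'b::real_normed_vector" and D :: "'a \<Rightarrow> 'a \<Rightarrow>\<^sub>L 'b"
  assumes \<Omega>: "open \<Omega>" "a \<in> \<Omega>" and D: "\<And>p. p \<in> \<Omega> \<Longrightarrow> (f has_derivative blinfun_apply (D p)) (at p)"
    and cont: "isCont D a" and \<epsilon>: "\<epsilon> > 0"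
  shows "\<exists>r>0. ball a r \<subseteq> \<Omega> \<and> (\<forall>p\<in>ball a r. \<forall>p'\<in>ball a r.
    norm (f p' - f p - D a (p' - p)) \<le> \<epsilon> * norm (p' - p))"
proof -
  obtain r1 where r1: "r1 > 0" "ball a r1 \<subseteq> \<Omega>" using \<Omega> by (meson open_contains_ball)
  obtain r2 where r2: "r2 > 0" "\<And>p. dist p a < r2 \<Longrightarrow> dist (D p) (D a) < \<epsilon>"
    using cont \<epsilon> unfolding continuous_at_eps_delta by blast
  define r where "r = min r1 r2"
  have r: "r > 0" "ball a r \<subseteq> \<Omega>" using r1 r2 by (auto simp: r_def)
  have "norm (f p' - f p - D a (p' - p)) \<le> \<epsilon> * norm (p' - p)" if p: "p \<in> ball a r" "p' \<in> ball a r" for p p'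
  proof -
    have "norm ((f p' - D a p') - (f p - D a p)) \<le> \<epsilon> * norm (p' - p)"
    proof (rule differentiable_bound[where S = "ball a r" and f' = "\<lambda>x. blinfun_apply (D x - D a)"])
      fix x assume x: "x \<in> ball a r"
      have "((\<lambda>p. f p - D a p) has_derivative (\<lambda>h. D x h - D a h)) (at x within ball a r)"
        using x r by (intro has_derivative_diff has_derivative_at_withinI[OF D]
            bounded_linear_imp_has_derivative[OF blinfun.bounded_linear_right]) auto
      then show "((\<lambda>p. f p - D a p) has_derivative blinfun_apply (D x - D a)) (at x within ball a r)"
        by (simp add: minus_blinfun.rep_eq)
      show "onorm (blinfun_apply (D x - D a)) \<le> \<epsilon>"
        using r2(2)[of x] x by (auto simp: r_def dist_norm norm_blinfun.rep_eq[symmetric] dist_commute[of a] norm_minus_commute[of a])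
    qed (use p in auto)
    then show ?thesis by (simp add: blinfun.diff_right algebra_simps)
  qed
  then show ?thesis using r by blast
qed

section \<open>The random map in coordinates\<close>

definition coord_diff :: "('m, 'd::real_normed_vector) chart \<Rightarrow> 'h::real_normed_vector \<times> 'm \<Rightarrow> 'h \<times> 'm \<Rightarrow> 'h \<times> 'd" where
  "coord_diff c z z' = (fst z' - fst z, snd c (snd z') - snd c (snd z))"

locale smooth_system = riemannian_mfd A g
  for A :: "('m::metric_space, 'd::real_normed_vector) chart set" and g +
  fixes S :: "('h::{real_inner, banach} \<times> 'm) \<times> 'e::{real_inner, banach} \<Rightarrow> 'h \<times> 'm"
    and \<iota> :: "'v::{real_inner, banach} \<Rightarrow> 'h" and F :: "('h \<times> 'm) \<times> 'e \<Rightarrow> 'v \<times> 'm"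
  assumes S_cont: "continuous_on UNIV S"
    and emb: "compact_embedding \<iota>" and S_F: "\<And>w. S w = (\<iota> (fst (F w)), snd (F w))"
    and C2: "C2_bounded A F"
begin

lemma iota_linear: "bounded_linear \<iota>"
  using emb by (simp add: compact_embedding_def)

text \<open>Derivatives take their values in the smaller space \<open>'v\<close>, where boundedness
  will yield compactness; \<open>jmap\<close> reads these values in \<open>'h\<close>, where
  distances are measured.\<close>

definition jmap :: "'v \<times> 'd \<Rightarrow> 'h \<times> 'd" where "jmap p = (\<iota> (fst p), snd p)"

lemma jmap_linear: "bounded_linear jmap"
  unfolding jmap_def
  by (intro bounded_linear_Pair bounded_linear_compose[OF iota_linear] bounded_linear_fst bounded_linear_snd)

lemma open_coord_dom:
  assumes c: "c \<in> A" "c' \<in> A"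
  shows "open (coord_dom F c c')"
proof -
  define V where "V = {p :: ('h \<times> 'd) \<times> 'e. snd (fst p) \<in> snd c ` fst c}"
  define \<psi> where "\<psi> = (\<lambda>p :: ('h \<times> 'd) \<times> 'e. snd (S ((fst (fst p), chart_inv c (snd (fst p))), snd p)))"
  have V: "open V" unfolding V_def
    using open_coords[OF c(1)] by (intro open_Collect_mem continuous_intros) auto
  have "continuous_on V \<psi>" unfolding \<psi>_def
    by (intro continuous_intros continuous_on_compose2[OF S_cont] continuous_on_compose2[OF continuous_chart_inv[OF c(1)]])
       (auto simp: V_def)
  then have "open (V \<inter> \<psi> -` fst c')" using V open_dom[OF c(2)] by (rule continuous_open_preimage)
  moreover have "coord_dom F c c' = V \<inter> \<psi> -` fst c'"
    by (auto simp: coord_dom_def V_def \<psi>_def S_F)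
  ultimately show ?thesis by simp
qed

definition linearization :: "_ \<Rightarrow> _ \<Rightarrow> _ \<Rightarrow> _ \<Rightarrow> ((('h \<times> 'd) \<times> 'e) \<Rightarrow>\<^sub>L ('v \<times> 'd)) \<Rightarrow> bool" where
  "linearization c c' z0 \<eta>0 T \<longleftrightarrow>
     (coord_rep F c c' has_derivative blinfun_apply T) (at ((fst z0, snd c (snd z0)), \<eta>0))"

text \<open>Links the intrinsic \<open>noise_deriv\<close> with the derivative \<open>T\<close> of
  the coordinate representation: \<open>T\<close> is evaluated on pure noise directions, and its
  manifold component in the chart \<open>c'\<close> determines the whole tangent vector.\<close>

lemma linearization_noise_deriv:
  assumes c: "c \<in> A" "c' \<in> A" "snd z0 \<in> fst c" "snd (S (z0, \<eta>0)) \<in> fst c'"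
    and T: "linearization c c' z0 \<eta>0 T"
  shows "fst (noise_deriv A S z0 \<eta>0 v) = \<iota> (fst (T ((0, 0), v)))"
    and "snd (noise_deriv A S z0 \<eta>0 v) = tangent_vec A c' (snd (S (z0, \<eta>0))) (snd (T ((0, 0), v)))"
proof -
  let ?y = "snd (S (z0, \<eta>0))"
  let ?in = "\<lambda>e. ((fst z0, snd c (snd z0)), e)"
  have "(?in has_derivative (\<lambda>v. ((0, 0), v))) (at \<eta>0)"
    by (auto intro!: derivative_eq_intros simp: zero_prod_def)
  from has_derivative_compose[OF this] T
  have 1: "((\<lambda>e. coord_rep F c c' (?in e)) has_derivative (\<lambda>v. T ((0, 0), v))) (at \<eta>0)"
    unfolding linearization_def by blast
  have rep: "coord_rep F c c' (?in e) = (fst (F (z0, e)), snd c' (snd (S (z0, e))))" for e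
    using c by (simp add: coord_rep_def chart_inv_left Let_def S_F)
  have "((\<lambda>e. fst (F (z0, e))) has_derivative (\<lambda>v. fst (T ((0, 0), v)))) (at \<eta>0)"
    using has_derivative_fst[OF 1] by (simp add: rep)
  from bounded_linear.has_derivative[OF iota_linear this]
  have "((\<lambda>e. fst (S (z0, e))) has_derivative (\<lambda>v. \<iota> (fst (T ((0, 0), v))))) (at \<eta>0)"
    by (simp add: S_F)
  from frechet_derivative_at[OF this]
  show "fst (noise_deriv A S z0 \<eta>0 v) = \<iota> (fst (T ((0, 0), v)))"
    by (simp add: noise_deriv_def fun_eq_iff)
  have 2: "((\<lambda>e. snd c' (snd (S (z0, e)))) has_derivative (\<lambda>v. snd (T ((0, 0), v)))) (at \<eta>0)"
    using has_derivative_snd[OF 1] by (simp add: rep)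
  have cont: "isCont (\<lambda>e. snd (S (z0, e))) \<eta>0"
  proof -
    have "continuous_on UNIV (\<lambda>e. snd (S (z0, e)))"
      by (intro continuous_intros continuous_on_compose2[OF S_cont]) auto
    then show ?thesis by (simp add: continuous_on_eq_continuous_at)
  qed
  show "snd (noise_deriv A S z0 \<eta>0 v) = tangent_vec A c' ?y (snd (T ((0, 0), v)))"
  proof
    fix c2
    show "snd (noise_deriv A S z0 \<eta>0 v) c2 = tangent_vec A c' ?y (snd (T ((0, 0), v))) c2"
    proof (cases "c2 \<in> charts_at A ?y")
      case True
      then have c2: "c2 \<in> A" "?y \<in> fst c2" by (auto simp: charts_at_def)
      have "((\<lambda>e. snd c2 (snd (S (z0, e)))) has_derivative
          (\<lambda>v. transition_deriv c' c2 ?y (snd (T ((0, 0), v))))) (at \<eta>0)"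
        using chart_change_derivative[OF c(2) c2(1) c(4) c2(2) 2] cont by auto
      from frechet_derivative_at[OF this] show ?thesis
        using True c2 by (simp add: noise_deriv_def tangent_vec_apply fun_eq_iff)
    qed (simp add: noise_deriv_def tangent_vec_outside)
  qed
qed

lemma linearization_dense:
  assumes c: "c \<in> A" "c' \<in> A" "snd z0 \<in> fst c" "snd (S (z0, \<eta>0)) \<in> fst c'"
    and T: "linearization c c' z0 \<eta>0 T"
    and dense: "noise_deriv_dense A g S z0 \<eta>0" and \<epsilon>: "\<epsilon> > 0"
  shows "\<exists>v. norm (jmap (T ((0, 0), v)) - y) < \<epsilon>"
proof -
  let ?y = "snd (S (z0, \<eta>0))"
  obtain k where k: "k > 0" "\<And>w. w \<in> tangent_space A ?y \<Longrightarrow> k * norm (w c') \<le> sqrt (g ?y w w)"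
    using tangent_norm_lower[OF c(2,4)] by blast
  \<comment> \<open>Both components get the share \<epsilon>/2; the factor \<open>k\<close> converts
    the norm given by \<open>g\<close> into the coordinate norm.\<close>
  define \<delta> where "\<delta> = min (\<epsilon>/2) (k * \<epsilon>/2)"
  have \<delta>: "\<delta> > 0" using \<epsilon> k by (simp add: \<delta>_def)
  have lin: "tangent_vec A c' ?y a c'' - tangent_vec A c' ?y b c'' = tangent_vec A c' ?y (a - b) c''" for a b c''
    using fun_cong[OF tangent_vec_linear[OF c(2,4), of "-1" b a], of c''] by simp
  have "tangent_vec A c' ?y (snd y) \<in> tangent_space A ?y"
    using c by (intro tangent_vec_in_tangent_space)
  then obtain v where v: "norm (fst (noise_deriv A S z0 \<eta>0 v) - fst y) < \<delta>"
      "sqrt (g ?y (\<lambda>c. snd (noise_deriv A S z0 \<eta>0 v) c - tangent_vec A c' ?y (snd y) c)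
                 (\<lambda>c. snd (noise_deriv A S z0 \<eta>0 v) c - tangent_vec A c' ?y (snd y) c)) < \<delta>"
    using dense \<delta> unfolding noise_deriv_dense_def Let_def by blast
  let ?a = "snd (T ((0, 0), v)) - snd y"
  note nd = linearization_noise_deriv[OF c T]
  have "(\<lambda>c. snd (noise_deriv A S z0 \<eta>0 v) c - tangent_vec A c' ?y (snd y) c) = tangent_vec A c' ?y ?a"
    unfolding nd by (simp add: lin)
  then have "sqrt (g ?y (tangent_vec A c' ?y ?a) (tangent_vec A c' ?y ?a)) < \<delta>" using v(2) by simp
  moreover have "k * norm (tangent_vec A c' ?y ?a c') \<le> sqrt (g ?y (tangent_vec A c' ?y ?a) (tangent_vec A c' ?y ?a))"
    using c by (intro k tangent_vec_in_tangent_space)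
  moreover have "tangent_vec A c' ?y ?a c' = ?a" using c by (simp add: tangent_vec_apply transition_deriv_self)
  ultimately have "k * norm ?a < k * \<epsilon>/2" unfolding \<delta>_def by simp
  then have "norm ?a < \<epsilon>/2" using k by simp
  moreover have "norm (\<iota> (fst (T ((0, 0), v))) - fst y) < \<epsilon>/2" using v(1) unfolding nd \<delta>_def by simp
  moreover have "norm (jmap (T ((0, 0), v)) - y) \<le> norm (\<iota> (fst (T ((0, 0), v))) - fst y) + norm ?a"
    using norm_Pair_le[of "\<iota> (fst (T ((0, 0), v))) - fst y" ?a] by (cases y) (simp add: jmap_def)
  ultimately show ?thesis by (intro exI[of _ v]) simp
qed

text \<open>The order of quantifiers matters: \<open>T\<close> and \<open>C\<close> are chosen once
  and only the radius depends on \<epsilon>, so that a finite set of shifts can later be fixed in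
  terms of \<open>T\<close> and \<open>C\<close> before the accuracy is. Strict differentiability
  allows both states and both noise values to vary.\<close>

lemma local_linearization:
  assumes c: "c \<in> A" "c' \<in> A" "snd z0 \<in> fst c" "snd (S (z0, \<eta>0)) \<in> fst c'"
  shows "\<exists>T C. linearization c c' z0 \<eta>0 T \<and> C > 0 \<and>
    (\<forall>\<epsilon>>0. \<exists>r>0. \<forall>z\<in>ball z0 r. \<forall>z'\<in>ball z0 r. norm (coord_diff c z z') \<le> C * dist z z' \<and>
       (\<forall>\<eta>\<in>ball \<eta>0 r. \<forall>\<eta>'\<in>ball \<eta>0 r. dist (S (z, \<eta>)) (S (z', \<eta>')) \<le>
         C * (norm (jmap (T (coord_diff c z z', \<eta>' - \<eta>))) + \<epsilon> * (dist z z' + norm (\<eta>' - \<eta>)))))"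
proof -
  define y0 where "y0 = snd (S (z0, \<eta>0))"
  define \<Omega> where "\<Omega> = coord_dom F c c'"
  define \<pi> where "\<pi> = (\<lambda>z e. ((fst z, snd c (snd z)), e) :: ('h \<times> 'd) \<times> 'e)"
  obtain D1 D2 where D: "\<And>p. p\<in>\<Omega> \<Longrightarrow> (coord_rep F c c' has_derivative blinfun_apply (D1 p)) (at p)"
      "\<And>p. p\<in>\<Omega> \<Longrightarrow> (D1 has_derivative blinfun_apply (D2 p)) (at p)"
    using bspec[OF bspec[OF C2[unfolded C2_bounded_def] c(1)] c(2)] unfolding \<Omega>_def
    by (elim exE conjE) blast
  have o\<Omega>: "open \<Omega>" using open_coord_dom c by (simp add: \<Omega>_def)
  have \<pi>0: "\<pi> z0 \<eta>0 \<in> \<Omega>"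
    using c by (auto simp: \<Omega>_def \<pi>_def coord_dom_def chart_inv_left S_F)
  define T where "T = D1 (\<pi> z0 \<eta>0)"
  have T: "linearization c c' z0 \<eta>0 T" using D(1)[OF \<pi>0] by (simp add: linearization_def T_def \<pi>_def)
  have contD: "isCont D1 (\<pi> z0 \<eta>0)" using D(2)[OF \<pi>0] by (rule has_derivative_continuous)
  obtain r1 C1 where r1: "r1 > 0" "C1 > 0"
    and b1: "\<And>x y. x \<in> fst c \<Longrightarrow> y \<in> fst c \<Longrightarrow> snd c x \<in> ball (snd c (snd z0)) r1 \<Longrightarrow>
        snd c y \<in> ball (snd c (snd z0)) r1 \<Longrightarrow> norm (snd c x - snd c y) \<le> C1 * dist x y"
    using chart_bilipschitz[OF c(1,3)] by blast
  obtain r2 C2 where r2: "r2 > 0" "C2 > 0"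
    and b2: "\<And>x y. x \<in> fst c' \<Longrightarrow> y \<in> fst c' \<Longrightarrow> snd c' x \<in> ball (snd c' y0) r2 \<Longrightarrow>
        snd c' y \<in> ball (snd c' y0) r2 \<Longrightarrow> dist x y \<le> C2 * norm (snd c' x - snd c' y)"
    using chart_bilipschitz[OF c(2,4)] unfolding y0_def by blast
  obtain Kj where Kj: "Kj > 0" "\<And>x. norm (jmap x) \<le> norm x * Kj"
    using bounded_linear.pos_bounded[OF jmap_linear] by blast
  define C where "C = 1 + C1 + C2"
  have C: "C > 0" "1 + C1 \<le> C" "1 + C2 \<le> C" using r1 r2 by (auto simp: C_def)
  have nbhd: "\<exists>r>0. \<forall>z\<in>ball z0 r. \<forall>\<eta>\<in>ball \<eta>0 r.
      snd z \<in> fst c \<and> snd c (snd z) \<in> ball (snd c (snd z0)) r1 \<and> \<pi> z \<eta> \<in> ball (\<pi> z0 \<eta>0) \<delta> \<and>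
      snd (S (z, \<eta>)) \<in> fst c' \<and> snd c' (snd (S (z, \<eta>))) \<in> ball (snd c' y0) r2" if "\<delta> > 0" for \<delta>
  proof -
    define U1 where "U1 = fst c \<inter> snd c -` ball (snd c (snd z0)) r1"
    define U2 where "U2 = fst c' \<inter> snd c' -` ball (snd c' y0) r2"
    have oU: "open U1" "open U2" unfolding U1_def U2_def
      using continuous_open_preimage[OF continuous_chart open_dom open_ball] c by auto
    define N where "N = {p :: ('h \<times> 'm) \<times> 'e. snd (fst p) \<in> fst c}"
    have oN: "open N" unfolding N_def using open_dom[OF c(1)] by (intro open_Collect_mem continuous_intros)
    have cN: "continuous_on N (\<lambda>p. \<pi> (fst p) (snd p))" unfolding \<pi>_def
      by (intro continuous_intros continuous_on_compose2[OF continuous_chart[OF c(1)]]) (auto simp: N_def)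
    have "open (N \<inter> (\<lambda>p. \<pi> (fst p) (snd p)) -` ball (\<pi> z0 \<eta>0) \<delta>)" (is "open ?G1")
      by (rule continuous_open_preimage[OF cN oN open_ball])
    note G1 = this
    have G2: "open {p :: ('h \<times> 'm) \<times> 'e. snd (fst p) \<in> U1}" (is "open ?G2")
      by (intro open_Collect_mem continuous_intros oU)
    have G3: "open {p :: ('h \<times> 'm) \<times> 'e. snd (S p) \<in> U2}" (is "open ?G3")
      by (intro open_Collect_mem continuous_intros oU S_cont)
    note open_Int[OF open_Int[OF G1 G2] G3]
    moreover have "(z0, \<eta>0) \<in> ?G1 \<inter> ?G2 \<inter> ?G3"
      using c r1 r2 that by (simp add: N_def U1_def U2_def y0_def)
    ultimately obtain U V where UV: "open U" "open V" "(z0, \<eta>0) \<in> U \<times> V" "U \<times> V \<subseteq> ?G1 \<inter> ?G2 \<inter> ?G3"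
      by (rule open_prod_elim)
    from UV(3) have zU: "z0 \<in> U" and eV: "\<eta>0 \<in> V" by simp_all
    obtain ra where ra: "ra > 0" "ball z0 ra \<subseteq> U" using openE[OF UV(1) zU] .
    obtain rb where rb: "rb > 0" "ball \<eta>0 rb \<subseteq> V" using openE[OF UV(2) eV] .
    have "(z, \<eta>) \<in> ?G1 \<inter> ?G2 \<inter> ?G3" if "z \<in> ball z0 (min ra rb)" "\<eta> \<in> ball \<eta>0 (min ra rb)" for z \<eta>
    proof -
      have "z \<in> U" "\<eta> \<in> V" using that ra(2) rb(2) by auto
      then show ?thesis using UV(4) by blast
    qed
    then have "snd z \<in> fst c \<and> snd c (snd z) \<in> ball (snd c (snd z0)) r1 \<and> \<pi> z \<eta> \<in> ball (\<pi> z0 \<eta>0) \<delta> \<and>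
      snd (S (z, \<eta>)) \<in> fst c' \<and> snd c' (snd (S (z, \<eta>))) \<in> ball (snd c' y0) r2"
      if "z \<in> ball z0 (min ra rb)" "\<eta> \<in> ball \<eta>0 (min ra rb)" for z \<eta>
      using that unfolding U1_def U2_def by simp
    moreover have "min ra rb > 0" using ra(1) rb(1) by simp
    ultimately show ?thesis by blast
  qed
  have main: "\<exists>r>0. \<forall>z\<in>ball z0 r. \<forall>z'\<in>ball z0 r. norm (coord_diff c z z') \<le> C * dist z z' \<and>
       (\<forall>\<eta>\<in>ball \<eta>0 r. \<forall>\<eta>'\<in>ball \<eta>0 r. dist (S (z, \<eta>)) (S (z', \<eta>')) \<le>
         C * (norm (jmap (T (coord_diff c z z', \<eta>' - \<eta>))) + \<epsilon> * (dist z z' + norm (\<eta>' - \<eta>))))"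
    if \<epsilon>: "\<epsilon> > 0" for \<epsilon>
  proof -
    \<comment> \<open>\<open>Kj\<close> bounds \<open>jmap\<close>, and \<open>C + 1\<close> bounds
      the coordinate increments by the distances; both factors cancel at the end and leave
      \<epsilon>.\<close>
    define \<epsilon>1 where "\<epsilon>1 = \<epsilon> / (Kj * (C + 1))"
    have "\<epsilon>1 > 0" using \<epsilon> Kj C by (simp add: \<epsilon>1_def)
    note sd = strict_derivative[OF o\<Omega> \<pi>0 D(1) contD this, folded T_def]
    from sd obtain \<delta> where \<delta>0: "\<delta> > 0 \<and> ball (\<pi> z0 \<eta>0) \<delta> \<subseteq> \<Omega> \<and>
        (\<forall>p\<in>ball (\<pi> z0 \<eta>0) \<delta>. \<forall>p'\<in>ball (\<pi> z0 \<eta>0) \<delta>.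
        norm (coord_rep F c c' p' - coord_rep F c c' p - T (p' - p)) \<le> \<epsilon>1 * norm (p' - p))"
      by (rule exE)
    then have \<delta>: "\<delta> > 0" by (rule conjunct1)
    from \<delta>0 have lin: "norm (coord_rep F c c' p' - coord_rep F c c' p - T (p' - p)) \<le> \<epsilon>1 * norm (p' - p)"
      if "p\<in>ball (\<pi> z0 \<eta>0) \<delta>" "p'\<in>ball (\<pi> z0 \<eta>0) \<delta>" for p p'
      using that by blast
    obtain r where r: "r > 0" and nb: "\<And>z \<eta>. z\<in>ball z0 r \<Longrightarrow> \<eta>\<in>ball \<eta>0 r \<Longrightarrow>
      snd z \<in> fst c \<and> snd c (snd z) \<in> ball (snd c (snd z0)) r1 \<and> \<pi> z \<eta> \<in> ball (\<pi> z0 \<eta>0) \<delta> \<and>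
      snd (S (z, \<eta>)) \<in> fst c' \<and> snd c' (snd (S (z, \<eta>))) \<in> ball (snd c' y0) r2"
      using nbhd[OF \<delta>] by metis
    have A1: "norm (coord_diff c z z') \<le> C * dist z z'" if z: "z \<in> ball z0 r" "z' \<in> ball z0 r" for z z'
    proof -
      have "norm (coord_diff c z z') \<le> norm (fst z' - fst z) + norm (snd c (snd z') - snd c (snd z))"
        unfolding coord_diff_def by (rule norm_Pair_le)
      also have "norm (fst z' - fst z) \<le> dist z z'" using dist_fst_le[of z' z] by (simp add: dist_norm dist_commute)
      also have "norm (snd c (snd z') - snd c (snd z)) \<le> C1 * dist (snd z') (snd z)"
        using nb[OF z(1), of \<eta>0] nb[OF z(2), of \<eta>0] r by (intro b1) auto
      also have "\<dots> \<le> C1 * dist z z'" using dist_snd_le[of z' z] r1 by (simp add: dist_commute)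
      also have "dist z z' + C1 * dist z z' \<le> C * dist z z'"
        using C(2) mult_right_mono[OF C(2), of "dist z z'"] by (simp add: distrib_right)
      finally show ?thesis by simp
    qed
    have A2: "dist (S (z, \<eta>)) (S (z', \<eta>')) \<le>
         C * (norm (jmap (T (coord_diff c z z', \<eta>' - \<eta>))) + \<epsilon> * (dist z z' + norm (\<eta>' - \<eta>)))"
      if z: "z \<in> ball z0 r" "z' \<in> ball z0 r" and e: "\<eta> \<in> ball \<eta>0 r" "\<eta>' \<in> ball \<eta>0 r" for z z' \<eta> \<eta>'
    proof -
      let ?s = "\<lambda>z \<eta>. coord_rep F c c' (\<pi> z \<eta>)"
      have rep: "?s z \<eta> = (fst (F (z, \<eta>)), snd c' (snd (S (z, \<eta>))))" if "z \<in> ball z0 r" for z \<eta>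
        using nb[OF that, of \<eta>0] r c by (simp add: coord_rep_def \<pi>_def chart_inv_left Let_def S_F)
      have p: "\<pi> z' \<eta>' - \<pi> z \<eta> = (coord_diff c z z', \<eta>' - \<eta>)" by (simp add: \<pi>_def coord_diff_def)
      let ?R = "?s z' \<eta>' - ?s z \<eta> - T (coord_diff c z z', \<eta>' - \<eta>)"
      have "norm ?R \<le> \<epsilon>1 * norm (coord_diff c z z', \<eta>' - \<eta>)"
        using lin[of "\<pi> z \<eta>" "\<pi> z' \<eta>'"] nb z e unfolding p by blast
      also have "norm (coord_diff c z z', \<eta>' - \<eta>) \<le> norm (coord_diff c z z') + norm (\<eta>' - \<eta>)"
        by (rule norm_Pair_le)
      also have "\<dots> \<le> C * dist z z' + norm (\<eta>' - \<eta>)" using A1[OF z] by simp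
      also have "\<dots> \<le> (C + 1) * (dist z z' + norm (\<eta>' - \<eta>))" using C(1) by (simp add: algebra_simps)
      finally have R: "norm ?R \<le> \<epsilon>1 * ((C + 1) * (dist z z' + norm (\<eta>' - \<eta>)))"
        using \<open>\<epsilon>1 > 0\<close> by simp
      interpret j: bounded_linear jmap by (rule jmap_linear)
      have "norm (jmap (?s z' \<eta>' - ?s z \<eta>)) \<le> norm (jmap (T (coord_diff c z z', \<eta>' - \<eta>))) + norm (jmap ?R)"
        using norm_triangle_ineq[of "jmap (T (coord_diff c z z', \<eta>' - \<eta>))" "jmap ?R"] by (simp add: j.diff)
      also have "norm (jmap ?R) \<le> norm ?R * Kj" by (rule Kj)
      also have "\<dots> \<le> \<epsilon>1 * ((C + 1) * (dist z z' + norm (\<eta>' - \<eta>))) * Kj" using R Kj by simp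
      also have "\<dots> = \<epsilon> * (dist z z' + norm (\<eta>' - \<eta>))" using Kj C by (simp add: \<epsilon>1_def)
      finally have B: "norm (jmap (?s z' \<eta>' - ?s z \<eta>)) \<le>
          norm (jmap (T (coord_diff c z z', \<eta>' - \<eta>))) + \<epsilon> * (dist z z' + norm (\<eta>' - \<eta>))" by simp
      have J: "jmap (?s z' \<eta>' - ?s z \<eta>) = (fst (S (z', \<eta>')) - fst (S (z, \<eta>)),
          snd c' (snd (S (z', \<eta>'))) - snd c' (snd (S (z, \<eta>))))"
        using bounded_linear.linear[OF iota_linear] by (simp add: rep[OF z(1)] rep[OF z(2)] jmap_def S_F linear_diff)
      have "dist (S (z, \<eta>)) (S (z', \<eta>')) \<le> dist (fst (S (z, \<eta>))) (fst (S (z', \<eta>'))) + dist (snd (S (z, \<eta>))) (snd (S (z', \<eta>')))"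
        unfolding dist_prod_def by (rule sqrt_sum_squares_le_sum) auto
      also have "dist (snd (S (z, \<eta>))) (snd (S (z', \<eta>'))) \<le> C2 * norm (snd c' (snd (S (z, \<eta>))) - snd c' (snd (S (z', \<eta>'))))"
        using nb z e by (intro b2) blast+
      also have "\<dots> \<le> C2 * norm (jmap (?s z' \<eta>' - ?s z \<eta>))"
        using r2 unfolding J by (simp add: norm_minus_commute norm_snd_le)
      also have "dist (fst (S (z, \<eta>))) (fst (S (z', \<eta>'))) \<le> norm (jmap (?s z' \<eta>' - ?s z \<eta>))"
        unfolding J by (simp add: norm_minus_commute dist_norm norm_fst_le)
      also have "norm (jmap (?s z' \<eta>' - ?s z \<eta>)) + C2 * norm (jmap (?s z' \<eta>' - ?s z \<eta>)) \<le> C * norm (jmap (?s z' \<eta>' - ?s z \<eta>))"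
        using mult_right_mono[OF C(3), of "norm (jmap (?s z' \<eta>' - ?s z \<eta>))"] by (simp add: distrib_right)
      also have "\<dots> \<le> C * (norm (jmap (T (coord_diff c z z', \<eta>' - \<eta>))) + \<epsilon> * (dist z z' + norm (\<eta>' - \<eta>)))"
        using B C by simp
      finally show ?thesis by simp
    qed
    show ?thesis using r A1 A2 by blast
  qed
  show ?thesis using T C(1) main by blast
qed

text \<open>The linearization with \<epsilon> = 1 and equal noise values, where the term with
  \<open>T\<close> is bounded by its operator norm.\<close>

lemma locally_Lipschitz:
  "\<exists>r>0. \<exists>L\<ge>0. \<forall>z\<in>ball z0 r. \<forall>z'\<in>ball z0 r. \<forall>\<eta>\<in>ball \<eta>0 r. dist (S (z, \<eta>)) (S (z', \<eta>)) \<le> L * dist z z'"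
proof -
  obtain c c' where c: "c \<in> A" "c' \<in> A" "snd z0 \<in> fst c" "snd (S (z0, \<eta>0)) \<in> fst c'"
    using chart_exists by meson
  obtain T C where C: "C > 0" and *: "\<forall>\<epsilon>>0. \<exists>r>0. \<forall>z\<in>ball z0 r. \<forall>z'\<in>ball z0 r. norm (coord_diff c z z') \<le> C * dist z z' \<and>
       (\<forall>\<eta>\<in>ball \<eta>0 r. \<forall>\<eta>'\<in>ball \<eta>0 r. dist (S (z, \<eta>)) (S (z', \<eta>')) \<le>
         C * (norm (jmap (blinfun_apply T (coord_diff c z z', \<eta>' - \<eta>))) + \<epsilon> * (dist z z' + norm (\<eta>' - \<eta>))))"
    using local_linearization[OF c] by blast
  obtain r where r: "r > 0" "\<And>z z'. z\<in>ball z0 r \<Longrightarrow> z'\<in>ball z0 r \<Longrightarrow> norm (coord_diff c z z') \<le> C * dist z z'"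
      "\<And>z z' \<eta>. z\<in>ball z0 r \<Longrightarrow> z'\<in>ball z0 r \<Longrightarrow> \<eta>\<in>ball \<eta>0 r \<Longrightarrow> dist (S (z, \<eta>)) (S (z', \<eta>)) \<le>
         C * (norm (jmap (T (coord_diff c z z', 0))) + dist z z')"
    using *[rule_format, of 1] by force
  obtain Kj where Kj: "Kj > 0" "\<And>x. norm (jmap x) \<le> norm x * Kj"
    using bounded_linear.pos_bounded[OF jmap_linear] by blast
  have "dist (S (z, \<eta>)) (S (z', \<eta>)) \<le> C * (norm T * C * Kj + 1) * dist z z'"
    if z: "z \<in> ball z0 r" "z' \<in> ball z0 r" and e: "\<eta> \<in> ball \<eta>0 r" for z z' \<eta>
  proof -
    have "norm (T (coord_diff c z z', 0)) \<le> norm T * norm (coord_diff c z z', 0::'e)" by (rule norm_blinfun)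
    also have "\<dots> \<le> norm T * (C * dist z z')"
      using r(2)[OF z] by (intro mult_left_mono) (simp_all add: norm_Pair)
    finally have "norm (T (coord_diff c z z', 0)) * Kj \<le> norm T * (C * dist z z') * Kj"
      using Kj(1) by simp
    with Kj(2)[of "T (coord_diff c z z', 0)"]
    have "norm (jmap (T (coord_diff c z z', 0))) \<le> norm T * (C * dist z z') * Kj" by linarith
    then have "C * (norm (jmap (T (coord_diff c z z', 0))) + dist z z') \<le> C * (norm T * (C * dist z z') * Kj + dist z z')"
      using C by simp
    also have "\<dots> = C * (norm T * C * Kj + 1) * dist z z'" by (simp add: algebra_simps)
    finally show ?thesis using r(3)[OF z e] by linarith
  qed
  then show ?thesis using r(1) C Kj by (intro exI[of _ r] conjI exI[of _ "C * (norm T * C * Kj + 1)"]) auto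
qed

text \<open>Since the shift of the noise may depend on \<open>z\<close> and \<open>z'\<close> in an arbitrary way, a finite net of the
  compact image of the unit ball is enough, and no right inverse of the noise derivative is needed.\<close>

lemma contracting_shift:
  assumes dense: "noise_deriv_dense A g S z0 \<eta>0" and E: "closure E = UNIV" and \<epsilon>: "\<epsilon> > 0"
  shows "\<exists>r>0. \<exists>W R. finite W \<and> W \<subseteq> E \<and> R \<ge> 0 \<and> (\<forall>z\<in>ball z0 r. \<forall>z'\<in>ball z0 r.
     \<exists>v\<in>W. \<exists>t. 0 \<le> t \<and> t \<le> R * dist z z' \<and>
       (\<forall>\<eta>\<in>ball \<eta>0 r. dist (S (z, \<eta>)) (S (z', \<eta> + t *\<^sub>R v)) \<le> \<epsilon> * dist z z'))"
proof -
  obtain c c' where c: "c \<in> A" "c' \<in> A" "snd z0 \<in> fst c" "snd (S (z0, \<eta>0)) \<in> fst c'"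
    using chart_exists by meson
  obtain T C where T: "linearization c c' z0 \<eta>0 T" and C: "C > 0"
    and *: "\<forall>\<epsilon>>0. \<exists>r>0. \<forall>z\<in>ball z0 r. \<forall>z'\<in>ball z0 r. norm (coord_diff c z z') \<le> C * dist z z' \<and>
       (\<forall>\<eta>\<in>ball \<eta>0 r. \<forall>\<eta>'\<in>ball \<eta>0 r. dist (S (z, \<eta>)) (S (z', \<eta>')) \<le>
         C * (norm (jmap (T (coord_diff c z z', \<eta>' - \<eta>))) + \<epsilon> * (dist z z' + norm (\<eta>' - \<eta>))))"
    using local_linearization[OF c] by blast
  interpret j: bounded_linear jmap by (rule jmap_linear)
  define B where "B = (\<lambda>v. jmap (T ((0, 0), v)))"
  have bB: "bounded_linear B" unfolding B_def
    by (intro bounded_linear_compose[OF jmap_linear] bounded_linear_compose[OF blinfun.bounded_linear_right]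
        bounded_linear_Pair bounded_linear_zero bounded_linear_ident)
  interpret B: bounded_linear B by (rule bB)
  \<comment> \<open>The summand 1 makes \<open>M\<close> exceed the norm of \<open>T\<close>
    strictly, so after division by \<open>M * norm w\<close> the displacement \<open>w\<close> is
    mapped by \<open>T\<close> into the open unit ball. \<open>\<epsilon>1\<close> below is tuned so
    that the error of the net finally amounts to \<epsilon>/2.\<close>
  define M where "M = norm T + 1"
  have M: "M > 0" by (simp add: M_def add_nonneg_pos)
  define \<epsilon>1 where "\<epsilon>1 = \<epsilon> / (2 * C * (M * C))"
  have \<epsilon>1: "\<epsilon>1 > 0" using \<epsilon> C M by (simp add: \<epsilon>1_def)
  have dE: "\<exists>v\<in>E. norm (y + B v) < \<epsilon>1" for y
  proof -
    obtain v0 where v0: "norm (B v0 - (- y)) < \<epsilon>1/2"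
      using linearization_dense[OF c T dense, of "\<epsilon>1/2" "-y"] \<epsilon>1 unfolding B_def by auto
    have "isCont B v0" using linear_continuous_at[OF bB] .
    then obtain d where d: "d > 0" "\<And>v. dist v v0 < d \<Longrightarrow> dist (B v) (B v0) < \<epsilon>1/2"
      using \<epsilon>1 unfolding continuous_at_eps_delta by (meson half_gt_zero)
    obtain v where v: "v \<in> E" "dist v v0 < d" using E d(1) by (metis UNIV_I closure_approachable)
    have "y + B v = (B v0 + y) + (B v - B v0)" by simp
    then have "norm (y + B v) \<le> norm (B v0 + y) + norm (B v - B v0)" by (metis norm_triangle_ineq)
    also have "\<dots> < \<epsilon>1" using v0 d(2)[OF v(2)] by (simp add: dist_norm)
    finally show ?thesis using v by blast
  qed
  \<comment> \<open>This set contains all values of \<open>jmap\<close> on the open unit ball. It is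
    compact by the compact embedding in one factor and by finite dimension in the other.\<close>
  define Kc where "Kc = closure (\<iota> ` ball 0 1) \<times> (cball 0 1 :: 'd set)"
  obtain Bs :: "'d set" where Bs: "finite Bs" "span Bs = UNIV" using finite_dim by blast
  have "compact Kc" unfolding Kc_def
    using emb compact_cball_finite_span[OF Bs] by (intro compact_Times) (auto simp: compact_embedding_def)
  moreover have "Kc \<subseteq> (\<Union>v\<in>E. {y. norm (y + B v) < \<epsilon>1})" using dE by auto
  moreover have "open {y. norm (y + B v) < \<epsilon>1}" for v
    by (intro open_Collect_less continuous_intros)
  ultimately obtain W where W: "W \<subseteq> E" "finite W" "Kc \<subseteq> (\<Union>v\<in>W. {y. norm (y + B v) < \<epsilon>1})"
    by (metis (no_types, lifting) compactE_image)
  define N where "N = (\<Sum>v\<in>W. norm v)"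
  have N: "norm v \<le> N" if "v \<in> W" for v unfolding N_def using W that by (intro member_le_sum) auto
  have N0: "N \<ge> 0" by (simp add: N_def sum_nonneg)
  \<comment> \<open>The net handles displacements of unit size; homogeneity extends it to all
    \<open>w\<close>, with a multiple proportional to \<open>norm w\<close> of one of the finitely
    many vectors.\<close>
  have sel: "\<exists>v\<in>W. norm (jmap (T (w, (M * norm w) *\<^sub>R v))) \<le> \<epsilon>1 * (M * norm w)" for w
  proof (cases "w = 0")
    case True
    have "0 \<in> Kc" using closure_subset[of "\<iota> ` ball 0 1"] bounded_linear.linear[OF iota_linear]
      by (auto simp: Kc_def zero_prod_def linear_0 intro!: subsetD[OF closure_subset] image_eqI[of _ _ 0])
    then obtain v where "v \<in> W" using W by blast
    moreover have "(0, 0) = (0 :: ('h \<times> 'd) \<times> 'e)" by (simp add: zero_prod_def)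
    ultimately show ?thesis using True by (auto simp: blinfun.zero_right j.zero)
  next
    case False
    define t where "t = M * norm w"
    have t: "t > 0" using M False by (simp add: t_def)
    define x where "x = T ((1/t) *\<^sub>R w, 0)"
    have "norm x \<le> norm T * norm ((1/t) *\<^sub>R w, 0::'e)" unfolding x_def by (rule norm_blinfun)
    also have "\<dots> = norm T / M" using t M False by (simp add: norm_Pair t_def)
    also have "\<dots> < 1" using M by (simp add: M_def)
    finally have "norm x < 1" .
    then have "norm (fst x) < 1" "norm (snd x) \<le> 1" using norm_fst_le[of "fst x" "snd x"] norm_snd_le[of "snd x" "fst x"] by simp_all
    then have "jmap x \<in> Kc" unfolding Kc_def jmap_def
      by (auto intro!: subsetD[OF closure_subset])
    then obtain v where v: "v \<in> W" "norm (jmap x + B v) < \<epsilon>1" using W by blast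
    have "(w, t *\<^sub>R v) = t *\<^sub>R (((1/t) *\<^sub>R w, 0) + ((0, 0), v))"
      using t by (simp add: zero_prod_def[symmetric])
    then have "jmap (T (w, t *\<^sub>R v)) = t *\<^sub>R (jmap x + B v)"
      by (simp only: blinfun.scaleR_right blinfun.add_right j.scaleR j.add x_def B_def)
    then have "norm (jmap (T (w, t *\<^sub>R v))) = t * norm (jmap x + B v)" using t by simp
    also have "\<dots> \<le> t * \<epsilon>1" using v t by (intro mult_left_mono) auto
    finally show ?thesis using v(1) by (auto simp: t_def mult.commute)
  qed
  \<comment> \<open>Chosen after the net, because the linearization error also involves the length
    of the shift, which is at most \<open>M * C * N * dist z z'\<close>. This error takes the other
    \<epsilon>/2.\<close>
  define \<epsilon>2 where "\<epsilon>2 = \<epsilon> / (2 * C * (1 + M * C * N))"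
  have pos: "1 + M * C * N > 0" using M C N0 by (simp add: add_pos_nonneg)
  have "\<epsilon>2 > 0" using \<epsilon> C pos by (simp add: \<epsilon>2_def)
  then obtain r where r: "r > 0" "\<And>z z'. z\<in>ball z0 r \<Longrightarrow> z'\<in>ball z0 r \<Longrightarrow> norm (coord_diff c z z') \<le> C * dist z z'"
      "\<And>z z' \<eta> \<eta>'. z\<in>ball z0 r \<Longrightarrow> z'\<in>ball z0 r \<Longrightarrow> \<eta>\<in>ball \<eta>0 r \<Longrightarrow> \<eta>'\<in>ball \<eta>0 r \<Longrightarrow> dist (S (z, \<eta>)) (S (z', \<eta>')) \<le>
         C * (norm (jmap (T (coord_diff c z z', \<eta>' - \<eta>))) + \<epsilon>2 * (dist z z' + norm (\<eta>' - \<eta>)))"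
    using * by metis
  define R where "R = M * C"
  have R: "R > 0" using M C by (simp add: R_def)
  \<comment> \<open>Noise values within \<open>r / 2\<close> stay within \<open>r\<close> after a
    shift of length at most \<open>r / 2\<close>; the second bound guarantees this length, as
    \<open>dist z z'\<close> is below \<open>2 * r'\<close>.\<close>
  define r' where "r' = min (r/2) (r / (4 * (R * N + 1)))"
  have RN: "R * N + 1 > 0" using R N0 by (simp add: add_nonneg_pos)
  have "r' > 0" unfolding r'_def using r(1) RN by simp
  moreover have "r' \<le> r/2" unfolding r'_def by (rule min.cobounded1)
  moreover have "r' \<le> r / (4 * (R * N + 1))" unfolding r'_def by (rule min.cobounded2)
  ultimately have r': "r' > 0" "r' \<le> r/2" "r' \<le> r / (4 * (R * N + 1))" by blast+
  have "\<exists>v\<in>W. \<exists>t. 0 \<le> t \<and> t \<le> R * dist z z' \<and>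
       (\<forall>\<eta>\<in>ball \<eta>0 r'. dist (S (z, \<eta>)) (S (z', \<eta> + t *\<^sub>R v)) \<le> \<epsilon> * dist z z')"
    if z': "z \<in> ball z0 r'" "z' \<in> ball z0 r'" for z z'
  proof -
    have z: "z \<in> ball z0 r" "z' \<in> ball z0 r" using z' r' r(1) by auto
    let ?w = "coord_diff c z z'"
    define t where "t = M * norm ?w"
    obtain v where v: "v \<in> W" "norm (jmap (T (?w, t *\<^sub>R v))) \<le> \<epsilon>1 * t"
      using sel[of ?w] unfolding t_def by blast
    have t: "0 \<le> t" "t \<le> R * dist z z'"
      using r(2)[OF z] M by (auto simp: t_def R_def mult.assoc)
    have tv: "norm (t *\<^sub>R v) \<le> R * N * dist z z'"
    proof -
      have "t * norm v \<le> (R * dist z z') * N" using t N[OF v(1)] R by (intro mult_mono) auto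
      then show ?thesis using t by (simp add: mult_ac)
    qed
    have "dist z z' < 2 * r'" using z' dist_triangle[of z z' z0] by (simp add: dist_commute)
    then have "R * N * dist z z' \<le> R * N * (2 * r')" using R N0 by (intro mult_left_mono) auto
    also have "\<dots> \<le> (R * N + 1) * (2 * r')" using r' by simp
    also have "\<dots> \<le> r/2" using r'(3) RN by (simp add: field_simps)
    finally have tv2: "norm (t *\<^sub>R v) \<le> r/2" using tv by simp
    have "dist (S (z, \<eta>)) (S (z', \<eta> + t *\<^sub>R v)) \<le> \<epsilon> * dist z z'" if e: "\<eta> \<in> ball \<eta>0 r'" for \<eta>
    proof -
      have e1: "\<eta> \<in> ball \<eta>0 r" using e r' r(1) by auto
      have "dist \<eta>0 (\<eta> + t *\<^sub>R v) \<le> dist \<eta>0 \<eta> + norm (t *\<^sub>R v)"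
        using dist_triangle[of \<eta>0 "\<eta> + t *\<^sub>R v" \<eta>] by (simp add: dist_norm)
      also have "\<dots> < r" using e r'(2) tv2 by simp
      finally have e2: "\<eta> + t *\<^sub>R v \<in> ball \<eta>0 r" by simp
      have a: "norm (jmap (T (?w, t *\<^sub>R v))) \<le> \<epsilon>1 * (R * dist z z')"
        using v(2) t \<epsilon>1 by (meson less_imp_le mult_left_mono order_trans)
      have b: "\<epsilon>2 * (dist z z' + norm (t *\<^sub>R v)) \<le> \<epsilon>2 * ((1 + R * N) * dist z z')"
        using tv \<open>\<epsilon>2 > 0\<close> by (simp add: distrib_right)
      have "dist (S (z, \<eta>)) (S (z', \<eta> + t *\<^sub>R v)) \<le>
          C * (norm (jmap (T (?w, t *\<^sub>R v))) + \<epsilon>2 * (dist z z' + norm (t *\<^sub>R v)))"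
        using r(3)[OF z e1 e2] by simp
      also have "\<dots> \<le> C * (\<epsilon>1 * (R * dist z z') + \<epsilon>2 * ((1 + R * N) * dist z z'))"
        using add_mono[OF a b] C by (rule_tac mult_left_mono) auto
      also have "\<dots> = \<epsilon> * dist z z'"
      proof -
        have "C * (\<epsilon>1 * R) = \<epsilon>/2" using C M by (simp add: \<epsilon>1_def R_def)
        moreover have "C * (\<epsilon>2 * (1 + R * N)) = \<epsilon>/2" using C pos by (simp add: \<epsilon>2_def R_def)
        ultimately have "C * (\<epsilon>1 * R) + C * (\<epsilon>2 * (1 + R * N)) = \<epsilon>" by simp
        then show ?thesis by (metis (no_types, opaque_lifting) distrib_left distrib_right mult.assoc)
      qed
      finally show ?thesis .
    qed
    then show ?thesis using v(1) t by blast
  qed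
  then show ?thesis using r'(1) W R by (intro exI[of _ r'] conjI exI[of _ W] exI[of _ R]) auto
qed

end

section \<open>Shifts of the noise\<close>

text \<open>The difference is at most \<open>L * \<bar>t\<bar>\<close> and vanishes off two
  intervals of length \<open>2 * R\<close>; thus bounded support turns a uniform Lipschitz bound
  into one in L1.\<close>

lemma lipschitz_translate_L1:
  fixes \<rho> :: "real \<Rightarrow> real"
  assumes L: "L-lipschitz_on UNIV \<rho>" and supp: "\<And>x. \<bar>x\<bar> > R \<Longrightarrow> \<rho> x = 0" and R: "R \<ge> 0"
  shows "integrable lborel \<rho>" and "integrable lborel (\<lambda>x. \<rho> (x - t))"
    and "(\<integral>x. \<bar>\<rho> (x - t) - \<rho> x\<bar> \<partial>lborel) \<le> 4 * R * L * \<bar>t\<bar>"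
proof -
  have L0: "L \<ge> 0" using L by (rule lipschitz_on_nonneg)
  have cont: "continuous_on UNIV \<rho>" using L by (rule lipschitz_on_continuous_on)
  have eq: "\<rho> = (\<lambda>x. indicator {-R..R} x *\<^sub>R \<rho> x)"
  proof
    fix x show "\<rho> x = indicator {-R..R} x *\<^sub>R \<rho> x"
      using supp[of x] by (cases "x \<in> {-R..R}") (auto simp: abs_if)
  qed
  have "set_integrable lborel {-R..R} \<rho>"
    by (rule borel_integrable_atLeastAtMost') (rule continuous_on_subset[OF cont], simp)
  then show i1: "integrable lborel \<rho>" by (subst eq) (simp add: set_integrable_def)
  show i2: "integrable lborel (\<lambda>x. \<rho> (x - t))"
    using lborel_integrable_real_affine[OF i1, of 1 "-t"] by simp
  define b where "b = (\<lambda>x. L * \<bar>t\<bar> * indicator {-R..R} x + L * \<bar>t\<bar> * indicator {-R+t..R+t} x :: real)"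
  have ib: "integrable lborel b" unfolding b_def by (intro Bochner_Integration.integrable_add integrable_mult_right integrable_real_indicator)
      (auto simp: emeasure_lborel_Icc_eq)
  have "(\<integral>x. \<bar>\<rho> (x - t) - \<rho> x\<bar> \<partial>lborel) \<le> (\<integral>x. b x \<partial>lborel)"
  proof (rule integral_mono)
    fix x
    have "\<bar>\<rho> (x - t) - \<rho> x\<bar> \<le> L * \<bar>t\<bar>"
      using lipschitz_onD[OF L, of "x - t" x] by (simp add: dist_real_def)
    moreover have "\<bar>\<rho> (x - t) - \<rho> x\<bar> = 0" if "x \<notin> {-R..R}" "x \<notin> {-R+t..R+t}"
      using supp[of x] supp[of "x - t"] that by (auto simp: abs_if)
    moreover have "0 \<le> L * \<bar>t\<bar>" using L0 by simp
    ultimately show "\<bar>\<rho> (x - t) - \<rho> x\<bar> \<le> b x" unfolding b_def indicator_def by auto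
  qed (use i1 i2 ib in auto)
  also have "\<dots> = L * \<bar>t\<bar> * (2 * R) + L * \<bar>t\<bar> * (2 * R)"
    unfolding b_def using R by (subst Bochner_Integration.integral_add) auto
  finally show "(\<integral>x. \<bar>\<rho> (x - t) - \<rho> x\<bar> \<partial>lborel) \<le> 4 * R * L * \<bar>t\<bar>" by (simp add: algebra_simps)
qed

text \<open>A continuous density that is positive at a point is positive on an open set around it,
  which has positive Lebesgue measure; beyond \<open>R\<close> this would contradict the almost sure
  bound.\<close>

lemma lipschitz_density_support:
  fixes \<rho> :: "real \<Rightarrow> real"
  assumes d: "distributed P lborel \<xi> (\<lambda>x. ennreal (\<rho> x))" and cont: "continuous_on UNIV \<rho>"
    and nn: "\<And>x. 0 \<le> \<rho> x" and bd: "AE \<omega> in P. \<bar>\<xi> \<omega>\<bar> \<le> R" and x: "\<bar>x\<bar> > R"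
  shows "\<rho> x = 0"
proof (rule ccontr)
  assume "\<rho> x \<noteq> 0"
  define U where "U = {x. R < \<bar>x\<bar>} \<inter> {x. 0 < \<rho> x}"
  have m: "\<xi> \<in> measurable P lborel" and de: "distr P lborel \<xi> = density lborel (\<lambda>x. ennreal (\<rho> x))"
    and mr: "(\<lambda>x. ennreal (\<rho> x)) \<in> borel_measurable lborel"
    using d by (auto simp: distributed_def)
  have "AE y in distr P lborel \<xi>. \<bar>y\<bar> \<le> R"
    by (subst AE_distr_iff[OF m]) (use bd in auto)
  then have "AE y in lborel. 0 < ennreal (\<rho> y) \<longrightarrow> \<bar>y\<bar> \<le> R" unfolding de using mr by (simp add: AE_density)
  then have ae: "AE y in lborel. y \<notin> U" by (eventually_elim) (auto simp: U_def ennreal_less_zero_iff)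
  have oU: "open U" unfolding U_def
    by (intro open_Int open_Collect_less continuous_intros cont)
  then have "U \<in> null_sets lborel" using ae by (subst AE_iff_null_sets) auto
  then have "negligible U" by (simp add: negligible_iff_null_sets null_sets_completionI)
  moreover have "x \<in> U" using x \<open>\<rho> x \<noteq> 0\<close> nn[of x] by (auto simp: U_def)
  ultimately show False using open_not_negligible[OF oU] by blast
qed

text \<open>The constant components only serve to give both variables the same type, as \<open>indep_var\<close> requires.\<close>

lemma (in prob_space) shift_estimate:
  fixes \<rho> :: "real \<Rightarrow> real" and Y :: "'a \<Rightarrow> 'e::{real_normed_vector, second_countable_topology}"
  assumes indep: "indep_var (borel \<Otimes>\<^sub>M borel) (\<lambda>\<omega>. (\<xi> \<omega>, 0 :: 'e)) (borel \<Otimes>\<^sub>M borel) (\<lambda>\<omega>. (0 :: real, Y \<omega>))"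
    and d: "distributed M lborel \<xi> (\<lambda>x. ennreal (\<rho> x))"
    and nn: "\<And>x. 0 \<le> \<rho> x" and L: "L-lipschitz_on UNIV \<rho>" and supp: "\<And>x. \<bar>x\<bar> > R \<Longrightarrow> \<rho> x = 0" and R: "R \<ge> 0"
    and G: "G \<in> borel_measurable borel" "\<And>x. \<bar>G x :: real\<bar> \<le> B"
  shows "\<bar>(\<integral>\<omega>. G ((\<xi> \<omega> + t) *\<^sub>R w + Y \<omega>) \<partial>M) - (\<integral>\<omega>. G (\<xi> \<omega> *\<^sub>R w + Y \<omega>) \<partial>M)\<bar> \<le> 4 * R * L * \<bar>t\<bar> * B"
proof -
  have B: "B \<ge> 0" using G(2)[of 0] by linarith
  define N1 where "N1 = distr M (borel \<Otimes>\<^sub>M borel) (\<lambda>\<omega>. (\<xi> \<omega>, 0 :: 'e))"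
  define M1 where "M1 = distr M borel \<xi>"
  define M2 where "M2 = distr M (borel \<Otimes>\<^sub>M borel) (\<lambda>\<omega>. (0 :: real, Y \<omega>))"
  have m1: "(\<lambda>\<omega>. (\<xi> \<omega>, 0 :: 'e)) \<in> measurable M (borel \<Otimes>\<^sub>M borel)"
    and m2: "(\<lambda>\<omega>. (0 :: real, Y \<omega>)) \<in> measurable M (borel \<Otimes>\<^sub>M borel)"
    using indep by (auto dest: indep_var_rv1 indep_var_rv2)
  have mx: "\<xi> \<in> borel_measurable M" using measurable_compose[OF m1 measurable_fst] by simp
  interpret N1: prob_space N1 unfolding N1_def by (rule prob_space_distr[OF m1])
  interpret M1: prob_space M1 unfolding M1_def by (rule prob_space_distr[OF mx])
  interpret M2: prob_space M2 unfolding M2_def by (rule prob_space_distr[OF m2])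
  interpret pp: pair_prob_space N1 M2 ..
  have M1d: "M1 = density lborel (\<lambda>x. ennreal (\<rho> x))"
  proof -
    have "distr M lborel \<xi> = M1" unfolding M1_def by (intro distr_cong) auto
    then show ?thesis using d by (simp add: distributed_def)
  qed
  have joint: "distr M ((borel \<Otimes>\<^sub>M borel) \<Otimes>\<^sub>M (borel \<Otimes>\<^sub>M borel)) (\<lambda>\<omega>. ((\<xi> \<omega>, 0 :: 'e), (0 :: real, Y \<omega>))) = N1 \<Otimes>\<^sub>M M2"
    using indep unfolding indep_var_distribution_eq N1_def M2_def by simp
  have sM: "sets N1 = sets (borel \<Otimes>\<^sub>M borel)" "sets M1 = sets borel" "sets M2 = sets (borel \<Otimes>\<^sub>M borel)"
    by (simp_all add: M1_def M2_def N1_def)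
  note [measurable] = G(1) mx m1 m2
  note [measurable_cong] = sM
  have rho_m[measurable]: "\<rho> \<in> borel_measurable borel"
    using lipschitz_on_continuous_on[OF L] by (rule borel_measurable_continuous_onI)
  \<comment> \<open>The expectation over \<open>\<xi>\<close> alone, with the rest of the noise
    frozen at \<open>y\<close>. By Fubini it suffices to bound its change in \<open>t\<close>
    uniformly in \<open>y\<close>.\<close>
  define a where "a = (\<lambda>t y. \<integral>x. G ((x + t) *\<^sub>R w + y) \<partial>M1)"
  have aN: "(\<integral>p. G ((fst p + t) *\<^sub>R w + snd q) \<partial>N1) = a t (snd q)" for t q
    unfolding a_def M1_def N1_def by (subst (1 2) integral_distr) auto
  have expect: "(\<integral>\<omega>. G ((\<xi> \<omega> + t) *\<^sub>R w + Y \<omega>) \<partial>M) = (\<integral>q. a t (snd q) \<partial>M2)" for t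
  proof -
    have "(\<integral>\<omega>. G ((\<xi> \<omega> + t) *\<^sub>R w + Y \<omega>) \<partial>M) =
        (\<integral>p. G ((fst (fst p) + t) *\<^sub>R w + snd (snd p)) \<partial>distr M ((borel \<Otimes>\<^sub>M borel) \<Otimes>\<^sub>M (borel \<Otimes>\<^sub>M borel))
          (\<lambda>\<omega>. ((\<xi> \<omega>, 0 :: 'e), (0 :: real, Y \<omega>))))"
      by (subst integral_distr) auto
    also have "\<dots> = (\<integral>p. (case p of (p, q) \<Rightarrow> G ((fst p + t) *\<^sub>R w + snd q)) \<partial>(N1 \<Otimes>\<^sub>M M2))"
      unfolding joint by (simp add: case_prod_beta)
    also have "\<dots> = (\<integral>q. (\<integral>p. G ((fst p + t) *\<^sub>R w + snd q) \<partial>N1) \<partial>M2)"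
    proof (rule pp.integral_snd[symmetric])
      show "integrable (N1 \<Otimes>\<^sub>M M2) (\<lambda>(p, q). G ((fst p + t) *\<^sub>R w + snd q))"
        by (rule pp.P.integrable_const_bound[of _ B]) (use G in auto)
    qed
    finally show ?thesis unfolding aN .
  qed
  have am: "(\<lambda>q. a t (snd q)) \<in> borel_measurable M2" for t
    unfolding a_def by (rule M1.borel_measurable_lebesgue_integral) auto
  have aint: "integrable M2 (\<lambda>q. a t (snd q))" for t
  proof (rule M2.integrable_const_bound[of _ B])
    have "\<bar>a t y\<bar> \<le> B" for y
    proof -
      have "\<bar>a t y\<bar> \<le> (\<integral>x. B \<partial>M1)" unfolding a_def
        by (intro integral_abs_bound[THEN order_trans] integral_mono M1.integrable_const_bound[of _ B]) (use G B in auto)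
      then show ?thesis using M1.prob_space by simp
    qed
    then show "AE q in M2. norm (a t (snd q)) \<le> B" by auto
  qed (rule am)
  have diff: "\<bar>a t y - a 0 y\<bar> \<le> 4 * R * L * \<bar>t\<bar> * B" for y
  proof -
    note i = lipschitz_translate_L1[OF L supp R]
    have gi: "integrable lborel (\<lambda>x. r x * G (x *\<^sub>R w + y))" if "integrable lborel r" for r
    proof (rule Bochner_Integration.integrable_bound)
      show "integrable lborel (\<lambda>x. B * r x)" using that by simp
      show "(\<lambda>x. r x * G (x *\<^sub>R w + y)) \<in> borel_measurable lborel"
        using borel_measurable_integrable[OF that] by measurable
      show "AE x in lborel. norm (r x * G (x *\<^sub>R w + y)) \<le> norm (B * r x)"
        using mult_right_mono[OF G(2) abs_ge_zero] B by (intro AE_I2) (simp add: abs_mult mult.commute)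
    qed
    \<comment> \<open>Translation invariance of Lebesgue measure moves the shift from
      \<open>G\<close>, which is merely bounded and measurable, to the density.\<close>
    have at: "a t y = (\<integral>x. \<rho> (x - t) * G (x *\<^sub>R w + y) \<partial>lborel)" for t
    proof -
      have "a t y = (\<integral>x. \<rho> x * G ((x + t) *\<^sub>R w + y) \<partial>lborel)"
        unfolding a_def M1d using nn by (subst integral_density) auto
      also have "\<dots> = (\<integral>x. \<rho> (x - t) * G (x *\<^sub>R w + y) \<partial>lborel)"
        by (subst (2) lborel_integral_real_affine[of 1 _ t]) (auto simp: add.commute)
      finally show ?thesis .
    qed
    have "a t y - a 0 y = (\<integral>x. \<rho> (x - t) * G (x *\<^sub>R w + y) - \<rho> x * G (x *\<^sub>R w + y) \<partial>lborel)"
      using gi[OF i(1)] gi[OF i(2)[of t]] at[of 0] at[of t] by simp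
    also have "\<dots> = (\<integral>x. (\<rho> (x - t) - \<rho> x) * G (x *\<^sub>R w + y) \<partial>lborel)" by (simp add: left_diff_distrib)
    also have "\<bar>\<dots>\<bar> \<le> (\<integral>x. \<bar>\<rho> (x - t) - \<rho> x\<bar> * B \<partial>lborel)"
    proof (rule order_trans[OF integral_abs_bound], rule integral_mono)
      show "integrable lborel (\<lambda>x. \<bar>(\<rho> (x - t) - \<rho> x) * G (x *\<^sub>R w + y)\<bar>)"
        using gi[of "\<lambda>x. \<rho> (x - t) - \<rho> x"] i(1) i(2)[of t] by (intro integrable_abs) auto
      show "integrable lborel (\<lambda>x. \<bar>\<rho> (x - t) - \<rho> x\<bar> * B)" using i(1) i(2)[of t] by auto
      show "\<bar>(\<rho> (x - t) - \<rho> x) * G (x *\<^sub>R w + y)\<bar> \<le> \<bar>\<rho> (x - t) - \<rho> x\<bar> * B" for x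
        unfolding abs_mult using G(2) by (intro mult_left_mono) auto
    qed
    also have "\<dots> = (\<integral>x. \<bar>\<rho> (x - t) - \<rho> x\<bar> \<partial>lborel) * B" by simp
    also have "\<dots> \<le> 4 * R * L * \<bar>t\<bar> * B" using i(3)[of t] B by (intro mult_right_mono)
    finally show ?thesis .
  qed
  have "\<bar>(\<integral>q. a t (snd q) \<partial>M2) - (\<integral>q. a 0 (snd q) \<partial>M2)\<bar> = \<bar>\<integral>q. a t (snd q) - a 0 (snd q) \<partial>M2\<bar>"
    using aint by (simp add: Bochner_Integration.integral_diff)
  also have "\<dots> \<le> (\<integral>q. 4 * R * L * \<bar>t\<bar> * B \<partial>M2)"
    by (intro integral_abs_bound[THEN order_trans] integral_mono) (use aint diff in auto)
  also have "\<dots> = 4 * R * L * \<bar>t\<bar> * B" using M2.prob_space by simp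
  finally show ?thesis using expect[of t] expect[of 0] by simp
qed

text \<open>Turns the unordered sum of the noise expansion into a limit along a sequence, to which
  dominated convergence applies.\<close>

lemma has_sum_nat_partial_sums:
  fixes f :: "nat \<Rightarrow> 'b::{comm_monoid_add, topological_space}"
  assumes "(f has_sum x) J"
  shows "(\<lambda>n. \<Sum>i\<in>J \<inter> {..n}. f i) \<longlonglongrightarrow> x"
proof -
  have "filterlim (\<lambda>n. J \<inter> {..n}) (finite_subsets_at_top J) sequentially"
    unfolding filterlim_finite_subsets_at_top
  proof (intro allI impI)
    fix X assume X: "finite X \<and> X \<subseteq> J"
    then have "X \<subseteq> {..Max (insert 0 X)}" by auto
    then show "\<forall>\<^sub>F n in sequentially. finite (J \<inter> {..n}) \<and> X \<subseteq> J \<inter> {..n} \<and> J \<inter> {..n} \<subseteq> J"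
      using X by (intro eventually_sequentiallyI[of "Max (insert 0 X)"]) force
  qed
  then show ?thesis using assms unfolding has_sum_def by (rule filterlim_compose[rotated])
qed

text \<open>A shift by \<open>s *\<^sub>R \<phi> j\<close> moves the single coefficient
  \<open>\<xi> j 1\<close> by \<open>s / b j\<close>, which is where \<open>b j \<noteq> 0\<close>
  enters; the other coefficients are independent of it. Boundedness of \<open>\<eta>\<close> bounds
  this coefficient too, so its density has bounded support. The estimate is proved for partial sums,
  whose remaining part is a function of finitely many coefficients, and passes to the limit because
  \<open>G\<close> is continuous and bounded.\<close>

lemma (in prob_space) basis_shift_estimate:
  fixes \<eta> :: "'a \<Rightarrow> 'e::{real_inner, banach, second_countable_topology}"
  assumes basis: "orthonormal_basis (J::nat set) \<phi>" and b: "\<forall>j\<in>J. b j \<noteq> 0"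
    and ind: "indep_vars (\<lambda>_. borel) (\<lambda>(j, k). \<xi> j k) (J \<times> {1::nat..})"
    and dens: "\<forall>j\<in>J. (\<forall>x. 0 \<le> \<rho> j x) \<and> (\<exists>L. L-lipschitz_on UNIV (\<rho> j)) \<and>
           (\<forall>k\<ge>1. distributed M lborel (\<xi> j k) (\<lambda>x. ennreal (\<rho> j x)))"
    and sum: "AE \<omega> in M. ((\<lambda>j. (b j * \<xi> j 1 \<omega>) *\<^sub>R \<phi> j) has_sum \<eta> \<omega>) J"
    and \<eta>: "\<eta> \<in> borel_measurable M" and bd: "AE \<omega> in M. norm (\<eta> \<omega>) \<le> R0"
    and j: "j \<in> J"
  shows "\<exists>C\<ge>0. \<forall>s B G. continuous_on UNIV G \<longrightarrow> (\<forall>x. \<bar>G x :: real\<bar> \<le> B) \<longrightarrow>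
    \<bar>(\<integral>\<omega>. G (\<eta> \<omega> + s *\<^sub>R \<phi> j) \<partial>M) - (\<integral>\<omega>. G (\<eta> \<omega>) \<partial>M)\<bar> \<le> C * \<bar>s\<bar> * B"
proof -
  have bj: "b j \<noteq> 0" using b j by blast
  obtain L where L: "L-lipschitz_on UNIV (\<rho> j)" using dens j by blast
  have nn: "\<And>x. 0 \<le> \<rho> j x" and d: "distributed M lborel (\<xi> j 1) (\<lambda>x. ennreal (\<rho> j x))"
    using dens j by auto
  have ip: "inner (\<phi> i) (\<phi> j) = (if i = j then 1 else 0)" if "i \<in> J" for i
    using basis that j by (simp add: orthonormal_basis_def)
  define Y where "Y = (\<lambda>n \<omega>. \<Sum>i\<in>J \<inter> {..n} - {j}. (b i * \<xi> i 1 \<omega>) *\<^sub>R \<phi> i)"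
  define E where "E = (\<lambda>n \<omega>. \<Sum>i\<in>J \<inter> {..n}. (b i * \<xi> i 1 \<omega>) *\<^sub>R \<phi> i)"
  have E_eq: "E n \<omega> = \<xi> j 1 \<omega> *\<^sub>R (b j *\<^sub>R \<phi> j) + Y n \<omega>" if "n \<ge> j" for n \<omega>
    unfolding E_def Y_def using that j by (subst sum.remove[of _ j]) (auto simp: mult.commute)
  have lim: "AE \<omega> in M. (\<lambda>n. E n \<omega>) \<longlonglongrightarrow> \<eta> \<omega>"
    using sum by eventually_elim (auto simp: E_def dest: has_sum_nat_partial_sums)
  have xbd: "AE \<omega> in M. \<bar>\<xi> j 1 \<omega>\<bar> \<le> \<bar>R0\<bar> / \<bar>b j\<bar>"
    using lim bd
  proof eventually_elim
    case (elim \<omega>)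
    have "(\<lambda>n. inner (E n \<omega>) (\<phi> j)) \<longlonglongrightarrow> inner (\<eta> \<omega>) (\<phi> j)" by (intro tendsto_intros elim)
    moreover have "inner (E n \<omega>) (\<phi> j) = b j * \<xi> j 1 \<omega>" if "n \<ge> j" for n
    proof -
      have "inner (Y n \<omega>) (\<phi> j) = (\<Sum>i\<in>J \<inter> {..n} - {j}. (b i * \<xi> i 1 \<omega>) * inner (\<phi> i) (\<phi> j))"
        by (simp add: Y_def inner_sum_left)
      also have "\<dots> = 0" by (rule sum.neutral) (use ip in auto)
      finally show ?thesis using E_eq[OF that] ip[OF j] by (simp add: inner_add_left)
    qed
    then have "\<forall>\<^sub>F n in sequentially. inner (E n \<omega>) (\<phi> j) = b j * \<xi> j 1 \<omega>"
      by (rule eventually_sequentiallyI)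
    then have "(\<lambda>n. inner (E n \<omega>) (\<phi> j)) \<longlonglongrightarrow> b j * \<xi> j 1 \<omega>" by (rule tendsto_eventually)
    ultimately have "b j * \<xi> j 1 \<omega> = inner (\<eta> \<omega>) (\<phi> j)" using LIMSEQ_unique by blast
    then have "\<bar>b j * \<xi> j 1 \<omega>\<bar> \<le> norm (\<eta> \<omega>) * norm (\<phi> j)" by (metis Cauchy_Schwarz_ineq2)
    also have "norm (\<phi> j) = 1" using ip[OF j] by (simp add: norm_eq_sqrt_inner)
    finally have "\<bar>b j\<bar> * \<bar>\<xi> j 1 \<omega>\<bar> \<le> \<bar>R0\<bar>" using elim(2) by (simp add: abs_mult)
    then show ?case using bj by (simp add: field_simps)
  qed
  define R where "R = \<bar>R0\<bar> / \<bar>b j\<bar>"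
  have R: "R \<ge> 0" by (simp add: R_def)
  have supp: "\<And>x. \<bar>x\<bar> > R \<Longrightarrow> \<rho> j x = 0"
    using lipschitz_density_support[OF d lipschitz_on_continuous_on[OF L] nn xbd] by (simp add: R_def)
  have indep: "indep_var (borel \<Otimes>\<^sub>M borel) (\<lambda>\<omega>. (\<xi> j 1 \<omega>, 0 :: 'e)) (borel \<Otimes>\<^sub>M borel) (\<lambda>\<omega>. (0 :: real, Y n \<omega>))" for n
  proof -
    let ?A = "{(j, 1::nat)}" and ?B = "(J \<inter> {..n} - {j}) \<times> {1::nat}"
    let ?X = "\<lambda>(j, k). \<xi> j k"
    let ?p = "\<lambda>f. (f (j, 1), 0 :: 'e)"
    let ?q = "\<lambda>f. (0 :: real, \<Sum>i\<in>J \<inter> {..n} - {j}. (b i * f (i, 1)) *\<^sub>R \<phi> i)"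
    have "indep_var (borel \<Otimes>\<^sub>M borel) (?p \<circ> (\<lambda>\<omega>. restrict (\<lambda>i. ?X i \<omega>) ?A))
      (borel \<Otimes>\<^sub>M borel) (?q \<circ> (\<lambda>\<omega>. restrict (\<lambda>i. ?X i \<omega>) ?B))"
    proof (rule indep_var_compose[OF indep_var_restrict[OF ind]])
      show "?p \<in> measurable (Pi\<^sub>M ?A (\<lambda>_. borel)) (borel \<Otimes>\<^sub>M borel)" by measurable
      show "?q \<in> measurable (Pi\<^sub>M ?B (\<lambda>_. borel)) (borel \<Otimes>\<^sub>M borel)"
        by (intro measurable_Pair borel_measurable_sum borel_measurable_scaleR borel_measurable_times borel_measurable_const
            measurable_component_singleton) auto
    qed (use j in auto)
    also have "(?p \<circ> (\<lambda>\<omega>. restrict (\<lambda>i. ?X i \<omega>) ?A)) = (\<lambda>\<omega>. (\<xi> j 1 \<omega>, 0))" by (auto simp: fun_eq_iff)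
    also have "(?q \<circ> (\<lambda>\<omega>. restrict (\<lambda>i. ?X i \<omega>) ?B)) = (\<lambda>\<omega>. (0, Y n \<omega>))"
      by (auto simp: fun_eq_iff Y_def intro!: sum.cong)
    finally show ?thesis .
  qed
  have mE: "E n \<in> borel_measurable M" if "n \<ge> j" for n
    using measurable_compose[OF indep_var_rv1[OF indep[of n]] measurable_fst]
      measurable_compose[OF indep_var_rv2[OF indep[of n]] measurable_snd]
    unfolding E_eq[OF that, abs_def] by simp
  define C where "C = 4 * R * L / \<bar>b j\<bar>"
  have "C \<ge> 0" using R lipschitz_on_nonneg[OF L] by (simp add: C_def)
  moreover have "\<bar>(\<integral>\<omega>. G (\<eta> \<omega> + s *\<^sub>R \<phi> j) \<partial>M) - (\<integral>\<omega>. G (\<eta> \<omega>) \<partial>M)\<bar> \<le> C * \<bar>s\<bar> * B"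
    if G: "continuous_on UNIV G" "\<forall>x. \<bar>G x :: real\<bar> \<le> B" for s B G
  proof -
    have Gm: "G \<in> borel_measurable borel" using G(1) by (rule borel_measurable_continuous_onI)
    \<comment> \<open>Starting at index \<open>j\<close> ensures that every partial sum contains the
      shifted coefficient.\<close>
    have conv: "(\<lambda>n. \<integral>\<omega>. G (E (n + j) \<omega> + v) \<partial>M) \<longlonglongrightarrow> (\<integral>\<omega>. G (\<eta> \<omega> + v) \<partial>M)" for v
    proof (rule integral_dominated_convergence[where w = "\<lambda>_. B"])
      show "AE \<omega> in M. (\<lambda>n. G (E (n + j) \<omega> + v)) \<longlonglongrightarrow> G (\<eta> \<omega> + v)"
        using lim
      proof eventually_elim
        case (elim \<omega>)
        then have "(\<lambda>n. E (n + j) \<omega> + v) \<longlonglongrightarrow> \<eta> \<omega> + v" by (intro tendsto_intros LIMSEQ_ignore_initial_segment)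
        then show ?case using G(1) by (auto intro: continuous_on_tendsto_compose)
      qed
      show "(\<lambda>\<omega>. G (\<eta> \<omega> + v)) \<in> borel_measurable M" using Gm \<eta> by measurable
      show "(\<lambda>\<omega>. G (E (n + j) \<omega> + v)) \<in> borel_measurable M" for n
        using measurable_compose[OF borel_measurable_add[OF mE[of "n + j"] borel_measurable_const] Gm] by simp
    qed (use G in auto)
    have "\<bar>(\<integral>\<omega>. G (E (n + j) \<omega> + s *\<^sub>R \<phi> j) \<partial>M) - (\<integral>\<omega>. G (E (n + j) \<omega> + 0) \<partial>M)\<bar> \<le> C * \<bar>s\<bar> * B" for n
    proof -
      have e1: "E (n + j) \<omega> + s *\<^sub>R \<phi> j = (\<xi> j 1 \<omega> + s / b j) *\<^sub>R (b j *\<^sub>R \<phi> j) + Y (n + j) \<omega>" for \<omega>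
        using bj by (simp add: E_eq algebra_simps)
      have e2: "E (n + j) \<omega> + 0 = \<xi> j 1 \<omega> *\<^sub>R (b j *\<^sub>R \<phi> j) + Y (n + j) \<omega>" for \<omega>
        by (simp add: E_eq)
      show ?thesis unfolding e1 e2
        using shift_estimate[OF indep[of "n + j"] d nn L supp R Gm G(2)[rule_format], of "s / b j" "b j *\<^sub>R \<phi> j"]
        by (simp add: C_def)
    qed
    moreover have "(\<lambda>n. \<bar>(\<integral>\<omega>. G (E (n + j) \<omega> + s *\<^sub>R \<phi> j) \<partial>M) - (\<integral>\<omega>. G (E (n + j) \<omega> + 0) \<partial>M)\<bar>)
      \<longlonglongrightarrow> \<bar>(\<integral>\<omega>. G (\<eta> \<omega> + s *\<^sub>R \<phi> j) \<partial>M) - (\<integral>\<omega>. G (\<eta> \<omega> + 0) \<partial>M)\<bar>"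
      by (intro tendsto_intros conv)
    ultimately show ?thesis by (auto intro: LIMSEQ_le_const2)
  qed
  ultimately show ?thesis by blast
qed

text \<open>The translates of the law along \<open>v\<close> depend on the amount of the shift in a
  Lipschitz way in total variation, tested here against bounded continuous functions. The constant
  may depend on \<open>v\<close>, which is harmless because only finitely many directions are used
  at a time.\<close>

definition shift_regular :: "'e::real_normed_vector measure \<Rightarrow> 'e \<Rightarrow> bool" where
  "shift_regular \<l> v \<longleftrightarrow> (\<exists>C\<ge>0. \<forall>s B G. continuous_on UNIV G \<longrightarrow> (\<forall>x. \<bar>G x :: real\<bar> \<le> B) \<longrightarrow>
    \<bar>(\<integral>x. G (x + s *\<^sub>R v) \<partial>\<l>) - (\<integral>x. G x \<partial>\<l>)\<bar> \<le> C * \<bar>s\<bar> * B)"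

text \<open>For a sum of directions, shift along one and then along the other; the shifted test
  function has the same bound. This carries regularity from the basis vectors to their span, which
  is dense.\<close>

lemma shift_regular_subspace: "subspace {v. shift_regular \<l> v}"
  unfolding subspace_def
proof (safe, goal_cases)
  case 1 then show ?case unfolding shift_regular_def by (intro exI[of _ 0]) auto
next
  case (2 v w)
  then obtain C D where C: "C \<ge> 0" "\<And>s B G. continuous_on UNIV G \<Longrightarrow> (\<forall>x. \<bar>G x :: real\<bar> \<le> B) \<Longrightarrow>
      \<bar>(\<integral>x. G (x + s *\<^sub>R v) \<partial>\<l>) - (\<integral>x. G x \<partial>\<l>)\<bar> \<le> C * \<bar>s\<bar> * B"
    and D: "D \<ge> 0" "\<And>s B G. continuous_on UNIV G \<Longrightarrow> (\<forall>x. \<bar>G x :: real\<bar> \<le> B) \<Longrightarrow>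
      \<bar>(\<integral>x. G (x + s *\<^sub>R w) \<partial>\<l>) - (\<integral>x. G x \<partial>\<l>)\<bar> \<le> D * \<bar>s\<bar> * B"
    unfolding shift_regular_def by metis
  have "\<bar>(\<integral>x. G (x + s *\<^sub>R (v + w)) \<partial>\<l>) - (\<integral>x. G x \<partial>\<l>)\<bar> \<le> (C + D) * \<bar>s\<bar> * B"
    if G: "continuous_on UNIV G" "\<forall>x. \<bar>G x :: real\<bar> \<le> B" for s B G
  proof -
    have "continuous_on UNIV (\<lambda>x. G (x + s *\<^sub>R w))"
      by (intro continuous_on_compose2[OF G(1)] continuous_intros) auto
    from C(2)[OF this, of B s] D(2)[OF G, of s] G(2)
    show ?thesis by (simp add: algebra_simps)
  qed
  then show ?case using C(1) D(1) unfolding shift_regular_def by (intro exI[of _ "C + D"]) auto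
next
  case (3 c v)
  then obtain C where C: "C \<ge> 0" "\<And>s B G. continuous_on UNIV G \<Longrightarrow> (\<forall>x. \<bar>G x :: real\<bar> \<le> B) \<Longrightarrow>
      \<bar>(\<integral>x. G (x + s *\<^sub>R v) \<partial>\<l>) - (\<integral>x. G x \<partial>\<l>)\<bar> \<le> C * \<bar>s\<bar> * B"
    unfolding shift_regular_def by metis
  have "\<bar>(\<integral>x. G (x + s *\<^sub>R c *\<^sub>R v) \<partial>\<l>) - (\<integral>x. G x \<partial>\<l>)\<bar> \<le> (C * \<bar>c\<bar>) * \<bar>s\<bar> * B"
    if G: "continuous_on UNIV G" "\<forall>x. \<bar>G x :: real\<bar> \<le> B" for s B G
    using C(2)[OF G, of "s * c"] by (simp add: abs_mult mult_ac)
  then show ?case using C(1) unfolding shift_regular_def by (intro exI[of _ "C * \<bar>c\<bar>"]) auto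
qed

lemma decomposable_noise_shift_regular:
  fixes \<eta> :: "nat \<Rightarrow> 'w \<Rightarrow> 'e::{real_inner, banach, second_countable_topology}"
  assumes P: "prob_space P" and dec: "decomposable_noise P \<eta>" and m: "\<eta> 1 \<in> borel_measurable P"
    and bd: "AE \<omega> in P. norm (\<eta> 1 \<omega>) \<le> R0"
  shows "closure {v. shift_regular (distr P borel (\<eta> 1)) v} = UNIV"
proof -
  interpret prob_space P by fact
  obtain J \<phi> b \<xi> \<rho> where J: "orthonormal_basis (J::nat set) \<phi>" "\<forall>j\<in>J. b j \<noteq> 0"
    "indep_vars (\<lambda>_. borel) (\<lambda>(j, k). \<xi> j k) (J \<times> {1::nat..})"
    "\<forall>j\<in>J. (\<forall>x. 0 \<le> \<rho> j x) \<and> (\<exists>L. L-lipschitz_on UNIV (\<rho> j)) \<and>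
           (\<forall>k\<ge>1. distributed P lborel (\<xi> j k) (\<lambda>x. ennreal (\<rho> j x)))"
    and hs: "\<forall>k\<ge>1. AE \<omega> in P. ((\<lambda>j. (b j * \<xi> j k \<omega>) *\<^sub>R \<phi> j) has_sum \<eta> k \<omega>) J"
    using dec unfolding decomposable_noise_def by blast
  have "\<phi> j \<in> {v. shift_regular (distr P borel (\<eta> 1)) v}" if j: "j \<in> J" for j
  proof -
    have hs1: "AE \<omega> in P. ((\<lambda>j. (b j * \<xi> j 1 \<omega>) *\<^sub>R \<phi> j) has_sum \<eta> 1 \<omega>) J" using hs by blast
    obtain C where C: "C \<ge> 0" "\<And>s B G. continuous_on UNIV G \<Longrightarrow> (\<forall>x. \<bar>G x :: real\<bar> \<le> B) \<Longrightarrow>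
      \<bar>(\<integral>\<omega>. G (\<eta> 1 \<omega> + s *\<^sub>R \<phi> j) \<partial>P) - (\<integral>\<omega>. G (\<eta> 1 \<omega>) \<partial>P)\<bar> \<le> C * \<bar>s\<bar> * B"
      using basis_shift_estimate[OF J hs1 m bd j] by blast
    have "\<bar>(\<integral>x. G (x + s *\<^sub>R \<phi> j) \<partial>distr P borel (\<eta> 1)) - (\<integral>x. G x \<partial>distr P borel (\<eta> 1))\<bar> \<le> C * \<bar>s\<bar> * B"
      if G: "continuous_on UNIV G" "\<forall>x. \<bar>G x :: real\<bar> \<le> B" for s B G
    proof -
      have Gm: "G \<in> borel_measurable borel" using G(1) by (rule borel_measurable_continuous_onI)
      then have "(\<lambda>x. G (x + s *\<^sub>R \<phi> j)) \<in> borel_measurable borel" by measurable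
      then show ?thesis using C(2)[OF G, of s] Gm m by (simp add: integral_distr)
    qed
    then show ?thesis using C(1) unfolding shift_regular_def by blast
  qed
  then have "span (\<phi> ` J) \<subseteq> {v. shift_regular (distr P borel (\<eta> 1)) v}"
    by (intro span_minimal shift_regular_subspace) auto
  then show ?thesis using J(1) closure_mono unfolding orthonormal_basis_def by blast
qed

section \<open>The Lasota-Yorke inequality\<close>

lemma lipschitz_on_mult_bounded:
  fixes f g :: "'a::metric_space \<Rightarrow> real"
  assumes f: "C-lipschitz_on UNIV f" "\<And>x. \<bar>f x\<bar> \<le> 1" and g: "D-lipschitz_on UNIV g" "\<And>x. \<bar>g x\<bar> \<le> 1"
  shows "(C + D)-lipschitz_on UNIV (\<lambda>x. f x * g x)"
proof (rule lipschitz_onI)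
  fix x y
  have "f x * g x - f y * g y = (f x - f y) * g x + f y * (g x - g y)" by (simp add: algebra_simps)
  then have "\<bar>f x * g x - f y * g y\<bar> \<le> \<bar>f x - f y\<bar> * \<bar>g x\<bar> + \<bar>f y\<bar> * \<bar>g x - g y\<bar>"
    by (metis abs_mult abs_triangle_ineq)
  also have "\<dots> \<le> \<bar>f x - f y\<bar> * 1 + 1 * \<bar>g x - g y\<bar>"
    using f(2) g(2) by (intro add_mono mult_left_mono mult_right_mono) auto
  also have "\<dots> \<le> C * dist x y + D * dist x y"
    using lipschitz_onD[OF f(1), of x y] lipschitz_onD[OF g(1), of x y] by (simp add: dist_real_def)
  finally show "dist (f x * g x) (f y * g y) \<le> (C + D) * dist x y" by (simp add: dist_real_def distrib_right)
qed (use lipschitz_on_nonneg[OF f(1)] lipschitz_on_nonneg[OF g(1)] in auto)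

definition bump :: "'a::metric_space \<Rightarrow> real \<Rightarrow> 'a \<Rightarrow> real" where
  "bump a r x = max 0 (min 1 (2 - 2 * dist x a / r))"

lemma bump_bounds: "0 \<le> bump a r x" "bump a r x \<le> 1"
  by (auto simp: bump_def)

lemma bump_eq_1: "r > 0 \<Longrightarrow> x \<in> ball a (r/2) \<Longrightarrow> bump a r x = 1"
  by (simp add: bump_def dist_commute field_simps)

lemma bump_eq_0: "r > 0 \<Longrightarrow> x \<notin> ball a r \<Longrightarrow> bump a r x = 0"
  by (simp add: bump_def dist_commute field_simps)

lemma clamp_diff_le:
  fixes a b :: real
  shows "\<bar>max 0 (min 1 a) - max 0 (min 1 b)\<bar> \<le> \<bar>a - b\<bar>"
  by (simp add: max_def min_def)

lemma bump_lipschitz: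
  assumes "r > 0" shows "(2/r)-lipschitz_on UNIV (bump a r)"
proof (rule lipschitz_onI)
  fix x y :: 'a
  have "\<bar>bump a r x - bump a r y\<bar> \<le> \<bar>2 * dist x a / r - 2 * dist y a / r\<bar>"
    unfolding bump_def using clamp_diff_le[of "2 - 2 * dist x a / r" "2 - 2 * dist y a / r"]
    by (simp add: abs_minus_commute)
  also have "\<dots> = (2/r) * \<bar>dist x a - dist y a\<bar>"
  proof -
    have "2 * dist x a / r - 2 * dist y a / r = (2/r) * (dist x a - dist y a)"
      by (simp add: right_diff_distrib)
    moreover have "\<bar>2/r\<bar> = 2/r" using assms by simp
    ultimately show ?thesis by (metis abs_mult)
  qed
  also have "\<dots> \<le> (2/r) * dist x y"
    using assms abs_dist_diff_le[of x a y] by (intro mult_left_mono) (auto simp: dist_commute)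
  finally show "dist (bump a r x) (bump a r y) \<le> (2/r) * dist x y" by (simp add: dist_real_def)
qed (use assms in auto)

locale noisy_map =
  fixes S :: "'x::{metric_space, second_countable_topology} \<times> 'e::{real_normed_vector, second_countable_topology} \<Rightarrow> 'x"
    and \<l> :: "'e measure" and K :: "'e set" and X :: "'x set"
  assumes prob: "prob_space \<l>" and sets_l: "sets \<l> = sets borel"
    and S_continuous: "continuous_on UNIV S"
    and K_compact: "compact K" and AE_K: "AE e in \<l>. e \<in> K"
    and X_compact: "compact X" and X_nonempty: "X \<noteq> {}" and X_inv: "S ` (X \<times> K) \<subseteq> X"
begin

sublocale prob_space \<l> by (rule prob)

definition Q :: "('x \<Rightarrow> real) \<Rightarrow> 'x \<Rightarrow> real" where
  "Q f z = (\<integral>e. f (S (z, e)) \<partial>\<l>)"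

lemma borel_measurable_l: "borel_measurable \<l> = borel_measurable borel"
  by (rule measurable_cong_sets[OF sets_l refl])

lemma S_section: "continuous_on UNIV (\<lambda>e. S (z, e + v))"
  by (intro continuous_on_compose2[OF S_continuous] continuous_intros) auto

lemma integrable_bounded:
  assumes "(g :: 'e \<Rightarrow> real) \<in> borel_measurable borel" "\<And>x. \<bar>g x\<bar> \<le> B"
  shows "integrable \<l> g"
  using assms by (intro integrable_const_bound[of _ B]) (auto simp: borel_measurable_l)

lemma integral_abs_le:
  assumes "(g :: 'e \<Rightarrow> real) \<in> borel_measurable borel" "\<And>x. \<bar>g x\<bar> \<le> B"
  shows "\<bar>\<integral>x. g x \<partial>\<l>\<bar> \<le> B"
proof -
  have "\<bar>\<integral>x. g x \<partial>\<l>\<bar> \<le> (\<integral>x. \<bar>g x\<bar> \<partial>\<l>)" by (rule integral_abs_bound)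
  also have "\<dots> \<le> (\<integral>x. B \<partial>\<l>)"
    by (intro integral_mono integrable_abs integrable_bounded[OF assms] integrable_const) (rule assms)
  finally show ?thesis using prob_space by simp
qed

text \<open>The weight \<open>\<zeta>\<close> localises the noise where one and the same shift direction works.\<close>

lemma weighted_difference:
  assumes r: "r > 0" and W: "finite W" "\<And>v. v \<in> W \<Longrightarrow> shift_regular \<l> v" and R: "R \<ge> 0"
    and sh: "\<And>z z'. z\<in>ball z0 r \<Longrightarrow> z'\<in>ball z0 r \<Longrightarrow> \<exists>v\<in>W. \<exists>t. 0 \<le> t \<and> t \<le> R * dist z z' \<and>
       (\<forall>\<eta>\<in>ball \<eta>0 r. dist (S (z, \<eta>)) (S (z', \<eta> + t *\<^sub>R v)) \<le> \<epsilon> * dist z z')"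
    and chi: "\<kappa>-lipschitz_on UNIV \<zeta>" "\<And>e. 0 \<le> \<zeta> e" "\<And>e. \<zeta> e \<le> 1" "\<And>e. e \<notin> ball \<eta>0 r \<Longrightarrow> \<zeta> e = 0"
    and \<epsilon>: "\<epsilon> \<ge> 0"
  shows "\<exists>C\<ge>0. \<forall>z\<in>ball z0 r. \<forall>z'\<in>ball z0 r. \<forall>f \<Lambda> B. \<Lambda>-lipschitz_on UNIV f \<longrightarrow> (\<forall>x. \<bar>f x :: real\<bar> \<le> B) \<longrightarrow>
    \<bar>\<integral>e. \<zeta> e * (f (S (z, e)) - f (S (z', e))) \<partial>\<l>\<bar> \<le> (C * B + \<epsilon> * \<Lambda> * (\<integral>e. \<zeta> e \<partial>\<l>)) * dist z z'"
proof -
  obtain c where c: "\<And>v. v \<in> W \<Longrightarrow> c v \<ge> 0"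
      "\<And>v s B G. v \<in> W \<Longrightarrow> continuous_on UNIV G \<Longrightarrow> (\<forall>x. \<bar>G x :: real\<bar> \<le> B) \<Longrightarrow>
        \<bar>(\<integral>x. G (x + s *\<^sub>R v) \<partial>\<l>) - (\<integral>x. G x \<partial>\<l>)\<bar> \<le> c v * \<bar>s\<bar> * B"
    using W(2) unfolding shift_regular_def by metis
  define D where "D = (\<Sum>v\<in>W. \<kappa> * norm v + c v)"
  have \<kappa>: "\<kappa> \<ge> 0" using chi(1) by (rule lipschitz_on_nonneg)
  have D: "\<kappa> * norm v + c v \<le> D" if "v \<in> W" for v
    unfolding D_def using that W(1) c(1) \<kappa> by (intro member_le_sum) auto
  have D0: "D \<ge> 0" unfolding D_def using c(1) \<kappa> by (intro sum_nonneg) auto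
  have chic: "continuous_on UNIV \<zeta>" using chi(1) by (rule lipschitz_on_continuous_on)
  have "\<bar>\<integral>e. \<zeta> e * (f (S (z, e)) - f (S (z', e))) \<partial>\<l>\<bar> \<le> (R * D * B + \<epsilon> * \<Lambda> * (\<integral>e. \<zeta> e \<partial>\<l>)) * dist z z'"
    if z: "z \<in> ball z0 r" "z' \<in> ball z0 r" and f: "\<Lambda>-lipschitz_on UNIV f" "\<forall>x. \<bar>f x :: real\<bar> \<le> B" for z z' f \<Lambda> B
  proof -
    have B: "B \<ge> 0" using f(2) by (meson abs_ge_zero order_trans)
    have \<Lambda>: "\<Lambda> \<ge> 0" using f(1) by (rule lipschitz_on_nonneg)
    obtain v t where vt: "v \<in> W" "0 \<le> t" "t \<le> R * dist z z'"
      and d: "\<And>\<eta>. \<eta>\<in>ball \<eta>0 r \<Longrightarrow> dist (S (z, \<eta>)) (S (z', \<eta> + t *\<^sub>R v)) \<le> \<epsilon> * dist z z'"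
      using sh[OF z] by blast
    have fc: "continuous_on UNIV (\<lambda>e. f (S (z, e + u)))" for z u
      by (rule continuous_on_compose2[OF lipschitz_on_continuous_on[OF f(1)] S_section]) auto
    have fc0: "continuous_on UNIV (\<lambda>e. f (S (z, e)))" for z using fc[of z 0] by simp
    have chis: "continuous_on UNIV (\<lambda>e. \<zeta> (e + u))" for u
      by (intro continuous_on_compose2[OF chic] continuous_intros) auto
    let ?u = "t *\<^sub>R v"
    \<comment> \<open>The integrand equals \<open>?A + ?B + (G (e + ?u) - G e)\<close>. Here
      \<open>?A\<close> compares the image of \<open>z\<close> with the compensated image of
      \<open>z'\<close>, \<open>?B\<close> pays for moving the weight, and the last difference is
      the price of the shift under \<open>shift_regular\<close>. The latter two are of order
      \<open>t * B\<close>.\<close>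
    let ?A = "\<lambda>e. \<zeta> e * (f (S (z, e)) - f (S (z', e + ?u)))"
    let ?B = "\<lambda>e. (\<zeta> e - \<zeta> (e + ?u)) * f (S (z', e + ?u))"
    define G where "G = (\<lambda>e. \<zeta> e * f (S (z', e)))"
    have Gc: "continuous_on UNIV G" unfolding G_def by (intro continuous_intros chic fc0)
    have Gb: "\<bar>G e\<bar> \<le> B" for e
    proof -
      have "\<bar>\<zeta> e\<bar> * \<bar>f (S (z', e))\<bar> \<le> 1 * B" using chi(2,3) f(2) by (intro mult_mono) auto
      then show ?thesis by (simp add: G_def abs_mult)
    qed
    have Ab: "\<bar>?A e\<bar> \<le> \<zeta> e * (\<Lambda> * (\<epsilon> * dist z z'))" for e
    proof (cases "e \<in> ball \<eta>0 r")
      case True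
      have "\<bar>f (S (z, e)) - f (S (z', e + ?u))\<bar> \<le> \<Lambda> * dist (S (z, e)) (S (z', e + ?u))"
        using lipschitz_onD[OF f(1), of "S (z, e)" "S (z', e + ?u)"] by (simp add: dist_real_def)
      also have "\<dots> \<le> \<Lambda> * (\<epsilon> * dist z z')" using d[OF True] \<Lambda> by (rule mult_left_mono)
      finally show ?thesis using chi(2)[of e] by (simp add: abs_mult mult_left_mono)
    next
      case False
      then show ?thesis using chi(4) by simp
    qed
    have Bb: "\<bar>?B e\<bar> \<le> \<kappa> * (t * norm v) * B" for e
    proof -
      have "\<bar>\<zeta> e - \<zeta> (e + ?u)\<bar> \<le> \<kappa> * (t * norm v)"
        using lipschitz_onD[OF chi(1), of e "e + ?u"] vt by (simp add: dist_real_def dist_norm)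
      then show ?thesis unfolding abs_mult using f(2) \<kappa> vt by (intro mult_mono) auto
    qed
    have chii: "integrable \<l> \<zeta>"
      using chi(2,3) by (intro integrable_bounded[of _ 1] borel_measurable_continuous_onI[OF chic]) auto
    have Ac: "?A \<in> borel_measurable borel"
      by (intro borel_measurable_continuous_onI continuous_intros chic fc fc0)
    have Bc: "?B \<in> borel_measurable borel"
      by (intro borel_measurable_continuous_onI continuous_intros chic chis fc)
    have Ai: "integrable \<l> ?A"
    proof (rule integrable_bounded[OF Ac])
      fix e
      have "\<zeta> e * (\<Lambda> * (\<epsilon> * dist z z')) \<le> 1 * (\<Lambda> * (\<epsilon> * dist z z'))"
        using chi(3) \<Lambda> \<epsilon> by (intro mult_right_mono) auto
      then show "\<bar>?A e\<bar> \<le> 1 * (\<Lambda> * (\<epsilon> * dist z z'))" using Ab[of e] by linarith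
    qed
    have Bi: "integrable \<l> ?B" using Bc Bb by (rule integrable_bounded)
    have Gi: "integrable \<l> G" using borel_measurable_continuous_onI[OF Gc] Gb by (rule integrable_bounded)
    have Gsc: "continuous_on UNIV (\<lambda>e. G (e + ?u))"
      by (intro continuous_on_compose2[OF Gc] continuous_intros) auto
    have Gsi: "integrable \<l> (\<lambda>e. G (e + ?u))"
      using borel_measurable_continuous_onI[OF Gsc] Gb by (rule integrable_bounded)
    have "(\<integral>e. \<zeta> e * (f (S (z, e)) - f (S (z', e))) \<partial>\<l>) = (\<integral>e. ?A e + ?B e + (G (e + ?u) - G e) \<partial>\<l>)"
      by (intro Bochner_Integration.integral_cong) (auto simp: G_def algebra_simps)
    also have "\<dots> = (\<integral>e. ?A e \<partial>\<l>) + (\<integral>e. ?B e \<partial>\<l>) + ((\<integral>e. G (e + ?u) \<partial>\<l>) - (\<integral>e. G e \<partial>\<l>))"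
      using Ai Bi Gi Gsi by simp
    finally have eq: "(\<integral>e. \<zeta> e * (f (S (z, e)) - f (S (z', e))) \<partial>\<l>) = \<dots>" .
    have "\<bar>\<integral>e. ?A e \<partial>\<l>\<bar> \<le> (\<integral>e. \<bar>?A e\<bar> \<partial>\<l>)" by (rule integral_abs_bound)
    also have "\<dots> \<le> (\<integral>e. \<zeta> e * (\<Lambda> * (\<epsilon> * dist z z')) \<partial>\<l>)"
      by (intro integral_mono integrable_abs Ai integrable_mult_left chii Ab)
    also have "\<dots> = \<epsilon> * \<Lambda> * (\<integral>e. \<zeta> e \<partial>\<l>) * dist z z'" by simp
    finally have 1: "\<bar>\<integral>e. ?A e \<partial>\<l>\<bar> \<le> \<epsilon> * \<Lambda> * (\<integral>e. \<zeta> e \<partial>\<l>) * dist z z'" .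
    have 2: "\<bar>\<integral>e. ?B e \<partial>\<l>\<bar> \<le> \<kappa> * (t * norm v) * B" using Bc Bb by (rule integral_abs_le)
    have 3: "\<bar>(\<integral>e. G (e + ?u) \<partial>\<l>) - (\<integral>e. G e \<partial>\<l>)\<bar> \<le> c v * t * B"
      using c(2)[OF vt(1) Gc, of B t] Gb vt(2) by simp
    have "\<kappa> * (t * norm v) * B + c v * t * B = (\<kappa> * norm v + c v) * (t * B)" by (simp add: algebra_simps)
    also have "\<dots> \<le> D * ((R * dist z z') * B)"
      using D[OF vt(1)] D0 vt B by (intro mult_mono) auto
    finally have "\<kappa> * (t * norm v) * B + c v * t * B \<le> R * D * B * dist z z'" by (simp add: mult_ac)
    then show ?thesis unfolding eq using 1 2 3 by (simp add: distrib_right)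
  qed
  then show ?thesis using R D0 by (intro exI[of _ "R * D"]) auto
qed

end

text \<open>The two properties through which the smooth structure enters the probabilistic argument;
  the state space is an abstract metric space from here on.\<close>

locale contracting_noisy_map = noisy_map S \<l> K X
  for S :: "'x::{metric_space, second_countable_topology} \<times> 'e::{real_normed_vector, second_countable_topology} \<Rightarrow> 'x"
    and \<l> K X +
  assumes loc_Lip: "\<And>z0 \<eta>0. \<exists>r>0. \<exists>L\<ge>0. \<forall>z\<in>ball z0 r. \<forall>z'\<in>ball z0 r. \<forall>\<eta>\<in>ball \<eta>0 r.
      dist (S (z, \<eta>)) (S (z', \<eta>)) \<le> L * dist z z'"
    and good_shift: "\<And>z0. z0 \<in> X \<Longrightarrow> AE \<eta>0 in \<l>. \<forall>\<epsilon>>0. \<exists>r>0. \<exists>W R. finite W \<and> W \<subseteq> {v. shift_regular \<l> v} \<and> R \<ge> 0 \<and>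
      (\<forall>z\<in>ball z0 r. \<forall>z'\<in>ball z0 r. \<exists>v\<in>W. \<exists>t. 0 \<le> t \<and> t \<le> R * dist z z' \<and>
       (\<forall>\<eta>\<in>ball \<eta>0 r. dist (S (z, \<eta>)) (S (z', \<eta> + t *\<^sub>R v)) \<le> \<epsilon> * dist z z'))"
begin

text \<open>Compactness of \<open>K\<close> removes the dependence of radius and constant on the
  noise value. This crude bound is applied to the noise that the cutoffs leave over.\<close>

lemma uniform_Lip:
  "\<exists>r>0. \<exists>L\<ge>0. \<forall>z\<in>ball z0 r. \<forall>z'\<in>ball z0 r. \<forall>\<eta>\<in>K. dist (S (z, \<eta>)) (S (z', \<eta>)) \<le> L * dist z z'"
proof -
  obtain r L where rL: "\<And>\<eta>. r \<eta> > 0" "\<And>\<eta>. L \<eta> \<ge> 0"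
      "\<And>\<eta>0 z z' \<eta>. z\<in>ball z0 (r \<eta>0) \<Longrightarrow> z'\<in>ball z0 (r \<eta>0) \<Longrightarrow> \<eta>\<in>ball \<eta>0 (r \<eta>0) \<Longrightarrow>
        dist (S (z, \<eta>)) (S (z', \<eta>)) \<le> L \<eta>0 * dist z z'"
    using loc_Lip[of z0] by metis
  have "K \<subseteq> (\<Union>\<eta>\<in>K. ball \<eta> (r \<eta>))" using rL(1) by auto
  then obtain D where D: "D \<subseteq> K" "finite D" "K \<subseteq> (\<Union>\<eta>\<in>D. ball \<eta> (r \<eta>))"
    using compactE_image[OF K_compact] by (metis (no_types, lifting) open_ball)
  define \<rho> where "\<rho> = Min (insert 1 (r ` D))"
  have \<rho>: "\<rho> > 0" "\<And>\<eta>. \<eta> \<in> D \<Longrightarrow> \<rho> \<le> r \<eta>" using D(2) rL(1) by (auto simp: \<rho>_def)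
  have "dist (S (z, \<eta>)) (S (z', \<eta>)) \<le> (\<Sum>\<eta>\<in>D. L \<eta>) * dist z z'"
    if zz: "z \<in> ball z0 \<rho>" "z' \<in> ball z0 \<rho>" "\<eta> \<in> K" for z z' \<eta>
  proof -
    obtain \<eta>0 where e: "\<eta>0 \<in> D" "\<eta> \<in> ball \<eta>0 (r \<eta>0)" using D(3) zz(3) by blast
    have "dist (S (z, \<eta>)) (S (z', \<eta>)) \<le> L \<eta>0 * dist z z'"
      using zz \<rho>(2)[OF e(1)] by (intro rL(3) e) auto
    also have "\<dots> \<le> (\<Sum>\<eta>\<in>D. L \<eta>) * dist z z'"
      using e(1) D(2) rL(2) by (intro mult_right_mono member_le_sum) auto
    finally show ?thesis .
  qed
  then show ?thesis using \<rho>(1) rL(2) by (intro exI[of _ \<rho>] conjI exI[of _ "\<Sum>\<eta>\<in>D. L \<eta>"] sum_nonneg) auto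
qed

text \<open>By Lindelof countably many balls of good noise values cover almost all of the noise.
  Cutting off one ball after the other gives Lipschitz weights, each of which contributes
  \<open>\<epsilon>1\<close> times its own integral, so the factor of \<Lambda> does not grow with
  the number of balls, while \<open>C\<close> may. The mass left after \<open>n\<close> balls tends
  to 0 and is charged to the crude Lipschitz bound.\<close>

lemma local_Lasota_Yorke:
  assumes z0: "z0 \<in> X" and \<epsilon>: "\<epsilon> > 0"
  shows "\<exists>r>0. \<exists>C\<ge>0. \<forall>z\<in>ball z0 r. \<forall>z'\<in>ball z0 r. \<forall>f \<Lambda> B. \<Lambda>-lipschitz_on UNIV f \<longrightarrow> (\<forall>x. \<bar>f x :: real\<bar> \<le> B) \<longrightarrow>
    \<bar>Q f z - Q f z'\<bar> \<le> (C * B + \<epsilon> * \<Lambda>) * dist z z'"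
proof -
  define \<epsilon>1 where "\<epsilon>1 = \<epsilon>/2"
  have \<epsilon>1: "\<epsilon>1 > 0" using \<epsilon> by (simp add: \<epsilon>1_def)
  define ok where "ok = (\<lambda>\<eta>0 r. r > 0 \<and> (\<exists>W R. finite W \<and> W \<subseteq> {v. shift_regular \<l> v} \<and> R \<ge> 0 \<and>
      (\<forall>z\<in>ball z0 r. \<forall>z'\<in>ball z0 r. \<exists>v\<in>W. \<exists>t. 0 \<le> t \<and> t \<le> R * dist z z' \<and>
       (\<forall>\<eta>\<in>ball \<eta>0 r. dist (S (z, \<eta>)) (S (z', \<eta> + t *\<^sub>R v)) \<le> \<epsilon>1 * dist z z'))))"
  define G0 where "G0 = {\<eta>0. \<exists>r. ok \<eta>0 r}"
  have aeG: "AE \<eta> in \<l>. \<eta> \<in> G0"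
    using good_shift[OF z0]
  proof eventually_elim
    case (elim \<eta>)
    from elim[rule_format, OF \<epsilon>1] show ?case unfolding G0_def ok_def by simp
  qed
  define r where "r = (\<lambda>\<eta>. SOME r. ok \<eta> r)"
  have r: "ok \<eta> (r \<eta>)" if "\<eta> \<in> G0" for \<eta>
    using that someI_ex[of "ok \<eta>"] unfolding G0_def r_def by simp
  have rpos: "r \<eta> > 0" if "\<eta> \<in> G0" for \<eta> using r[OF that] by (simp add: ok_def)
  obtain F' where F': "F' \<subseteq> (\<lambda>\<eta>. ball \<eta> (r \<eta> / 2)) ` G0" "countable F'"
      "\<Union>F' = \<Union>((\<lambda>\<eta>. ball \<eta> (r \<eta> / 2)) ` G0)"
    using Lindelof[of "(\<lambda>\<eta>. ball \<eta> (r \<eta> / 2)) ` G0"] by auto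
  obtain D where D: "countable D" "D \<subseteq> G0" "F' = (\<lambda>\<eta>. ball \<eta> (r \<eta> / 2)) ` D"
    using F'(1,2) by (meson countable_subset_image)
  have G0D: "\<exists>\<eta>\<in>D. e \<in> ball \<eta> (r \<eta> / 2)" if "e \<in> G0" for e
  proof -
    have "e \<in> \<Union>((\<lambda>\<eta>. ball \<eta> (r \<eta> / 2)) ` G0)" using that rpos[OF that] by force
    then show ?thesis unfolding F'(3)[symmetric] D(3) by blast
  qed
  have "G0 \<noteq> {}"
  proof
    assume "G0 = {}"
    then have "AE \<eta> in \<l>. False" using aeG by simp
    then show False using AE_False by simp
  qed
  then have Dne: "D \<noteq> {}" using G0D by blast
  \<comment> \<open>If \<open>D\<close> is finite the enumeration repeats elements, which does no
    harm: a repeated ball only yields a further weight.\<close>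
  define p where "p = from_nat_into D"
  have pD: "p n \<in> D" for n using Dne by (simp add: p_def from_nat_into)
  then have pok: "ok (p n) (r (p n))" for n using r D(2) by blast
  have prp: "r (p n) > 0" for n using pok by (simp add: ok_def)
  define \<psi> where "\<psi> = (\<lambda>n. bump (p n) (r (p n)))"
  \<comment> \<open>What is left of 1 after \<open>n\<close> cutoffs. The products
    \<open>rem n e * \<psi> n e\<close> are the successive weights, and the first \<open>n\<close>
    of them add up to \<open>1 - rem n e\<close>.\<close>
  define rem where "rem = (\<lambda>n e. \<Prod>i<n. 1 - \<psi> i e)"
  have \<psi>01: "0 \<le> \<psi> n e" "\<psi> n e \<le> 1" for n e by (simp_all add: \<psi>_def bump_bounds)
  have rem01: "0 \<le> rem n e" "rem n e \<le> 1" for n e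
    using \<psi>01 by (auto simp: rem_def intro!: prod_nonneg prod_le_1)
  have remS: "rem (Suc n) e = rem n e - rem n e * \<psi> n e" for n e by (simp add: rem_def algebra_simps)
  have rem_lip: "\<exists>\<kappa>. \<kappa>-lipschitz_on UNIV (rem n)" for n
  proof (induction n)
    case 0 show ?case by (intro exI[of _ 0] lipschitz_onI) (auto simp: rem_def)
  next
    case (Suc n)
    then obtain \<kappa> where k: "\<kappa>-lipschitz_on UNIV (rem n)" by blast
    have "(2 / r (p n))-lipschitz_on UNIV (\<lambda>e. 1 - \<psi> n e)"
      using bump_lipschitz[OF prp[of n], of "p n"] unfolding \<psi>_def lipschitz_on_def by (simp add: dist_real_def abs_minus_commute)
    then have "(\<kappa> + 2 / r (p n))-lipschitz_on UNIV (\<lambda>e. rem n e * (1 - \<psi> n e))"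
      using rem01 \<psi>01 by (intro lipschitz_on_mult_bounded k) (auto simp: abs_le_iff)
    moreover have "rem (Suc n) = (\<lambda>e. rem n e * (1 - \<psi> n e))" by (auto simp: remS algebra_simps)
    ultimately show ?case by auto
  qed
  have rem_cont: "continuous_on UNIV (rem n)" for n using rem_lip lipschitz_on_continuous_on by blast
  have rem_int: "integrable \<l> (rem n)" for n
    by (rule integrable_bounded[of _ 1]) (use borel_measurable_continuous_onI[OF rem_cont] rem01 in auto)
  \<comment> \<open>The radius may shrink and \<open>C\<close> may grow in the induction, but the
    factor of \<Lambda> is tied to the integral of the weights used so far, which never exceeds
    1.\<close>
  define P where "P = (\<lambda>n. \<exists>\<rho>>0. \<exists>C\<ge>0. \<forall>z\<in>ball z0 \<rho>. \<forall>z'\<in>ball z0 \<rho>. \<forall>f \<Lambda> B. \<Lambda>-lipschitz_on UNIV f \<longrightarrow> (\<forall>x. \<bar>f x :: real\<bar> \<le> B) \<longrightarrow>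
    \<bar>\<integral>e. (1 - rem n e) * (f (S (z, e)) - f (S (z', e))) \<partial>\<l>\<bar> \<le> (C * B + \<epsilon>1 * \<Lambda> * (\<integral>e. 1 - rem n e \<partial>\<l>)) * dist z z')"
  have fint: "integrable \<l> (\<lambda>e. h e * (f (S (z, e)) - f (S (z', e))))"
    if f: "\<Lambda>-lipschitz_on UNIV f" "\<forall>x. \<bar>f x :: real\<bar> \<le> B" and h: "continuous_on UNIV h" "\<And>e. \<bar>h e\<bar> \<le> 1"
    for f h z z' \<Lambda> B
  proof (rule integrable_bounded)
    have "continuous_on UNIV (\<lambda>e. f (S (z, e)))" for z
      using continuous_on_compose2[OF lipschitz_on_continuous_on[OF f(1)] S_section[of z 0]] by auto
    then show "(\<lambda>e. h e * (f (S (z, e)) - f (S (z', e)))) \<in> borel_measurable borel"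
      by (intro borel_measurable_continuous_onI continuous_intros h)
    fix e
    have "\<bar>f (S (z, e)) - f (S (z', e))\<bar> \<le> 2 * B" using f(2)[rule_format, of "S (z, e)"] f(2)[rule_format, of "S (z', e)"] by linarith
    then have "\<bar>h e\<bar> * \<bar>f (S (z, e)) - f (S (z', e))\<bar> \<le> 1 * (2 * B)" using h(2) by (intro mult_mono) auto
    then show "\<bar>h e * (f (S (z, e)) - f (S (z', e)))\<bar> \<le> 1 * (2 * B)" by (simp add: abs_mult)
  qed
  have "P n" for n
  proof (induction n)
    case 0
    show ?case unfolding P_def rem_def by (intro exI[of _ 1] conjI exI[of _ 0]) auto
  next
    case (Suc n)
    then obtain \<rho> C where \<rho>: "\<rho> > 0" "C \<ge> 0" and IH: "\<And>z z' f \<Lambda> B. z\<in>ball z0 \<rho> \<Longrightarrow> z'\<in>ball z0 \<rho> \<Longrightarrow>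
       \<Lambda>-lipschitz_on UNIV f \<Longrightarrow> (\<forall>x. \<bar>f x :: real\<bar> \<le> B) \<Longrightarrow>
    \<bar>\<integral>e. (1 - rem n e) * (f (S (z, e)) - f (S (z', e))) \<partial>\<l>\<bar> \<le> (C * B + \<epsilon>1 * \<Lambda> * (\<integral>e. 1 - rem n e \<partial>\<l>)) * dist z z'"
      unfolding P_def by blast
    let ?r = "r (p n)"
    let ?chi = "\<lambda>e. rem n e * \<psi> n e"
    obtain W R where WR: "finite W" "W \<subseteq> {v. shift_regular \<l> v}" "R \<ge> 0"
      "\<And>z z'. z\<in>ball z0 ?r \<Longrightarrow> z'\<in>ball z0 ?r \<Longrightarrow> \<exists>v\<in>W. \<exists>t. 0 \<le> t \<and> t \<le> R * dist z z' \<and>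
       (\<forall>\<eta>\<in>ball (p n) ?r. dist (S (z, \<eta>)) (S (z', \<eta> + t *\<^sub>R v)) \<le> \<epsilon>1 * dist z z')"
      using pok[of n] unfolding ok_def by metis
    obtain \<kappa> where k: "\<kappa>-lipschitz_on UNIV (rem n)" using rem_lip by blast
    have chil: "(\<kappa> + 2 / ?r)-lipschitz_on UNIV ?chi"
      using rem01 \<psi>01 bump_lipschitz[OF prp[of n], of "p n"]
      by (intro lipschitz_on_mult_bounded k) (auto simp: \<psi>_def abs_le_iff)
    have chi01: "0 \<le> ?chi e" "?chi e \<le> 1" for e using rem01 \<psi>01 by (auto intro: mult_le_one)
    have chic: "continuous_on UNIV ?chi" using chil by (rule lipschitz_on_continuous_on)
    have "\<exists>C\<ge>0. \<forall>z\<in>ball z0 ?r. \<forall>z'\<in>ball z0 ?r. \<forall>f \<Lambda> B. \<Lambda>-lipschitz_on UNIV f \<longrightarrow> (\<forall>x. \<bar>f x :: real\<bar> \<le> B) \<longrightarrow>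
    \<bar>\<integral>e. ?chi e * (f (S (z, e)) - f (S (z', e))) \<partial>\<l>\<bar> \<le> (C * B + \<epsilon>1 * \<Lambda> * (\<integral>e. ?chi e \<partial>\<l>)) * dist z z'"
    proof (rule weighted_difference[OF prp WR(1) _ WR(3,4) chil chi01])
      show "shift_regular \<l> v" if "v \<in> W" for v using that WR(2) by blast
      show "?chi e = 0" if "e \<notin> ball (p n) ?r" for e
        using bump_eq_0[OF prp[of n] that] by (simp add: \<psi>_def)
    qed (use \<epsilon>1 in auto)
    then obtain C' where C': "C' \<ge> 0" and st: "\<And>z z' f \<Lambda> B. z\<in>ball z0 ?r \<Longrightarrow> z'\<in>ball z0 ?r \<Longrightarrow>
       \<Lambda>-lipschitz_on UNIV f \<Longrightarrow> (\<forall>x. \<bar>f x :: real\<bar> \<le> B) \<Longrightarrow>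
      \<bar>\<integral>e. ?chi e * (f (S (z, e)) - f (S (z', e))) \<partial>\<l>\<bar> \<le> (C' * B + \<epsilon>1 * \<Lambda> * (\<integral>e. ?chi e \<partial>\<l>)) * dist z z'"
      by blast
    have chii: "integrable \<l> ?chi"
      by (rule integrable_bounded[of _ 1]) (use borel_measurable_continuous_onI[OF chic] chi01 in auto)
    have sumint: "(\<integral>e. 1 - rem (Suc n) e \<partial>\<l>) = (\<integral>e. 1 - rem n e \<partial>\<l>) + (\<integral>e. ?chi e \<partial>\<l>)"
      using rem_int chii by (subst Bochner_Integration.integral_add[symmetric]) (auto simp: remS)
    have "\<bar>\<integral>e. (1 - rem (Suc n) e) * (f (S (z, e)) - f (S (z', e))) \<partial>\<l>\<bar>
        \<le> ((C + C') * B + \<epsilon>1 * \<Lambda> * (\<integral>e. 1 - rem (Suc n) e \<partial>\<l>)) * dist z z'"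
      if z: "z \<in> ball z0 (min \<rho> ?r)" "z' \<in> ball z0 (min \<rho> ?r)"
        and f: "\<Lambda>-lipschitz_on UNIV f" "\<forall>x. \<bar>f x :: real\<bar> \<le> B" for z z' f \<Lambda> B
    proof -
      have i1: "integrable \<l> (\<lambda>e. (1 - rem n e) * (f (S (z, e)) - f (S (z', e))))"
        using rem01 by (intro fint[OF f] continuous_intros rem_cont) (auto simp: abs_le_iff)
      have i2: "integrable \<l> (\<lambda>e. ?chi e * (f (S (z, e)) - f (S (z', e))))"
        using chi01 by (intro fint[OF f chic]) (auto simp: abs_le_iff)
      have "(\<integral>e. (1 - rem (Suc n) e) * (f (S (z, e)) - f (S (z', e))) \<partial>\<l>) =
          (\<integral>e. (1 - rem n e) * (f (S (z, e)) - f (S (z', e))) + ?chi e * (f (S (z, e)) - f (S (z', e))) \<partial>\<l>)"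
        by (intro Bochner_Integration.integral_cong) (auto simp: remS algebra_simps)
      also have "\<dots> = (\<integral>e. (1 - rem n e) * (f (S (z, e)) - f (S (z', e))) \<partial>\<l>)
          + (\<integral>e. ?chi e * (f (S (z, e)) - f (S (z', e))) \<partial>\<l>)"
        using i1 i2 by (rule Bochner_Integration.integral_add)
      finally have "\<bar>\<integral>e. (1 - rem (Suc n) e) * (f (S (z, e)) - f (S (z', e))) \<partial>\<l>\<bar> \<le>
         (C * B + \<epsilon>1 * \<Lambda> * (\<integral>e. 1 - rem n e \<partial>\<l>)) * dist z z' + (C' * B + \<epsilon>1 * \<Lambda> * (\<integral>e. ?chi e \<partial>\<l>)) * dist z z'"
        using IH[of z z' \<Lambda> f B] st[of z z' \<Lambda> f B] z f by auto
      also have "\<dots> = ((C + C') * B + \<epsilon>1 * \<Lambda> * (\<integral>e. 1 - rem (Suc n) e \<partial>\<l>)) * dist z z'"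
        unfolding sumint by (simp add: algebra_simps)
      finally show ?thesis .
    qed
    moreover have "min \<rho> ?r > 0" "C + C' \<ge> 0" using \<rho> C' prp by auto
    ultimately show ?case unfolding P_def by blast
  qed
  note Pn = this
  have "(\<lambda>n. \<integral>e. rem n e \<partial>\<l>) \<longlonglongrightarrow> (\<integral>e. 0 \<partial>\<l>)"
  proof (rule integral_dominated_convergence[where w = "\<lambda>_. 1"])
    show "AE e in \<l>. (\<lambda>n. rem n e) \<longlonglongrightarrow> 0"
      using aeG
    proof eventually_elim
      case (elim e)
      then obtain \<eta> where "\<eta> \<in> D" "e \<in> ball \<eta> (r \<eta> / 2)" using G0D by blast
      then obtain m where m: "e \<in> ball (p m) (r (p m) / 2)"
        using from_nat_into_surj[OF D(1)] unfolding p_def by metis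
      then have "\<psi> m e = 1" using bump_eq_1 prp unfolding \<psi>_def by blast
      then have "rem n e = 0" if "n \<ge> Suc m" for n
        using that by (auto simp: rem_def intro!: prod_zero bexI[of _ m])
      then show ?case by (intro tendsto_eventually eventually_sequentiallyI[of "Suc m"]) auto
    qed
  qed (use rem_int rem01 in auto)
  then have lim: "(\<lambda>n. \<integral>e. rem n e \<partial>\<l>) \<longlonglongrightarrow> 0" by simp
  obtain r0 L where L: "r0 > 0" "L \<ge> 0" "\<And>z z' \<eta>. z\<in>ball z0 r0 \<Longrightarrow> z'\<in>ball z0 r0 \<Longrightarrow> \<eta>\<in>K \<Longrightarrow>
      dist (S (z, \<eta>)) (S (z', \<eta>)) \<le> L * dist z z'"
    using uniform_Lip[of z0] by metis
  \<comment> \<open>With so little mass left, the crude bound contributes at most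
    \<open>\<epsilon>1\<close>, the second half of \<epsilon>. The summand 1 covers
    \<open>L = 0\<close>.\<close>
  have "\<epsilon>1 / (L + 1) > 0" using \<epsilon>1 L by simp
  then obtain n where "norm ((\<integral>e. rem n e \<partial>\<l>) - 0) < \<epsilon>1 / (L + 1)"
    using LIMSEQ_D[OF lim] by blast
  then have "(\<integral>e. rem n e \<partial>\<l>) * (L + 1) \<le> \<epsilon>1"
    using L by (simp add: pos_less_divide_eq abs_less_iff)
  moreover have rem_ge: "0 \<le> (\<integral>e. rem n e \<partial>\<l>)" using rem01 by (intro Bochner_Integration.integral_nonneg) auto
  ultimately have n: "(\<integral>e. rem n e \<partial>\<l>) * L \<le> \<epsilon>1" by (simp add: distrib_left)
  obtain \<rho> C where \<rho>: "\<rho> > 0" "C \<ge> 0" and main: "\<And>z z' f \<Lambda> B. z\<in>ball z0 \<rho> \<Longrightarrow> z'\<in>ball z0 \<rho> \<Longrightarrow>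
       \<Lambda>-lipschitz_on UNIV f \<Longrightarrow> (\<forall>x. \<bar>f x :: real\<bar> \<le> B) \<Longrightarrow>
    \<bar>\<integral>e. (1 - rem n e) * (f (S (z, e)) - f (S (z', e))) \<partial>\<l>\<bar> \<le> (C * B + \<epsilon>1 * \<Lambda> * (\<integral>e. 1 - rem n e \<partial>\<l>)) * dist z z'"
    using Pn[of n] unfolding P_def by blast
  have "\<bar>Q f z - Q f z'\<bar> \<le> (C * B + \<epsilon> * \<Lambda>) * dist z z'"
    if z: "z \<in> ball z0 (min \<rho> r0)" "z' \<in> ball z0 (min \<rho> r0)"
      and f: "\<Lambda>-lipschitz_on UNIV f" "\<forall>x. \<bar>f x :: real\<bar> \<le> B" for z z' f \<Lambda> B
  proof -
    have \<Lambda>: "\<Lambda> \<ge> 0" using f(1) by (rule lipschitz_on_nonneg)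
    let ?d = "\<lambda>e. f (S (z, e)) - f (S (z', e))"
    have fi: "integrable \<l> (\<lambda>e. f (S (z, e)))" for z
    proof (rule integrable_bounded)
      have "continuous_on UNIV (\<lambda>e. f (S (z, e)))"
        using continuous_on_compose2[OF lipschitz_on_continuous_on[OF f(1)] S_section[of z 0]] by auto
      then show "(\<lambda>e. f (S (z, e))) \<in> borel_measurable borel" by (rule borel_measurable_continuous_onI)
    qed (use f in auto)
    have i1: "integrable \<l> (\<lambda>e. (1 - rem n e) * ?d e)"
      using rem01 by (intro fint[OF f] continuous_intros rem_cont) (auto simp: abs_le_iff)
    have i2: "integrable \<l> (\<lambda>e. rem n e * ?d e)"
      using rem01 by (intro fint[OF f rem_cont]) (auto simp: abs_le_iff)
    have "Q f z - Q f z' = (\<integral>e. ?d e \<partial>\<l>)" unfolding Q_def using fi by simp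
    also have "\<dots> = (\<integral>e. (1 - rem n e) * ?d e + rem n e * ?d e \<partial>\<l>)"
      by (intro Bochner_Integration.integral_cong) (auto simp: algebra_simps)
    also have "\<dots> = (\<integral>e. (1 - rem n e) * ?d e \<partial>\<l>) + (\<integral>e. rem n e * ?d e \<partial>\<l>)"
      using i1 i2 by (rule Bochner_Integration.integral_add)
    finally have eq: "Q f z - Q f z' = \<dots>" .
    have "\<bar>\<integral>e. rem n e * ?d e \<partial>\<l>\<bar> \<le> (\<integral>e. \<bar>rem n e * ?d e\<bar> \<partial>\<l>)" by (rule integral_abs_bound)
    also have "\<dots> \<le> (\<integral>e. rem n e * (\<Lambda> * (L * dist z z')) \<partial>\<l>)"
    proof (rule integral_mono_AE)
      show "AE e in \<l>. \<bar>rem n e * ?d e\<bar> \<le> rem n e * (\<Lambda> * (L * dist z z'))"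
        using AE_K
      proof eventually_elim
        case (elim e)
        have "\<bar>?d e\<bar> \<le> \<Lambda> * dist (S (z, e)) (S (z', e))"
          using lipschitz_onD[OF f(1), of "S (z, e)" "S (z', e)"] by (simp add: dist_real_def)
        also have "\<dots> \<le> \<Lambda> * (L * dist z z')" using L(3)[OF _ _ elim] z \<Lambda> by (intro mult_left_mono) auto
        finally show ?case using rem01[of n e] by (simp add: abs_mult mult_left_mono)
      qed
    qed (use i2 rem_int in auto)
    also have "\<dots> = ((\<integral>e. rem n e \<partial>\<l>) * L) * (\<Lambda> * dist z z')" by simp
    also have "\<dots> \<le> \<epsilon>1 * (\<Lambda> * dist z z')" using n \<Lambda> by (intro mult_right_mono) auto
    finally have 2: "\<bar>\<integral>e. rem n e * ?d e \<partial>\<l>\<bar> \<le> \<epsilon>1 * \<Lambda> * dist z z'" by simp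
    have "(\<integral>e. 1 - rem n e \<partial>\<l>) \<le> 1"
      using rem_ge rem_int prob_space by simp
    then have "\<epsilon>1 * \<Lambda> * (\<integral>e. 1 - rem n e \<partial>\<l>) \<le> \<epsilon>1 * \<Lambda> * 1" using \<epsilon>1 \<Lambda> by (intro mult_left_mono) auto
    then have "(C * B + \<epsilon>1 * \<Lambda> * (\<integral>e. 1 - rem n e \<partial>\<l>)) * dist z z' \<le> (C * B + \<epsilon>1 * \<Lambda>) * dist z z'"
      by (intro mult_right_mono) auto
    moreover have "(C * B + \<epsilon>1 * \<Lambda>) * dist z z' + \<epsilon>1 * \<Lambda> * dist z z' = (C * B + \<epsilon> * \<Lambda>) * dist z z'"
      by (simp add: \<epsilon>1_def algebra_simps)
    ultimately show ?thesis unfolding eq using main[of z z' \<Lambda> f B] 2 z f by auto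
  qed
  moreover have "min \<rho> r0 > 0" using \<rho> L by simp
  ultimately show ?thesis using \<rho>(2) by blast
qed

text \<open>A Lebesgue number \<delta> of the cover by local neighbourhoods settles points closer
  than \<delta>. For the others the trivial bound \<open>2 * B\<close> suffices, since it is at most
  \<open>2 / \<delta> * B * dist z z'\<close>.\<close>

lemma Lasota_Yorke:
  assumes \<epsilon>: "\<epsilon> > 0"
  shows "\<exists>C\<ge>0. \<forall>z\<in>X. \<forall>z'\<in>X. \<forall>f \<Lambda> B. \<Lambda>-lipschitz_on UNIV f \<longrightarrow> (\<forall>x. \<bar>f x :: real\<bar> \<le> B) \<longrightarrow>
    \<bar>Q f z - Q f z'\<bar> \<le> (C * B + \<epsilon> * \<Lambda>) * dist z z'"
proof -
  obtain r C where r: "\<And>z0. z0 \<in> X \<Longrightarrow> r z0 > 0" "\<And>z0. z0 \<in> X \<Longrightarrow> C z0 \<ge> 0"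
     "\<And>z0 z z' f \<Lambda> B. z0 \<in> X \<Longrightarrow> z\<in>ball z0 (r z0) \<Longrightarrow> z'\<in>ball z0 (r z0) \<Longrightarrow> \<Lambda>-lipschitz_on UNIV f \<Longrightarrow>
       (\<forall>x. \<bar>f x :: real\<bar> \<le> B) \<Longrightarrow> \<bar>Q f z - Q f z'\<bar> \<le> (C z0 * B + \<epsilon> * \<Lambda>) * dist z z'"
    using local_Lasota_Yorke[OF _ \<epsilon>] by metis
  have "X \<subseteq> (\<Union>z\<in>X. ball z (r z))" using r(1) by auto
  then obtain D where D: "D \<subseteq> X" "finite D" "X \<subseteq> (\<Union>z\<in>D. ball z (r z))"
    using compactE_image[OF X_compact] by (metis (no_types, lifting) open_ball)
  obtain \<delta> where \<delta>: "\<delta> > 0" "\<And>x. x \<in> X \<Longrightarrow> \<exists>z\<in>D. ball x \<delta> \<subseteq> ball z (r z)"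
    by (rule Heine_Borel_lemma[OF X_compact D(3)]) auto
  define C0 where "C0 = (\<Sum>z\<in>D. C z) + 2 / \<delta>"
  have CD: "C z \<le> (\<Sum>z\<in>D. C z)" if "z \<in> D" for z
    using that D r(2) by (intro member_le_sum) auto
  have s0: "0 \<le> (\<Sum>z\<in>D. C z)" using D r(2) by (intro sum_nonneg) auto
  have "\<bar>Q f z - Q f z'\<bar> \<le> (C0 * B + \<epsilon> * \<Lambda>) * dist z z'"
    if z: "z \<in> X" "z' \<in> X" and f: "\<Lambda>-lipschitz_on UNIV f" "\<forall>x. \<bar>f x :: real\<bar> \<le> B" for z z' f \<Lambda> B
  proof -
    have B: "B \<ge> 0" using f(2) by (meson abs_ge_zero order_trans)
    have \<Lambda>: "\<Lambda> \<ge> 0" using f(1) by (rule lipschitz_on_nonneg)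
    show ?thesis
    proof (cases "dist z z' < \<delta>")
      case True
      obtain w where w: "w \<in> D" "ball z \<delta> \<subseteq> ball w (r w)" using \<delta>(2) z by blast
      have "\<bar>Q f z - Q f z'\<bar> \<le> (C w * B + \<epsilon> * \<Lambda>) * dist z z'"
      proof (rule r(3)[OF _ _ _ f])
        show "w \<in> X" using w(1) D(1) by blast
        show "z \<in> ball w (r w)" "z' \<in> ball w (r w)" using w(2) True \<delta>(1) by (auto simp: subset_iff)
      qed
      also have "\<dots> \<le> (C0 * B + \<epsilon> * \<Lambda>) * dist z z'"
      proof -
        have "C w \<le> C0" using CD[OF w(1)] \<delta>(1) by (simp add: C0_def add_increasing2)
        then show ?thesis using B by (intro mult_right_mono add_right_mono) auto
      qed
      finally show ?thesis .
    next
      case False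
      have Qb: "\<bar>Q f z\<bar> \<le> B" for z unfolding Q_def
      proof (rule integral_abs_le)
        have "continuous_on UNIV (\<lambda>e. f (S (z, e)))"
          using continuous_on_compose2[OF lipschitz_on_continuous_on[OF f(1)] S_section[of z 0]] by auto
        then show "(\<lambda>e. f (S (z, e))) \<in> borel_measurable borel" by (rule borel_measurable_continuous_onI)
      qed (use f in auto)
      have "\<bar>Q f z - Q f z'\<bar> \<le> 2 / \<delta> * B * \<delta>" using Qb[of z] Qb[of z'] \<delta>(1) by simp
      also have "\<dots> \<le> 2 / \<delta> * B * dist z z'" using False \<delta>(1) B by (intro mult_left_mono) auto
      also have "\<dots> \<le> (C0 * B + \<epsilon> * \<Lambda>) * dist z z'"
      proof (intro mult_right_mono)
        have "2 / \<delta> * B \<le> C0 * B" using s0 B by (intro mult_right_mono) (auto simp: C0_def)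
        moreover have "0 \<le> \<epsilon> * \<Lambda>" using \<epsilon> \<Lambda> by simp
        ultimately show "2 / \<delta> * B \<le> C0 * B + \<epsilon> * \<Lambda>" by linarith
      qed simp
      finally show ?thesis .
    qed
  qed
  moreover have "C0 \<ge> 0" using s0 \<delta>(1) by (simp add: C0_def)
  ultimately show ?thesis by blast
qed

end

section \<open>Contraction of the Markov operator\<close>

text \<open>\<open>H\<close> is an infimal convolution, and clipping it at \<open>B\<close> and
  \<open>- B\<close> keeps the Lipschitz constant. The extension is needed because test functions
  and their images under \<open>Q\<close> are controlled on \<open>X\<close> only, whereas
  \<open>Lasota_Yorke\<close> asks for functions that are Lipschitz on the whole space.\<close>

lemma McShane_extension:
  fixes f :: "'a::metric_space \<Rightarrow> real"
  assumes X: "X \<noteq> {}" and lip: "\<And>x y. x \<in> X \<Longrightarrow> y \<in> X \<Longrightarrow> \<bar>f x - f y\<bar> \<le> L * dist x y"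
    and bd: "\<And>x. x \<in> X \<Longrightarrow> \<bar>f x\<bar> \<le> B" and L: "L \<ge> 0" and B: "B \<ge> 0"
  shows "\<exists>F. L-lipschitz_on UNIV F \<and> (\<forall>x. \<bar>F x\<bar> \<le> B) \<and> (\<forall>x\<in>X. F x = f x)"
proof -
  define H where "H = (\<lambda>x. INF y\<in>X. f y + L * dist x y)"
  have bdd: "bdd_below ((\<lambda>y. f y + L * dist x y) ` X)" for x
  proof (rule bdd_belowI[of _ "-B"])
    fix v assume "v \<in> (\<lambda>y. f y + L * dist x y) ` X"
    then obtain y where y: "y \<in> X" "v = f y + L * dist x y" by blast
    have "0 \<le> L * dist x y" using L by simp
    then show "- B \<le> v" using bd[OF y(1)] y(2) by linarith
  qed
  have Hle: "H x \<le> H x' + L * dist x x'" for x x'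
  proof -
    have "H x - L * dist x x' \<le> f y + L * dist x' y" if y: "y \<in> X" for y
    proof -
      have "H x \<le> f y + L * dist x y" unfolding H_def by (rule cINF_lower[OF bdd y])
      also have "L * dist x y \<le> L * (dist x x' + dist x' y)" using L dist_triangle by (intro mult_left_mono)
      finally show ?thesis by (simp add: distrib_left)
    qed
    then have "H x - L * dist x x' \<le> H x'" unfolding H_def[of] by (intro cINF_greatest X)
    then show ?thesis by simp
  qed
  have Heq: "H x = f x" if x: "x \<in> X" for x
  proof (rule antisym)
    show "H x \<le> f x" unfolding H_def using cINF_lower[OF bdd x, of x] by simp
    show "f x \<le> H x" unfolding H_def
    proof (rule cINF_greatest[OF X])
      fix y assume "y \<in> X"
      from lip[OF x this] show "f x \<le> f y + L * dist x y" by linarith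
    qed
  qed
  define F where "F = (\<lambda>x. max (-B) (min B (H x)))"
  have "L-lipschitz_on UNIV F"
  proof (rule lipschitz_onI)
    fix x x'
    have "\<bar>F x - F x'\<bar> \<le> \<bar>H x - H x'\<bar>" unfolding F_def by (simp add: max_def min_def)
    also have "\<dots> \<le> L * dist x x'" using Hle[of x x'] Hle[of x' x] by (simp add: dist_commute abs_le_iff)
    finally show "dist (F x) (F x') \<le> L * dist x x'" by (simp add: dist_real_def)
  qed (rule L)
  moreover have "\<bar>F x\<bar> \<le> B" for x using B by (simp add: F_def abs_le_iff max_def min_def)
  moreover have "F x = f x" if "x \<in> X" for x
    using bd[OF that] Heq[OF that] by (simp add: F_def abs_le_iff max_def min_def)
  ultimately show ?thesis by blast
qed

section \<open>Iterates of the Markov operator\<close>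

context noisy_map
begin

definition Cb :: "('x \<Rightarrow> real) \<Rightarrow> bool" where
  "Cb f \<longleftrightarrow> continuous_on UNIV f \<and> (\<exists>B. \<forall>x. \<bar>f x\<bar> \<le> B)"

lemma Cb_section: "Cb f \<Longrightarrow> continuous_on UNIV (\<lambda>e. f (S (z, e)))"
  using continuous_on_compose2[of UNIV f UNIV "\<lambda>e. S (z, e)"] S_section[of z 0] by (auto simp: Cb_def)

lemma Cb_measurable: "Cb f \<Longrightarrow> (\<lambda>e. f (S (z, e))) \<in> borel_measurable borel"
  using Cb_section by (rule borel_measurable_continuous_onI)

lemma Cb_integrable: "Cb f \<Longrightarrow> integrable \<l> (\<lambda>e. f (S (z, e)))"
  using integrable_bounded[OF Cb_measurable] unfolding Cb_def by blast

lemma Cb_affine: "Cb f \<Longrightarrow> Cb (\<lambda>x. c + s * f x)"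
  unfolding Cb_def
proof safe
  fix B assume B: "\<forall>x. \<bar>f x\<bar> \<le> B"
  have "\<bar>c + s * f x\<bar> \<le> \<bar>c\<bar> + \<bar>s\<bar> * B" for x
    using mult_left_mono[OF B[rule_format, of x] abs_ge_zero[of s]] abs_triangle_ineq[of c "s * f x"]
    by (simp add: abs_mult)
  then show "\<exists>B. \<forall>x. \<bar>c + s * f x\<bar> \<le> B" by blast
qed (intro continuous_intros)

lemma Cb_lipschitz: "L-lipschitz_on UNIV f \<Longrightarrow> (\<And>x. \<bar>f x\<bar> \<le> B) \<Longrightarrow> Cb f"
  unfolding Cb_def using lipschitz_on_continuous_on by blast

lemma Cb_Q: assumes "Cb f" shows "Cb (Q f)"
proof -
  obtain B where B: "\<And>x. \<bar>f x\<bar> \<le> B" using assms by (auto simp: Cb_def)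
  have "continuous_on UNIV (Q f)"
    unfolding continuous_on_sequentially
  proof (intro allI impI ballI)
    fix z0 and z :: "nat \<Rightarrow> 'x" assume "(\<forall>n. z n \<in> UNIV) \<and> z \<longlonglongrightarrow> z0"
    then have z: "z \<longlonglongrightarrow> z0" by blast
    show "(Q f \<circ> z) \<longlonglongrightarrow> Q f z0" unfolding Q_def o_def
    proof (rule integral_dominated_convergence[where w = "\<lambda>_. B"])
      show "AE e in \<l>. (\<lambda>n. f (S (z n, e))) \<longlonglongrightarrow> f (S (z0, e))"
      proof (intro AE_I2)
        fix e :: 'e
        have "(\<lambda>n. (z n, e)) \<longlonglongrightarrow> (z0, e)" by (intro tendsto_intros z)
        then have "(\<lambda>n. S (z n, e)) \<longlonglongrightarrow> S (z0, e)"
          using S_continuous by (auto intro: continuous_on_tendsto_compose)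
        then show "(\<lambda>n. f (S (z n, e))) \<longlonglongrightarrow> f (S (z0, e))"
          using assms by (auto simp: Cb_def intro: continuous_on_tendsto_compose)
      qed
    qed (use Cb_measurable[OF assms] B in \<open>auto simp: borel_measurable_l\<close>)
  qed
  moreover have "\<bar>Q f z\<bar> \<le> B" for z unfolding Q_def
    by (rule integral_abs_le[OF Cb_measurable[OF assms] B])
  ultimately show ?thesis unfolding Cb_def by blast
qed

lemma Cb_Qn: "Cb f \<Longrightarrow> Cb ((Q ^^ n) f)"
  by (induction n) (auto simp: Cb_Q)

lemma Q_affine: "Cb f \<Longrightarrow> Q (\<lambda>x. c + s * f x) z = c + s * Q f z"
  unfolding Q_def using Cb_integrable prob_space by simp

text \<open>One rule for adding constants and for scaling; this explains terms such as
  \<open>0 + (1/M) * f x\<close> and \<open>- f x0 + 1 * f x\<close> below.\<close>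

lemma Qn_affine: assumes "Cb f" shows "(Q ^^ n) (\<lambda>x. c + s * f x) = (\<lambda>z. c + s * (Q ^^ n) f z)"
proof (induction n)
  case (Suc n)
  then show ?case using Q_affine[OF Cb_Qn[OF assms]] by simp
qed simp

text \<open>Comparison on \<open>X\<close> is enough because almost every noise value lies in
  \<open>K\<close> and so keeps the state in \<open>X\<close>.\<close>

lemma Q_mono:
  assumes "Cb f" "Cb g" "\<And>x. x \<in> X \<Longrightarrow> f x \<le> g x" "z \<in> X"
  shows "Q f z \<le> Q g z"
  unfolding Q_def
proof (rule integral_mono_AE)
  show "AE e in \<l>. f (S (z, e)) \<le> g (S (z, e))"
    using AE_K by eventually_elim (use assms X_inv in \<open>auto intro!: assms(3)\<close>)
qed (use Cb_integrable assms in auto)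

lemma Qn_mono:
  assumes "Cb f" "Cb g" "\<And>x. x \<in> X \<Longrightarrow> f x \<le> g x"
  shows "z \<in> X \<Longrightarrow> (Q ^^ n) f z \<le> (Q ^^ n) g z"
proof (induction n arbitrary: z)
  case (Suc n)
  then show ?case using Q_mono[OF Cb_Qn[OF assms(1)] Cb_Qn[OF assms(2)]] by simp
qed (use assms in auto)

lemma Cb_const: "Cb (\<lambda>_. c)"
  by (auto simp: Cb_def)

lemma Qn_const: "(Q ^^ n) (\<lambda>_. c) = (\<lambda>_. c)"
  using Qn_affine[OF Cb_const[of 0], of n c 0] by simp

lemma Q_cong:
  assumes "Cb f" "Cb g" "\<And>x. x \<in> X \<Longrightarrow> f x = g x" "z \<in> X"
  shows "Q f z = Q g z"
  using Q_mono[OF assms(1,2)] Q_mono[OF assms(2,1)] assms(3,4) by (simp add: antisym)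

lemma Qn_ge: "Cb f \<Longrightarrow> (\<And>x. x \<in> X \<Longrightarrow> lo \<le> f x) \<Longrightarrow> z \<in> X \<Longrightarrow> lo \<le> (Q ^^ n) f z"
  using Qn_mono[OF Cb_const, of f lo z n] by (simp add: Qn_const)

lemma Qn_le: "Cb f \<Longrightarrow> (\<And>x. x \<in> X \<Longrightarrow> f x \<le> hi) \<Longrightarrow> z \<in> X \<Longrightarrow> (Q ^^ n) f z \<le> hi"
  using Qn_mono[OF _ Cb_const, of f hi z n] by (simp add: Qn_const)

lemma Qn_osc:
  assumes "Cb f" "\<And>x y. x \<in> X \<Longrightarrow> y \<in> X \<Longrightarrow> \<bar>f x - f y\<bar> \<le> c" "z \<in> X" "z' \<in> X"
  shows "\<bar>(Q ^^ n) f z - (Q ^^ n) f z'\<bar> \<le> c"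
proof -
  have *: "(Q ^^ n) f z - c \<le> (Q ^^ n) f z'" if "z \<in> X" "z' \<in> X" for z z'
  proof (rule Qn_ge[OF assms(1) _ that(2)])
    fix x assume x: "x \<in> X"
    have "f y \<le> f x + c" if "y \<in> X" for y using assms(2)[OF that x] by (auto simp: abs_le_iff)
    then have "(Q ^^ n) f z \<le> f x + c" by (rule Qn_le[OF assms(1) _ \<open>z \<in> X\<close>])
    then show "(Q ^^ n) f z - c \<le> f x" by simp
  qed
  show ?thesis using *[OF assms(3,4)] *[OF assms(4,3)] by (auto simp: abs_le_iff)
qed

end

section \<open>Positivity and decay of oscillations\<close>

locale mixing_noisy_map = contracting_noisy_map S \<l> K X
  for S :: "'x::{metric_space, second_countable_topology} \<times> 'e::{real_normed_vector, second_countable_topology} \<Rightarrow> 'x"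
    and \<l> K X +
  assumes support: "K = measure_support \<l>"
    and control: "\<exists>zhat\<in>X. \<forall>\<epsilon>>0. \<exists>m\<ge>1. \<forall>z\<in>X. \<exists>\<zeta>.
               (\<forall>k\<in>{1..m}. \<zeta> k \<in> K) \<and> dist (traj S z \<zeta> m) zhat < \<epsilon>"
begin

text \<open>\<open>K\<close> is the support of the law, so the open set of noise values with
  positive integrand, which contains \<open>e0\<close>, has positive mass.\<close>

lemma Q_pos:
  assumes w: "Cb w" "\<And>x. 0 \<le> w x" and e0: "e0 \<in> K" "0 < w (S (z, e0))"
  shows "0 < Q w z"
proof -
  have "0 \<le> Q w z" unfolding Q_def using w by (intro Bochner_Integration.integral_nonneg) auto
  moreover have "Q w z \<noteq> 0"
  proof
    assume "Q w z = 0"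
    then have "AE e in \<l>. w (S (z, e)) = 0"
      unfolding Q_def using w Cb_integrable[OF w(1)] by (subst (asm) integral_nonneg_eq_0_iff_AE) auto
    then have ae: "AE e in \<l>. e \<notin> {e. 0 < w (S (z, e))}" by eventually_elim auto
    have o: "open {e. 0 < w (S (z, e))}"
      by (intro open_Collect_less continuous_intros Cb_section w)
    then have s: "{e. 0 < w (S (z, e))} \<in> sets \<l>" by (simp add: sets_l)
    have "emeasure \<l> {e. 0 < w (S (z, e))} = 0"
      using AE_iff_null_sets[OF s] ae by (simp add: null_sets_def)
    moreover have "emeasure \<l> {e. 0 < w (S (z, e))} > 0"
      using e0 o unfolding support measure_support_def by blast
    ultimately show False by simp
  qed
  ultimately show ?thesis by simp
qed

text \<open>\<open>traj\<close> recurses on the last step, while in \<open>Q ^^ Suc n\<close> the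
  outermost integral is over the first noise value; the induction for positivity needs the first
  step split off.\<close>

lemma traj_shift: "traj S z \<zeta> (Suc n) = traj S (S (z, \<zeta> 1)) (\<lambda>k. \<zeta> (Suc k)) n"
  by (induction n) auto

lemma Qn_nonneg: "(\<And>x. 0 \<le> w x) \<Longrightarrow> 0 \<le> (Q ^^ n) w z"
  by (induction n arbitrary: z) (auto simp: Q_def intro!: Bochner_Integration.integral_nonneg)

lemma Qn_pos:
  assumes w: "Cb w" "\<And>x. 0 \<le> w x" and "\<forall>k\<in>{1..m}. \<zeta> k \<in> K" "0 < w (traj S z \<zeta> m)"
  shows "0 < (Q ^^ m) w z"
  using assms(3,4)
proof (induction m arbitrary: z \<zeta>)
  case (Suc m)
  have "0 < (Q ^^ m) w (S (z, \<zeta> 1))"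
    using Suc.prems by (intro Suc.IH[of "\<lambda>k. \<zeta> (Suc k)"]) (auto simp: traj_shift simp del: traj.simps)
  then show ?case using Q_pos[OF Cb_Qn[OF w(1)] Qn_nonneg[OF w(2)], where ?e0.0 = "\<zeta> 1"] Suc.prems(1) by simp
qed simp

text \<open>On \<open>X\<close> these are the functions with Lipschitz constant 1 for the distance
  \<open>min 1 (d / \<theta>)\<close>.\<close>

definition truncated_lipschitz :: "real \<Rightarrow> ('x \<Rightarrow> real) \<Rightarrow> bool" where
  "truncated_lipschitz \<theta> f \<longleftrightarrow> Cb f \<and> (\<forall>x\<in>X. \<forall>y\<in>X. \<bar>f x - f y\<bar> \<le> min 1 (dist x y / \<theta>))"

lemma close_contraction:
  "\<exists>\<theta>>0. \<forall>f. truncated_lipschitz \<theta> f \<longrightarrow> (\<forall>z\<in>X. \<forall>z'\<in>X. \<bar>Q f z - Q f z'\<bar> \<le> 1/2 * (dist z z' / \<theta>))"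
proof -
  obtain C where C: "C \<ge> 0" "\<And>z z' f \<Lambda> B. z\<in>X \<Longrightarrow> z'\<in>X \<Longrightarrow> \<Lambda>-lipschitz_on UNIV f \<Longrightarrow> (\<forall>x. \<bar>f x :: real\<bar> \<le> B) \<Longrightarrow>
    \<bar>Q f z - Q f z'\<bar> \<le> (C * B + 1/4 * \<Lambda>) * dist z z'"
    using Lasota_Yorke[of "1/4"] by (metis zero_less_divide_1_iff zero_less_numeral)
  \<comment> \<open>This makes \<open>C\<close> at most \<open>1/4 * (1/\<theta>)\<close>, the same
    share as that of the term with the Lipschitz constant \<open>1/\<theta>\<close>. The summand 1
    covers \<open>C = 0\<close>.\<close>
  define \<theta> where "\<theta> = 1 / (4 * (C + 1))"
  have \<theta>: "\<theta> > 0" using C by (simp add: \<theta>_def)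
  have C\<theta>: "C \<le> 1/4 * (1/\<theta>)" using C by (simp add: \<theta>_def)
  have "\<bar>Q f z - Q f z'\<bar> \<le> 1/2 * (dist z z' / \<theta>)" if f: "truncated_lipschitz \<theta> f" and z: "z \<in> X" "z' \<in> X" for f z z'
  proof -
    obtain x0 where x0: "x0 \<in> X" using X_nonempty by blast
    \<comment> \<open>\<open>Q\<close> preserves constants, so \<open>f\<close> may be centred at a
      point of \<open>X\<close>; its supremum on \<open>X\<close> is then at most 1, as the term
      \<open>C * B\<close> requires.\<close>
    define h where "h = (\<lambda>x. - f x0 + 1 * f x)"
    have f1: "\<bar>f x - f y\<bar> \<le> 1" "\<bar>f x - f y\<bar> \<le> dist x y / \<theta>" if "x \<in> X" "y \<in> X" for x y
      using f that unfolding truncated_lipschitz_def by auto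
    have "\<exists>F. (1/\<theta>)-lipschitz_on UNIV F \<and> (\<forall>x. \<bar>F x\<bar> \<le> 1) \<and> (\<forall>x\<in>X. F x = h x)"
      using f1 x0 \<theta> by (intro McShane_extension X_nonempty) (auto simp: h_def)
    then obtain F where F: "(1/\<theta>)-lipschitz_on UNIV F" "\<forall>x. \<bar>F x\<bar> \<le> 1" "\<And>x. x \<in> X \<Longrightarrow> F x = h x" by blast
    have CbF: "Cb F" using F(1,2) by (intro Cb_lipschitz) auto
    have Cbf: "Cb f" using f by (simp add: truncated_lipschitz_def)
    have "Q F w = - f x0 + 1 * Q f w" if "w \<in> X" for w
      unfolding Q_affine[OF Cbf, symmetric]
      by (rule Q_cong[OF CbF Cb_affine[OF Cbf] _ that]) (simp add: F(3) h_def)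
    then have "\<bar>Q f z - Q f z'\<bar> = \<bar>Q F z - Q F z'\<bar>" using z by simp
    also have "\<dots> \<le> (C * 1 + 1/4 * (1/\<theta>)) * dist z z'" by (rule C(2)[OF z F(1,2)])
    also have "\<dots> \<le> (1/4 * (1/\<theta>) + 1/4 * (1/\<theta>)) * dist z z'"
      using C\<theta> by (intro mult_right_mono) auto
    also have "\<dots> = 1/2 * (dist z z' / \<theta>)" by simp
    finally show ?thesis .
  qed
  then show ?thesis using \<theta> by blast
qed

text \<open>Below distance \<theta> one step halves the distance and the other \<open>m - 1\<close>
  steps keep the function in the class. Beyond \<theta> there is a lower bound \<open>p\<close> on
  the mass near \<open>zh\<close> after \<open>m\<close> steps, which acts like a coupling: from
  either state this much mass meets values of \<open>f\<close> that differ little.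
  \<open>\<alpha>\<close> is the worse of the two factors.\<close>

lemma osc_decay_truncated_lipschitz:
  "\<exists>\<theta>>0. \<exists>m\<ge>1. \<exists>\<alpha>. 1/2 \<le> \<alpha> \<and> \<alpha> < 1 \<and> (\<forall>f k. truncated_lipschitz \<theta> f \<longrightarrow> (\<forall>z\<in>X. \<forall>z'\<in>X.
    \<bar>(Q ^^ (m * k)) f z - (Q ^^ (m * k)) f z'\<bar> \<le> \<alpha> ^ k * min 1 (dist z z' / \<theta>)))"
proof -
  obtain \<theta> where \<theta>: "\<theta> > 0" and close: "\<And>f z z'. truncated_lipschitz \<theta> f \<Longrightarrow> z\<in>X \<Longrightarrow> z'\<in>X \<Longrightarrow> \<bar>Q f z - Q f z'\<bar> \<le> 1/2 * (dist z z' / \<theta>)"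
    using close_contraction by blast
  have truncated_lipschitz_Q: "truncated_lipschitz \<theta> (Q f)" if f: "truncated_lipschitz \<theta> f" for f
    unfolding truncated_lipschitz_def
  proof (intro conjI ballI)
    have Cbf: "Cb f" using f by (simp add: truncated_lipschitz_def)
    then show "Cb (Q f)" by (rule Cb_Q)
    fix x y assume xy: "x \<in> X" "y \<in> X"
    have "\<bar>(Q ^^ 1) f x - (Q ^^ 1) f y\<bar> \<le> 1"
      using f xy by (intro Qn_osc[OF Cbf]) (auto simp: truncated_lipschitz_def)
    moreover have "0 \<le> dist x y / \<theta>" using \<theta> by simp
    then have "1/2 * (dist x y / \<theta>) \<le> dist x y / \<theta>" by linarith
    ultimately show "\<bar>Q f x - Q f y\<bar> \<le> min 1 (dist x y / \<theta>)" using close[OF f xy] by simp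
  qed
  have truncated_lipschitz_Qn: "truncated_lipschitz \<theta> ((Q ^^ n) f)" if f: "truncated_lipschitz \<theta> f" for f n
    using f by (induction n) (auto intro: truncated_lipschitz_Q)
  obtain zh where zh: "zh \<in> X" and ctrl: "\<forall>\<epsilon>>0. \<exists>m\<ge>1. \<forall>z\<in>X. \<exists>\<zeta>.
               (\<forall>k\<in>{1..m}. \<zeta> k \<in> K) \<and> dist (traj S z \<zeta> m) zh < \<epsilon>"
    using control by blast
  have t4: "\<theta>/4 > 0" "\<theta>/4/2 > 0" using \<theta> by auto
  obtain m where m: "m \<ge> 1" and mc: "\<forall>z\<in>X. \<exists>\<zeta>. (\<forall>k\<in>{1..m}. \<zeta> k \<in> K) \<and> dist (traj S z \<zeta> m) zh < \<theta>/4/2"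
    using ctrl t4(2) by blast
  \<comment> \<open>On the ball of radius \<open>\<theta>/4\<close> a function of the class differs
    from its value at \<open>zh\<close> by at most 1/4. The controls reach the ball of half that
    radius, where \<open>u\<close> is 1.\<close>
  define u where "u = bump zh (\<theta>/4)"
  have u01: "0 \<le> u x" "u x \<le> 1" for x by (simp_all add: u_def bump_bounds)
  have u0: "u x = 0" if "dist x zh \<ge> \<theta>/4" for x
    unfolding u_def using that by (intro bump_eq_0 t4) (auto simp: dist_commute)
  have Cbu: "Cb u" unfolding u_def
    by (rule Cb_lipschitz[OF bump_lipschitz[OF t4(1)], of _ 1]) (simp add: bump_bounds abs_le_iff order_trans[OF _ bump_bounds(1)])
  have pos: "0 < (Q ^^ m) u z" if z: "z \<in> X" for z
  proof -
    obtain \<zeta> where \<zeta>: "\<forall>k\<in>{1..m}. \<zeta> k \<in> K" "dist (traj S z \<zeta> m) zh < \<theta>/4/2" using mc z by blast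
    have "u (traj S z \<zeta> m) = 1" unfolding u_def using \<zeta>(2) by (intro bump_eq_1 t4) (simp add: dist_commute)
    then show ?thesis using \<zeta>(1) by (intro Qn_pos[OF Cbu u01(1)]) auto
  qed
  have "continuous_on X ((Q ^^ m) u)"
    using Cb_Qn[OF Cbu] by (auto simp: Cb_def intro: continuous_on_subset)
  then obtain zm where zm: "zm \<in> X" "\<And>z. z \<in> X \<Longrightarrow> (Q ^^ m) u zm \<le> (Q ^^ m) u z"
    using continuous_attains_inf[OF X_compact X_nonempty] by blast
  \<comment> \<open>The minimum over the compact set \<open>X\<close> makes the positivity uniform
    in the starting point.\<close>
  define p where "p = (Q ^^ m) u zm"
  have p: "0 < p" "\<And>z. z \<in> X \<Longrightarrow> p \<le> (Q ^^ m) u z" using pos[OF zm(1)] zm by (auto simp: p_def)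
  have far: "(Q ^^ m) f z - (Q ^^ m) f z' \<le> 1 - p/2" if f: "truncated_lipschitz \<theta> f" and z: "z \<in> X" "z' \<in> X" for f z z'
  proof -
    have Cbf: "Cb f" using f by (simp add: truncated_lipschitz_def)
    have fc: "continuous_on X f" using Cbf by (auto simp: Cb_def intro: continuous_on_subset)
    obtain xa where xa: "xa \<in> X" "\<And>x. x \<in> X \<Longrightarrow> f x \<le> f xa"
      using continuous_attains_sup[OF X_compact X_nonempty fc] by blast
    obtain xi where xi: "xi \<in> X" "\<And>x. x \<in> X \<Longrightarrow> f xi \<le> f x"
      using continuous_attains_inf[OF X_compact X_nonempty fc] by blast
    define D where "D = f xa - f xi"
    have D: "D \<le> 1" using f xa(1) xi(1) by (auto simp: truncated_lipschitz_def D_def abs_le_iff)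
    have near: "\<bar>f x - f zh\<bar> \<le> 1/4" if "x \<in> X" "dist x zh < \<theta>/4" for x
    proof -
      have "\<bar>f x - f zh\<bar> \<le> dist x zh / \<theta>" using f that(1) zh by (auto simp: truncated_lipschitz_def)
      also have "\<dots> \<le> 1/4" using that(2) \<theta> by (simp add: field_simps)
      finally show ?thesis .
    qed
    \<comment> \<open>\<open>s\<close> and \<open>s'\<close> are gaps to the maximum and to the
      minimum of \<open>f\<close> that are guaranteed near \<open>zh\<close>. Therefore
      \<open>f xa - s * u x\<close> and \<open>f xi + s' * u x\<close> bound \<open>f\<close> on
      \<open>X\<close> from above and from below.\<close>
    define s where "s = max 0 (f xa - f zh - 1/4)"
    define s' where "s' = max 0 (f zh - 1/4 - f xi)"
    have s: "s \<ge> 0" "s' \<ge> 0" by (auto simp: s_def s'_def)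
    have "(Q ^^ m) f z \<le> (Q ^^ m) (\<lambda>x. f xa + (-s) * u x) z"
    proof (rule Qn_mono[OF Cbf Cb_affine[OF Cbu] _ z(1)])
      fix x assume x: "x \<in> X"
      show "f x \<le> f xa + (-s) * u x"
      proof (cases "dist x zh < \<theta>/4")
        case True
        have "s * u x \<le> s * 1" using s u01 by (intro mult_left_mono) auto
        moreover have "f x \<le> f zh + 1/4" using near[OF x True] by linarith
        then have "f x \<le> f xa - s" using xa(2)[OF x] by (simp add: s_def max_def)
        ultimately show ?thesis by linarith
      next
        case False
        then show ?thesis using u0[of x] xa(2)[OF x] by simp
      qed
    qed
    also have "\<dots> = f xa - s * (Q ^^ m) u z" using Qn_affine[OF Cbu, of m "f xa" "-s"] by simp
    also have "\<dots> \<le> f xa - s * p" using p(2)[OF z(1)] s(1) by (simp add: mult_left_mono)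
    finally have 1: "(Q ^^ m) f z \<le> f xa - s * p" .
    have "f xi + s' * p \<le> f xi + s' * (Q ^^ m) u z'" using p(2)[OF z(2)] s(2) by (simp add: mult_left_mono)
    also have "\<dots> = (Q ^^ m) (\<lambda>x. f xi + s' * u x) z'" using Qn_affine[OF Cbu, of m "f xi" s'] by simp
    also have "\<dots> \<le> (Q ^^ m) f z'"
    proof (rule Qn_mono[OF Cb_affine[OF Cbu] Cbf _ z(2)])
      fix x assume x: "x \<in> X"
      show "f xi + s' * u x \<le> f x"
      proof (cases "dist x zh < \<theta>/4")
        case True
        have "s' * u x \<le> s' * 1" using s u01 by (intro mult_left_mono) auto
        moreover have "f zh - 1/4 \<le> f x" using near[OF x True] by linarith
        then have "f xi + s' \<le> f x" using xi(2)[OF x] by (simp add: s'_def max_def)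
        ultimately show ?thesis by linarith
      next
        case False
        then show ?thesis using u0[of x] xi(2)[OF x] by simp
      qed
    qed
    finally have 2: "f xi + s' * p \<le> (Q ^^ m) f z'" .
    have p1: "p \<le> 1"
      using Qn_le[OF Cbu u01(2) zm(1), of m] unfolding p_def .
    \<comment> \<open>The difference is thus at most
      \<open>D - (D - 1/2) * p = D * (1 - p) + p / 2\<close>, and \<open>D\<close> is at most
      1.\<close>
    have "D - 1/2 \<le> s + s'" by (auto simp: D_def s_def s'_def max_def)
    then have "(D - 1/2) * p \<le> (s + s') * p" using p(1) by (intro mult_right_mono) auto
    moreover have "D * (1 - p) \<le> 1 * (1 - p)" using D p1 by (intro mult_right_mono) auto
    ultimately show ?thesis using 1 2 unfolding D_def by (simp add: algebra_simps)
  qed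
  define \<alpha> where "\<alpha> = max (1/2) (1 - p/2)"
  have \<alpha>: "1/2 \<le> \<alpha>" "1 - p/2 \<le> \<alpha>" "\<alpha> < 1" using p(1) by (auto simp: \<alpha>_def)
  have step: "\<bar>(Q ^^ m) f z - (Q ^^ m) f z'\<bar> \<le> \<alpha> * min 1 (dist z z' / \<theta>)"
    if f: "truncated_lipschitz \<theta> f" and z: "z \<in> X" "z' \<in> X" for f z z'
  proof (cases "dist z z' < \<theta>")
    case True
    obtain m' where m': "m = Suc m'" using m by (cases m) auto
    have "\<bar>Q ((Q ^^ m') f) z - Q ((Q ^^ m') f) z'\<bar> \<le> 1/2 * (dist z z' / \<theta>)"
      by (rule close[OF truncated_lipschitz_Qn[OF f] z])
    also have "\<dots> \<le> \<alpha> * (dist z z' / \<theta>)" using \<alpha>(1) \<theta> by (intro mult_right_mono) auto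
    also have "dist z z' / \<theta> = min 1 (dist z z' / \<theta>)" using True \<theta> by simp
    finally show ?thesis by (simp add: m')
  next
    case False
    then have "min 1 (dist z z' / \<theta>) = 1" using \<theta> by simp
    then show ?thesis using far[OF f z] far[OF f z(2,1)] \<alpha>(2) by (auto simp: abs_le_iff)
  qed
  \<comment> \<open>Divided by \<open>\<alpha> ^ k\<close>, the iterates stay in the class, so the
    estimate for one block of \<open>m\<close> steps can be repeated.\<close>
  have iter: "truncated_lipschitz \<theta> (\<lambda>x. 0 + (1 / \<alpha> ^ k) * (Q ^^ (m * k)) f x)" if f: "truncated_lipschitz \<theta> f" for f k
  proof (induction k)
    case 0 then show ?case using f by simp
  next
    case (Suc k)
    have Cbf: "Cb f" using f by (simp add: truncated_lipschitz_def)
    have a: "\<alpha> > 0" using \<alpha>(1) by linarith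
    show ?case unfolding truncated_lipschitz_def
    proof (intro conjI ballI Cb_affine Cb_Qn Cbf)
      fix x y assume xy: "x \<in> X" "y \<in> X"
      have "\<bar>(Q ^^ m) (\<lambda>x. 0 + (1 / \<alpha> ^ k) * (Q ^^ (m * k)) f x) x - (Q ^^ m) (\<lambda>x. 0 + (1 / \<alpha> ^ k) * (Q ^^ (m * k)) f x) y\<bar>
          \<le> \<alpha> * min 1 (dist x y / \<theta>)" by (rule step[OF Suc xy])
      moreover have "(Q ^^ m) (\<lambda>x. 0 + (1 / \<alpha> ^ k) * (Q ^^ (m * k)) f x) = (\<lambda>x. 0 + (1 / \<alpha> ^ k) * (Q ^^ (m * Suc k)) f x)"
        unfolding Qn_affine[OF Cb_Qn[OF Cbf]] by (simp add: funpow_add)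
      ultimately have "\<bar>(1 / \<alpha> ^ k) * (Q ^^ (m * Suc k)) f x - (1 / \<alpha> ^ k) * (Q ^^ (m * Suc k)) f y\<bar> \<le> \<alpha> * min 1 (dist x y / \<theta>)"
        by simp
      then have "(1/\<alpha>) * \<bar>(1 / \<alpha> ^ k) * (Q ^^ (m * Suc k)) f x - (1 / \<alpha> ^ k) * (Q ^^ (m * Suc k)) f y\<bar>
          \<le> (1/\<alpha>) * (\<alpha> * min 1 (dist x y / \<theta>))"
        using a by (intro mult_left_mono) auto
      then have "(1/\<alpha>) * \<bar>(1 / \<alpha> ^ k) * (Q ^^ (m * Suc k)) f x - (1 / \<alpha> ^ k) * (Q ^^ (m * Suc k)) f y\<bar> \<le> min 1 (dist x y / \<theta>)"
        using a by simp
      moreover have "(1/\<alpha>) * \<bar>(1 / \<alpha> ^ k) * (Q ^^ (m * Suc k)) f x - (1 / \<alpha> ^ k) * (Q ^^ (m * Suc k)) f y\<bar>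
         = \<bar>(0 + 1 / \<alpha> ^ Suc k * (Q ^^ (m * Suc k)) f x) - (0 + 1 / \<alpha> ^ Suc k * (Q ^^ (m * Suc k)) f y)\<bar>"
      proof -
        have abs: "(1/\<alpha>) * \<bar>t\<bar> = \<bar>(1/\<alpha>) * t\<bar>" for t using a by (simp add: abs_mult)
        have "(1/\<alpha>) * ((1 / \<alpha> ^ k) * v - (1 / \<alpha> ^ k) * w) = (0 + 1 / \<alpha> ^ Suc k * v) - (0 + 1 / \<alpha> ^ Suc k * w)" for v w
          by (simp add: diff_divide_distrib mult.commute)
        then show ?thesis unfolding abs by simp
      qed
      ultimately show "\<bar>(0 + 1 / \<alpha> ^ Suc k * (Q ^^ (m * Suc k)) f x) - (0 + 1 / \<alpha> ^ Suc k * (Q ^^ (m * Suc k)) f y)\<bar>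
         \<le> min 1 (dist x y / \<theta>)" by simp
    qed
  qed
  have "\<bar>(Q ^^ (m * k)) f z - (Q ^^ (m * k)) f z'\<bar> \<le> \<alpha> ^ k * min 1 (dist z z' / \<theta>)"
    if f: "truncated_lipschitz \<theta> f" and z: "z \<in> X" "z' \<in> X" for f k z z'
  proof -
    have a: "\<alpha> ^ k > 0" using \<alpha>(1) by simp
    have "\<bar>(1 / \<alpha> ^ k) * (Q ^^ (m * k)) f z - (1 / \<alpha> ^ k) * (Q ^^ (m * k)) f z'\<bar> \<le> min 1 (dist z z' / \<theta>)"
      using iter[OF f, of k] z unfolding truncated_lipschitz_def by simp
    moreover have "\<bar>(1 / \<alpha> ^ k) * (Q ^^ (m * k)) f z - (1 / \<alpha> ^ k) * (Q ^^ (m * k)) f z'\<bar>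
        = (1 / \<alpha> ^ k) * \<bar>(Q ^^ (m * k)) f z - (Q ^^ (m * k)) f z'\<bar>"
      using a by (simp add: right_diff_distrib[symmetric] abs_mult del: times_divide_eq_left)
    ultimately have "(1 / \<alpha> ^ k) * \<bar>(Q ^^ (m * k)) f z - (Q ^^ (m * k)) f z'\<bar> \<le> min 1 (dist z z' / \<theta>)"
      by simp
    then have "\<alpha> ^ k * ((1 / \<alpha> ^ k) * \<bar>(Q ^^ (m * k)) f z - (Q ^^ (m * k)) f z'\<bar>) \<le> \<alpha> ^ k * min 1 (dist z z' / \<theta>)"
      using a by (intro mult_left_mono) auto
    then show ?thesis using \<alpha>(1) by (simp split: if_splits)
  qed
  then show ?thesis using \<theta> m \<alpha> by blast
qed

lemma osc_decay:
  "\<exists>C>0. \<exists>\<gamma>>0. \<forall>f n. Cb f \<longrightarrow> (\<forall>x\<in>X. \<forall>y\<in>X. \<bar>f x - f y\<bar> \<le> min 2 (2 * dist x y)) \<longrightarrow>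
     (\<forall>z\<in>X. \<forall>z'\<in>X. \<bar>(Q ^^ n) f z - (Q ^^ n) f z'\<bar> \<le> C * exp (- \<gamma> * real n))"
proof -
  obtain \<theta> m \<alpha> where *: "\<theta> > 0" "m \<ge> 1" "1/2 \<le> \<alpha>" "\<alpha> < 1"
    and dec: "\<And>f k z z'. truncated_lipschitz \<theta> f \<Longrightarrow> z\<in>X \<Longrightarrow> z'\<in>X \<Longrightarrow>
      \<bar>(Q ^^ (m * k)) f z - (Q ^^ (m * k)) f z'\<bar> \<le> \<alpha> ^ k * min 1 (dist z z' / \<theta>)"
    using osc_decay_truncated_lipschitz by blast
  have a: "\<alpha> > 0" using *(3) by linarith
  \<comment> \<open>Scales the given functions into the class: 2 for the truncation at 1,
    \<open>2 * \<theta>\<close> for the Lipschitz constant \<open>1/\<theta>\<close>.\<close>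
  define M where "M = max 2 (2 * \<theta>)"
  have M: "M > 0" "2 \<le> M" "2 * \<theta> \<le> M" by (auto simp: M_def)
  \<comment> \<open>Every block of \<open>m\<close> steps yields a factor \<open>\<alpha>\<close>;
    the incomplete last block costs the factor \<open>1/\<alpha>\<close>.\<close>
  define \<gamma> where "\<gamma> = - ln \<alpha> / real m"
  have \<gamma>: "\<gamma> > 0" using a *(2,4) by (simp add: \<gamma>_def divide_neg_pos ln_less_zero)
  have pw: "\<alpha> ^ (n div m) \<le> (1/\<alpha>) * exp (- \<gamma> * real n)" for n
  proof -
    have "real n \<le> real m * (real (n div m) + 1)"
    proof -
      have "n < m * (n div m + 1)" using *(2) by (metis Suc_eq_plus1 dividend_less_times_div less_le_trans mult_Suc_right not_one_le_zero add.commute zero_less_iff_neq_zero)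
      then have "real n \<le> real (m * (n div m + 1))" by linarith
      then show ?thesis by (simp add: algebra_simps)
    qed
    then have "\<gamma> * real n \<le> \<gamma> * (real m * (real (n div m) + 1))" using \<gamma> by (intro mult_left_mono) auto
    also have "\<dots> = - ln \<alpha> * (real (n div m) + 1)" using *(2) by (simp add: \<gamma>_def)
    finally have "ln \<alpha> * real (n div m) \<le> - ln \<alpha> - \<gamma> * real n" by (simp add: algebra_simps)
    then have "exp (ln \<alpha> * real (n div m)) \<le> exp (- ln \<alpha>) * exp (- \<gamma> * real n)"
      by (simp add: exp_add[symmetric])
    moreover have "exp (ln \<alpha> * real (n div m)) = \<alpha> ^ (n div m)" using a by (simp add: powr_realpow[symmetric] powr_def mult.commute)
    moreover have "exp (- ln \<alpha>) = 1/\<alpha>" using a by (simp add: exp_minus divide_inverse)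
    ultimately show ?thesis by simp
  qed
  have "\<bar>(Q ^^ n) f z - (Q ^^ n) f z'\<bar> \<le> (M / \<alpha>) * exp (- \<gamma> * real n)"
    if f: "Cb f" "\<forall>x\<in>X. \<forall>y\<in>X. \<bar>f x - f y\<bar> \<le> min 2 (2 * dist x y)" and z: "z \<in> X" "z' \<in> X" for f n z z'
  proof -
    define h where "h = (\<lambda>x. 0 + (1/M) * f x)"
    have Cbh: "Cb h" unfolding h_def by (rule Cb_affine[OF f(1)])
    have "truncated_lipschitz \<theta> h" unfolding truncated_lipschitz_def
    proof (intro conjI ballI Cbh)
      fix x y assume xy: "x \<in> X" "y \<in> X"
      have "\<bar>h x - h y\<bar> = \<bar>f x - f y\<bar> / M" using M by (simp add: h_def diff_divide_distrib[symmetric])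
      moreover have "\<bar>f x - f y\<bar> \<le> M" using f(2) xy M by force
      moreover have "\<bar>f x - f y\<bar> \<le> M * (dist x y / \<theta>)"
      proof -
        have "\<bar>f x - f y\<bar> \<le> 2 * \<theta> * (dist x y / \<theta>)" using f(2) xy *(1) by simp
        also have "\<dots> \<le> M * (dist x y / \<theta>)" using M *(1) by (intro mult_right_mono) auto
        finally show ?thesis .
      qed
      ultimately have "\<bar>f x - f y\<bar> \<le> M * min 1 (dist x y / \<theta>)" by (simp add: min_def)
      with \<open>\<bar>h x - h y\<bar> = \<bar>f x - f y\<bar> / M\<close> show "\<bar>h x - h y\<bar> \<le> min 1 (dist x y / \<theta>)"
        unfolding pos_divide_le_eq[OF M(1)] by (simp only: mult.commute[of M] pos_divide_le_eq[OF M(1)])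
    qed
    define k where "k = n div m"
    have osc: "\<bar>(Q ^^ (m * k)) h x - (Q ^^ (m * k)) h y\<bar> \<le> \<alpha> ^ k" if "x \<in> X" "y \<in> X" for x y
    proof -
      have "\<alpha> ^ k * min 1 (dist x y / \<theta>) \<le> \<alpha> ^ k * 1" using a by (intro mult_left_mono) auto
      then show ?thesis using dec[OF \<open>truncated_lipschitz \<theta> h\<close> that, of k] by linarith
    qed
    have "(Q ^^ n) h = (Q ^^ (n mod m)) ((Q ^^ (m * k)) h)"
      unfolding k_def by (metis comp_apply funpow_add mod_mult_div_eq)
    then have "\<bar>(Q ^^ n) h z - (Q ^^ n) h z'\<bar> \<le> \<alpha> ^ k"
      using Qn_osc[OF Cb_Qn[OF Cbh] osc z] by simp
    moreover have "\<bar>(Q ^^ n) h z - (Q ^^ n) h z'\<bar> = \<bar>(Q ^^ n) f z - (Q ^^ n) f z'\<bar> / M"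
      unfolding h_def Qn_affine[OF f(1)] using M by (simp add: diff_divide_distrib[symmetric])
    ultimately have "\<bar>(Q ^^ n) f z - (Q ^^ n) f z'\<bar> \<le> M * \<alpha> ^ k" using M by (simp add: field_simps)
    also have "\<dots> \<le> M * ((1/\<alpha>) * exp (- \<gamma> * real n))" using pw[of n] M unfolding k_def by (intro mult_left_mono) auto
    finally show ?thesis by simp
  qed
  moreover have "M / \<alpha> > 0" using M a by simp
  ultimately show ?thesis using \<gamma> by blast
qed

end

section \<open>Representation of positive functionals\<close>

definition bounded_lipschitz :: "('a::metric_space \<Rightarrow> real) \<Rightarrow> bool" where
  "bounded_lipschitz f \<longleftrightarrow> (\<exists>L. L-lipschitz_on UNIV f) \<and> (\<exists>B. \<forall>x. \<bar>f x\<bar> \<le> B)"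

lemma bounded_lipschitz_const: "bounded_lipschitz (\<lambda>_. c)"
  unfolding bounded_lipschitz_def by (auto intro!: exI[of _ 0] lipschitz_onI exI[of _ "\<bar>c\<bar>"])

lemma bounded_lipschitz_obtain:
  assumes "bounded_lipschitz f"
  obtains L B where "L \<ge> 0" "B \<ge> 0" "\<And>x y. \<bar>f x - f y\<bar> \<le> L * dist x y" "\<And>x. \<bar>f x\<bar> \<le> B"
proof -
  obtain L B where LB: "L-lipschitz_on UNIV f" "\<forall>x. \<bar>f x\<bar> \<le> B"
    using assms by (auto simp: bounded_lipschitz_def)
  have "B \<ge> 0" using LB(2) by (meson abs_ge_zero order_trans)
  then show ?thesis
    using that[OF lipschitz_on_nonneg[OF LB(1)] _ _ LB(2)[rule_format]] lipschitz_onD[OF LB(1)]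
    by (auto simp: dist_real_def)
qed

lemma bounded_lipschitzI:
  "L \<ge> 0 \<Longrightarrow> (\<And>x y. \<bar>f x - f y\<bar> \<le> L * dist x y) \<Longrightarrow> (\<And>x. \<bar>f x\<bar> \<le> B) \<Longrightarrow> bounded_lipschitz f"
  unfolding bounded_lipschitz_def
  by (intro conjI exI[of _ L] exI[of _ B] allI lipschitz_onI) (simp_all add: dist_real_def)

lemma bounded_lipschitz_add:
  assumes "bounded_lipschitz f" "bounded_lipschitz g"
  shows "bounded_lipschitz (\<lambda>x. f x + g x)"
proof -
  obtain L B where f: "L \<ge> 0" "B \<ge> 0" "\<And>x y. \<bar>f x - f y\<bar> \<le> L * dist x y" "\<And>x. \<bar>f x\<bar> \<le> B"
    by (rule bounded_lipschitz_obtain[OF assms(1)]) blast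
  obtain L' B' where g: "L' \<ge> 0" "B' \<ge> 0" "\<And>x y. \<bar>g x - g y\<bar> \<le> L' * dist x y" "\<And>x. \<bar>g x\<bar> \<le> B'"
    by (rule bounded_lipschitz_obtain[OF assms(2)]) blast
  show ?thesis
  proof (rule bounded_lipschitzI[of "L + L'" _ "B + B'"])
    fix x y
    show "\<bar>f x + g x - (f y + g y)\<bar> \<le> (L + L') * dist x y" using f(3)[of x y] g(3)[of x y] by (simp add: distrib_right)
    show "\<bar>f x + g x\<bar> \<le> B + B'" using f(4)[of x] g(4)[of x] by linarith
  qed (use f g in auto)
qed

lemma bounded_lipschitz_mult:
  assumes "bounded_lipschitz f" "bounded_lipschitz g"
  shows "bounded_lipschitz (\<lambda>x. f x * g x)"
proof -
  obtain L B where f: "L \<ge> 0" "B \<ge> 0" "\<And>x y. \<bar>f x - f y\<bar> \<le> L * dist x y" "\<And>x. \<bar>f x\<bar> \<le> B"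
    by (rule bounded_lipschitz_obtain[OF assms(1)]) blast
  obtain L' B' where g: "L' \<ge> 0" "B' \<ge> 0" "\<And>x y. \<bar>g x - g y\<bar> \<le> L' * dist x y" "\<And>x. \<bar>g x\<bar> \<le> B'"
    by (rule bounded_lipschitz_obtain[OF assms(2)]) blast
  show ?thesis
  proof (rule bounded_lipschitzI[of "L * B' + B * L'" _ "B * B'"])
    fix x y
    have "f x * g x - f y * g y = (f x - f y) * g x + f y * (g x - g y)" by (simp add: algebra_simps)
    then have "\<bar>f x * g x - f y * g y\<bar> \<le> \<bar>f x - f y\<bar> * \<bar>g x\<bar> + \<bar>f y\<bar> * \<bar>g x - g y\<bar>"
      by (metis abs_mult abs_triangle_ineq)
    also have "\<dots> \<le> (L * dist x y) * B' + B * (L' * dist x y)"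
      using f g by (intro add_mono mult_mono) auto
    finally show "\<bar>f x * g x - f y * g y\<bar> \<le> (L * B' + B * L') * dist x y" by (simp add: algebra_simps)
    show "\<bar>f x * g x\<bar> \<le> B * B'" unfolding abs_mult using f g by (intro mult_mono) auto
  qed (use f g in auto)
qed

lemma bounded_lipschitz_diff:
  "bounded_lipschitz f \<Longrightarrow> bounded_lipschitz g \<Longrightarrow> bounded_lipschitz (\<lambda>x. f x - g x)"
  using bounded_lipschitz_add[of f "\<lambda>x. (-1) * g x"] bounded_lipschitz_mult[OF bounded_lipschitz_const[of "-1"], of g] by simp

lemma bounded_lipschitz_min:
  assumes "bounded_lipschitz f"
  shows "bounded_lipschitz (\<lambda>x. min (f x) c)"
proof -
  obtain L B where f: "L \<ge> 0" "B \<ge> 0" "\<And>x y. \<bar>f x - f y\<bar> \<le> L * dist x y" "\<And>x. \<bar>f x\<bar> \<le> B"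
    by (rule bounded_lipschitz_obtain[OF assms(1)]) blast
  show ?thesis
  proof (rule bounded_lipschitzI[of L _ "B + \<bar>c\<bar>"])
    fix x y
    have "\<bar>min (f x) c - min (f y) c\<bar> \<le> \<bar>f x - f y\<bar>" by (simp add: min_def)
    then show "\<bar>min (f x) c - min (f y) c\<bar> \<le> L * dist x y" using f(3)[of x y] by linarith
    show "\<bar>min (f x) c\<bar> \<le> B + \<bar>c\<bar>" using f(2) f(4)[of x] by (auto simp: min_def)
  qed (use f in auto)
qed

lemma bounded_lipschitz_sum:
  "(\<And>i. i \<in> I \<Longrightarrow> bounded_lipschitz (f i)) \<Longrightarrow> bounded_lipschitz (\<lambda>x. \<Sum>i\<in>I. f i x)"
  by (induction I rule: infinite_finite_induct) (auto intro: bounded_lipschitz_add bounded_lipschitz_const)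

lemma bounded_lipschitz_continuous: "bounded_lipschitz f \<Longrightarrow> continuous_on UNIV f"
  unfolding bounded_lipschitz_def using lipschitz_on_continuous_on by blast

text \<open>As \<open>n\<close> grows these functions increase to the indicator of the complement of
  a closed nonempty set \<open>C\<close>.\<close>

definition dist_cutoff :: "'a::metric_space set \<Rightarrow> nat \<Rightarrow> 'a \<Rightarrow> real" where
  "dist_cutoff C n x = min (real n * infdist x C) 1"

lemma dist_cutoff_lipschitz: "bounded_lipschitz (dist_cutoff C n)"
proof (rule bounded_lipschitzI[of "real n" _ 1])
  fix x y :: 'a
  have "\<bar>dist_cutoff C n x - dist_cutoff C n y\<bar> \<le> \<bar>real n * infdist x C - real n * infdist y C\<bar>"
    by (simp add: dist_cutoff_def min_def)
  also have "\<dots> = real n * \<bar>infdist x C - infdist y C\<bar>" by (simp add: right_diff_distrib[symmetric] abs_mult)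
  also have "\<dots> \<le> real n * dist x y"
    using infdist_triangle_abs[of x C y] by (intro mult_left_mono) (auto simp: dist_commute)
  finally show "\<bar>dist_cutoff C n x - dist_cutoff C n y\<bar> \<le> real n * dist x y" .
  show "\<bar>dist_cutoff C n x\<bar> \<le> 1" by (simp add: dist_cutoff_def infdist_nonneg min_def)
qed auto

lemma dist_cutoff_bounds: "0 \<le> dist_cutoff C n x" "dist_cutoff C n x \<le> 1"
  by (simp_all add: dist_cutoff_def infdist_nonneg)

lemma dist_cutoff_mono: "m \<le> n \<Longrightarrow> dist_cutoff C m x \<le> dist_cutoff C n x"
  unfolding dist_cutoff_def by (intro min.mono mult_right_mono infdist_nonneg) auto

lemma dist_cutoff_zero: "x \<in> C \<Longrightarrow> dist_cutoff C n x = 0"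
  by (simp add: dist_cutoff_def)

lemma dist_cutoff_tendsto:
  assumes "closed C" "C \<noteq> {}" "x \<notin> C"
  shows "\<forall>\<^sub>F n in sequentially. dist_cutoff C n x = 1"
proof -
  have p: "infdist x C > 0" using assms infdist_pos_not_in_closed by blast
  obtain N where "real N > 1 / infdist x C" using reals_Archimedean2 by blast
  then have "real n * infdist x C \<ge> 1" if "n \<ge> N" for n
  proof -
    have "1 / infdist x C < real n" using \<open>real N > 1 / infdist x C\<close> that by linarith
    then show ?thesis using p by (simp add: pos_divide_less_eq less_imp_le)
  qed
  then show ?thesis by (intro eventually_sequentiallyI[of N]) (simp add: dist_cutoff_def)
qed

text \<open>A Daniell-type construction: subsets are covered by countable families of functions. Splitting a
  cover along a distance cutoff whose index depends on the member of the family makes open sets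
  measurable directly.\<close>

locale lipschitz_functional =
  fixes X :: "'a::metric_space set" and \<Lambda> :: "('a \<Rightarrow> real) \<Rightarrow> real"
  assumes compact_X: "compact X"
    and add: "bounded_lipschitz f \<Longrightarrow> bounded_lipschitz g \<Longrightarrow> \<Lambda> (\<lambda>x. f x + g x) = \<Lambda> f + \<Lambda> g"
    and scale: "bounded_lipschitz f \<Longrightarrow> \<Lambda> (\<lambda>x. c * f x) = c * \<Lambda> f"
    and mono: "bounded_lipschitz f \<Longrightarrow> bounded_lipschitz g \<Longrightarrow> (\<And>x. x \<in> X \<Longrightarrow> f x \<le> g x) \<Longrightarrow> \<Lambda> f \<le> \<Lambda> g"
    and one: "\<Lambda> (\<lambda>_. 1) = 1"
begin

lemma const: "\<Lambda> (\<lambda>_. c) = c"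
  using scale[OF bounded_lipschitz_const[of 1], of c] one by simp

lemma nonneg: "bounded_lipschitz f \<Longrightarrow> (\<And>x. 0 \<le> f x) \<Longrightarrow> 0 \<le> \<Lambda> f"
  using mono[OF bounded_lipschitz_const[of 0], of f] by (simp add: const)

lemma diff: "bounded_lipschitz f \<Longrightarrow> bounded_lipschitz g \<Longrightarrow> \<Lambda> (\<lambda>x. f x - g x) = \<Lambda> f - \<Lambda> g"
  using add[of f "\<lambda>x. (-1) * g x"] scale[of g "-1"] bounded_lipschitz_mult[OF bounded_lipschitz_const[of "-1"], of g] by simp

lemma sum: "(\<And>i. i \<in> I \<Longrightarrow> bounded_lipschitz (f i)) \<Longrightarrow> \<Lambda> (\<lambda>x. \<Sum>i\<in>I. f i x) = (\<Sum>i\<in>I. \<Lambda> (f i))"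
  by (induction I rule: infinite_finite_induct) (auto simp: const add bounded_lipschitz_sum)

text \<open>Covering is asked for on \<open>X\<close> only, so that the complement of
  \<open>X\<close> becomes a null set.\<close>

definition cover :: "'a set \<Rightarrow> (nat \<Rightarrow> 'a \<Rightarrow> real) \<Rightarrow> bool" where
  "cover A f \<longleftrightarrow> (\<forall>i. bounded_lipschitz (f i) \<and> (\<forall>x. 0 \<le> f i x)) \<and> (\<forall>x\<in>A \<inter> X. 1 \<le> (\<Sum>i. ennreal (f i x)))"

definition cover_mass :: "'a set \<Rightarrow> ennreal" where
  "cover_mass A = (INF f\<in>{f. cover A f}. \<Sum>i. ennreal (\<Lambda> (f i)))"

lemma cover_mass_le: "cover A f \<Longrightarrow> cover_mass A \<le> (\<Sum>i. ennreal (\<Lambda> (f i)))"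
  unfolding cover_mass_def by (rule INF_lower) simp

text \<open>Doubly indexed covers, flattened by \<open>prod_decode\<close>. They arise from
  countable unions and from splitting each member of a cover into layers.\<close>

lemma cover_mass_le2:
  assumes "\<And>i j. bounded_lipschitz (f i j)" "\<And>i j x. 0 \<le> f i j x"
    and "\<And>x. x \<in> A \<inter> X \<Longrightarrow> 1 \<le> (\<Sum>i. \<Sum>j. ennreal (f i j x))"
  shows "cover_mass A \<le> (\<Sum>i. \<Sum>j. ennreal (\<Lambda> (f i j)))"
proof -
  define h where "h = (\<lambda>k. f (fst (prod_decode k)) (snd (prod_decode k)))"
  have "(\<Sum>k. (\<lambda>p. ennreal (f (fst p) (snd p) x)) (prod_decode k)) = (\<Sum>i. \<Sum>j. ennreal (f i j x))" for x
    by (rule suminf_ennreal_2dimen) simp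
  then have "cover A h" unfolding cover_def h_def using assms by auto
  then have "cover_mass A \<le> (\<Sum>k. ennreal (\<Lambda> (h k)))" by (rule cover_mass_le)
  also have "\<dots> = (\<Sum>k. (\<lambda>p. ennreal (\<Lambda> (f (fst p) (snd p)))) (prod_decode k))" by (simp add: h_def)
  also have "\<dots> = (\<Sum>i. \<Sum>j. ennreal (\<Lambda> (f i j)))" by (rule suminf_ennreal_2dimen) simp
  finally show ?thesis .
qed

lemma cover_mass_le1:
  assumes g: "bounded_lipschitz g" "\<And>x. 0 \<le> g x" "\<And>x. x \<in> A \<inter> X \<Longrightarrow> 1 \<le> g x"
  shows "cover_mass A \<le> ennreal (\<Lambda> g)"
proof -
  define f where "f = (\<lambda>i::nat. if i = 0 then g else (\<lambda>_. 0))"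
  have s: "(\<Sum>i. ennreal (f i x)) = ennreal (g x)" for x
    by (subst suminf_finite[of "{0}"]) (auto simp: f_def)
  have "cover A f" unfolding cover_def s
    using g by (auto simp: f_def bounded_lipschitz_const ennreal_ge_1)
  then have "cover_mass A \<le> (\<Sum>i. ennreal (\<Lambda> (f i)))" by (rule cover_mass_le)
  also have "\<dots> = ennreal (\<Lambda> g)" by (subst suminf_finite[of "{0}"]) (auto simp: f_def const)
  finally show ?thesis .
qed

lemma cover_mass_mono: assumes "A \<inter> X \<subseteq> B \<inter> X" shows "cover_mass A \<le> cover_mass B"
proof -
  have "cover A f" if "cover B f" for f using that assms unfolding cover_def by blast
  then show ?thesis unfolding cover_mass_def by (intro INF_superset_mono) auto
qed

lemma cover_mass_empty: "A \<inter> X = {} \<Longrightarrow> cover_mass A = 0"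
  using cover_mass_le1[OF bounded_lipschitz_const[of 0], of A] by (simp add: const)

lemma cover_mass_close:
  assumes "cover_mass A < e" shows "\<exists>f. cover A f \<and> (\<Sum>i. ennreal (\<Lambda> (f i))) < e"
  using assms unfolding cover_mass_def INF_less_iff by auto

lemma cover_mass_subadditive: "cover_mass (\<Union>n. A n) \<le> (\<Sum>n. cover_mass (A n))"
proof (rule ennreal_le_epsilon)
  fix e :: real assume e: "0 < e" "(\<Sum>n. cover_mass (A n)) < top"
  then have "\<And>n. cover_mass (A n) < cover_mass (A n) + e * (1/2)^Suc n"
    by (auto simp add: less_top dest!: ennreal_suminf_lessD)
  then have "\<exists>f. cover (A n) f \<and> (\<Sum>i. ennreal (\<Lambda> (f i))) < cover_mass (A n) + e * (1/2)^Suc n" for n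
    by (rule cover_mass_close)
  then obtain f where f: "\<And>n. cover (A n) (f n)" "\<And>n. (\<Sum>i. ennreal (\<Lambda> (f n i))) < cover_mass (A n) + e * (1/2)^Suc n"
    by metis
  have "cover_mass (\<Union>n. A n) \<le> (\<Sum>n. \<Sum>i. ennreal (\<Lambda> (f n i)))"
  proof (rule cover_mass_le2)
    fix x assume "x \<in> (\<Union>n. A n) \<inter> X"
    then obtain n where "x \<in> A n \<inter> X" by blast
    then have "1 \<le> (\<Sum>i. ennreal (f n i x))" using f(1)[of n] by (auto simp: cover_def)
    also have "\<dots> = (\<Sum>n\<in>{n}. \<Sum>i. ennreal (f n i x))" by simp
    also have "\<dots> \<le> (\<Sum>n. \<Sum>i. ennreal (f n i x))" by (rule sum_le_suminf) auto
    finally show "1 \<le> (\<Sum>n. \<Sum>i. ennreal (f n i x))" .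
  qed (use f(1) in \<open>auto simp: cover_def\<close>)
  also have "\<dots> \<le> (\<Sum>n. cover_mass (A n) + e * (1/2) ^ Suc n)"
    by (intro suminf_le less_imp_le f(2)) auto
  also have "... = (\<Sum>n. cover_mass (A n)) + (\<Sum>n. ennreal e * ennreal ((1/2) ^ Suc n))"
    using \<open>0 < e\<close> by (subst suminf_add[symmetric])
                     (auto simp del: ennreal_suminf_cmult simp add: ennreal_mult[symmetric])
  also have "\<dots> = (\<Sum>n. cover_mass (A n)) + e"
    unfolding ennreal_suminf_cmult
    by (subst suminf_ennreal_eq[OF zero_le_power power_half_series]) auto
  finally show "cover_mass (\<Union>n. A n) \<le> (\<Sum>n. cover_mass (A n)) + e" .
qed

lemma cover_mass_union: "cover_mass (A \<union> B) \<le> cover_mass A + cover_mass B"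
proof -
  have "cover_mass (A \<union> B) \<le> cover_mass (\<Union>n::nat. if n = 0 then A else if n = 1 then B else {})"
    by (rule cover_mass_mono) auto
  also have "\<dots> \<le> (\<Sum>n::nat. cover_mass (if n = 0 then A else if n = 1 then B else {}))" by (rule cover_mass_subadditive)
  also have "\<dots> = cover_mass A + cover_mass B"
    by (subst suminf_finite[of "{0, 1}"]) (auto simp: cover_mass_empty)
  finally show ?thesis .
qed

lemma cover_mass_outer: "outer_measure_space UNIV cover_mass" "outer_measure_space (Pow UNIV) cover_mass"
  unfolding outer_measure_space_def positive_def increasing_def countably_subadditive_def
  by (auto simp: cover_mass_empty intro!: cover_mass_mono cover_mass_subadditive)

text \<open>Given a nearly optimal cover \<open>f\<close> of \<open>T\<close> and the cutoffs
  \<open>h n\<close> for the complement of \<open>U\<close>, the layers of \<open>f i * h n\<close>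
  between consecutive \<open>n\<close> cover the part in \<open>U\<close> at total cost
  \<open>s i\<close>, the limit of \<open>\<Lambda> (f i * h n)\<close>. On the complement of
  \<open>U\<close> the cutoffs vanish, so \<open>f i * (1 - h n)\<close> still covers, for any
  choice of \<open>n\<close>. If \<open>n\<close> is large the two costs nearly add up to
  \<open>\<Lambda> (f i)\<close>. The case \<open>U = UNIV\<close> is excluded since
  \<open>infdist\<close> to the empty set is 0 by convention.\<close>

lemma open_caratheodory:
  assumes U: "open U" "U \<noteq> UNIV"
  shows "cover_mass (U \<inter> T) + cover_mass ((UNIV - U) \<inter> T) \<le> cover_mass T"
proof (rule ennreal_le_epsilon)
  fix e :: real assume e: "0 < e" "cover_mass T < top"
  define C where "C = - U"
  have C: "closed C" "C \<noteq> {}" using U by (auto simp: C_def)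
  define h where "h = dist_cutoff C"
  have hL: "bounded_lipschitz (h n)" for n by (simp add: h_def dist_cutoff_lipschitz)
  have h01: "0 \<le> h n x" "h n x \<le> 1" for n x by (simp_all add: h_def dist_cutoff_bounds)
  have "cover_mass T < cover_mass T + ennreal (e/2)" using e by (cases "cover_mass T") (auto simp: ennreal_plus[symmetric] ennreal_less_iff simp del: ennreal_plus)
  then obtain f where f: "cover T f" "(\<Sum>i. ennreal (\<Lambda> (f i))) < cover_mass T + ennreal (e/2)"
    using cover_mass_close by blast
  have fL: "bounded_lipschitz (f i)" and f0: "0 \<le> f i x" for i x using f(1) by (auto simp: cover_def)
  have fhL: "bounded_lipschitz (\<lambda>x. f i x * h n x)" for i n by (intro bounded_lipschitz_mult fL hL)
  define a where "a = (\<lambda>i n. \<Lambda> (\<lambda>x. f i x * h n x))"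
  define d where "d = (\<lambda>i n x. f i x * h (Suc n) x - f i x * h n x)"
  have dL: "bounded_lipschitz (d i n)" for i n unfolding d_def by (intro bounded_lipschitz_diff fhL)
  have d0: "0 \<le> d i n x" for i n x
    unfolding d_def h_def using f0[of i x] dist_cutoff_mono[of n "Suc n" C x] by (simp add: mult_left_mono)
  have \<Lambda>d: "\<Lambda> (d i n) = a i (Suc n) - a i n" for i n unfolding d_def a_def by (intro diff fhL)
  have a0: "a i 0 = 0" for i by (simp add: a_def h_def dist_cutoff_def infdist_nonneg min_def const)
  have ab: "a i n \<le> \<Lambda> (f i)" for i n unfolding a_def
    using mult_left_mono[OF h01(2) f0] by (intro mono fhL fL) simp
  have "incseq (a i)" for i
  proof (rule incseq_SucI)
    fix n show "a i n \<le> a i (Suc n)" using nonneg[OF dL d0, of i n] by (simp add: \<Lambda>d)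
  qed
  then have "\<exists>L. a i \<longlonglongrightarrow> L \<and> (\<forall>n. a i n \<le> L)" for i
    using incseq_convergent[of "a i" "\<Lambda> (f i)"] ab by metis
  then obtain s where s: "\<And>i. a i \<longlonglongrightarrow> s i" "\<And>i n. a i n \<le> s i" by metis
  have s0: "0 \<le> s i" for i using s(2)[of i 0] a0 by simp
  have sumd: "(\<Sum>n. ennreal (\<Lambda> (d i n))) = ennreal (s i)" for i
  proof -
    have "(\<lambda>n. \<Lambda> (d i n)) sums (s i - a i 0)" unfolding \<Lambda>d using s(1) by (rule telescope_sums)
    then show ?thesis using nonneg[OF dL d0] by (intro suminf_ennreal_eq) (auto simp: a0)
  qed
  have 1: "cover_mass (U \<inter> T) \<le> (\<Sum>i. ennreal (s i))"
  proof -
    have "cover_mass (U \<inter> T) \<le> (\<Sum>i. \<Sum>n. ennreal (\<Lambda> (d i n)))"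
    proof (rule cover_mass_le2[OF dL d0])
      fix x assume x: "x \<in> (U \<inter> T) \<inter> X"
      have "(\<Sum>n. ennreal (d i n x)) = ennreal (f i x)" for i
      proof -
        have "\<forall>\<^sub>F n in sequentially. h n x = 1" unfolding h_def
          using x by (intro dist_cutoff_tendsto C) (auto simp: C_def)
        then have "(\<lambda>n. f i x * h n x) \<longlonglongrightarrow> f i x"
          by (intro tendsto_eventually) (auto elim: eventually_mono)
        then have "(\<lambda>n. d i n x) sums (f i x - f i x * h 0 x)" unfolding d_def by (rule telescope_sums)
        moreover have "h 0 x = 0" by (simp add: h_def dist_cutoff_def)
        ultimately show ?thesis using d0 by (intro suminf_ennreal_eq) auto
      qed
      then show "1 \<le> (\<Sum>i. \<Sum>n. ennreal (d i n x))" using f(1) x by (auto simp: cover_def)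
    qed
    then show ?thesis by (simp add: sumd)
  qed
  have "\<exists>n. s i - e/2 * (1/2)^Suc i < a i n" for i
  proof -
    have "s i - e/2 * (1/2)^Suc i < s i" using e by simp
    from order_tendstoD(1)[OF s(1) this] show ?thesis by (auto simp: eventually_sequentially)
  qed
  \<comment> \<open>The cutoff index depends on \<open>i\<close>, which lets the errors be
    summable.\<close>
  then obtain k where k: "\<And>i. s i - e/2 * (1/2)^Suc i < a i (k i)" by metis
  have fkL: "bounded_lipschitz (\<lambda>x. f i x - f i x * h (k i) x)" for i by (intro bounded_lipschitz_diff fhL fL)
  have 2: "cover_mass ((UNIV - U) \<inter> T) \<le> (\<Sum>i. ennreal (\<Lambda> (f i) - a i (k i)))"
  proof -
    have "cover ((UNIV - U) \<inter> T) (\<lambda>i x. f i x - f i x * h (k i) x)"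
      unfolding cover_def
    proof (intro conjI allI ballI fkL)
      fix i x show "0 \<le> f i x - f i x * h (k i) x"
        using mult_left_mono[OF h01(2) f0, of i x "k i" x] by simp
    next
      fix x assume x: "x \<in> ((UNIV - U) \<inter> T) \<inter> X"
      then have "h n x = 0" for n by (simp add: h_def C_def dist_cutoff_zero)
      then show "1 \<le> (\<Sum>i. ennreal (f i x - f i x * h (k i) x))" using f(1) x by (auto simp: cover_def)
    qed
    from cover_mass_le[OF this] show ?thesis by (simp add: diff[OF fL fhL] a_def)
  qed
  have "cover_mass (U \<inter> T) + cover_mass ((UNIV - U) \<inter> T) \<le> (\<Sum>i. ennreal (s i)) + (\<Sum>i. ennreal (\<Lambda> (f i) - a i (k i)))"
    using 1 2 by (rule add_mono)
  also have "\<dots> = (\<Sum>i. ennreal (s i + (\<Lambda> (f i) - a i (k i))))"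
    using s0 ab by (subst suminf_add) (auto simp: ennreal_plus[symmetric] simp del: ennreal_plus)
  also have "\<dots> \<le> (\<Sum>i. ennreal (\<Lambda> (f i) + e/2 * (1/2)^Suc i))"
  proof (intro suminf_le ennreal_leI)
    fix i show "s i + (\<Lambda> (f i) - a i (k i)) \<le> \<Lambda> (f i) + e/2 * (1/2)^Suc i" using k[of i] by simp
  qed auto
  also have "\<dots> = (\<Sum>i. ennreal (\<Lambda> (f i))) + (\<Sum>i. ennreal (e/2) * ennreal ((1/2)^Suc i))"
    using nonneg[OF fL f0] e
    by (subst suminf_add) (auto simp del: ennreal_suminf_cmult simp add: ennreal_mult[symmetric])
  also have "(\<Sum>i. ennreal (e/2) * ennreal ((1/2)^Suc i)) = ennreal (e/2)"
    unfolding ennreal_suminf_cmult by (subst suminf_ennreal_eq[OF zero_le_power power_half_series]) auto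
  also have "(\<Sum>i. ennreal (\<Lambda> (f i))) + ennreal (e/2) \<le> (cover_mass T + ennreal (e/2)) + ennreal (e/2)"
    using f(2) by (intro add_right_mono) simp
  also have "\<dots> = cover_mass T + ennreal e" using e by (simp add: add.assoc ennreal_plus[symmetric] del: ennreal_plus)
  finally show "cover_mass (U \<inter> T) + cover_mass ((UNIV - U) \<inter> T) \<le> cover_mass T + ennreal e" .
qed

text \<open>The lower bound is an argument of Dini type: the partial sums of a cover are continuous
  and increasing, so by compactness one of them exceeds \<open>1 - e\<close> on all of
  \<open>X\<close>, and monotonicity of \<open>\<Lambda>\<close> applies to this finite sum. This
  takes the place of continuity of \<open>\<Lambda>\<close> along monotone sequences.\<close>

lemma cover_mass_X: "cover_mass X = 1"
proof (rule antisym)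
  show "cover_mass X \<le> 1" using cover_mass_le1[OF bounded_lipschitz_const[of 1], of X] by (simp add: const)
  show "1 \<le> cover_mass X" unfolding cover_mass_def
  proof (rule INF_greatest)
    fix f assume "f \<in> {f. cover X f}"
    then have f: "cover X f" by simp
    have fL: "bounded_lipschitz (f i)" and f0: "0 \<le> f i x" for i x using f by (auto simp: cover_def)
    have pL: "bounded_lipschitz (\<lambda>x. \<Sum>i<n. f i x)" for n by (intro bounded_lipschitz_sum fL)
    show "1 \<le> (\<Sum>i. ennreal (\<Lambda> (f i)))"
    proof (rule ennreal_le_epsilon)
      fix e :: real assume e: "0 < e"
      have ex: "\<exists>n. 1 - e < (\<Sum>i<n. f i x)" if x: "x \<in> X" for x
      proof (rule ccontr)
        assume "\<not> ?thesis"
        then have le: "(\<Sum>i<n. f i x) \<le> 1 - e" for n by (simp add: not_less)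
        have "(\<Sum>i. ennreal (f i x)) \<le> ennreal (1 - e)"
        proof (rule suminf_le_const)
          show "(\<Sum>i<n. ennreal (f i x)) \<le> ennreal (1 - e)" for n
            using le[of n] f0 by (simp add: sum_ennreal ennreal_leI)
        qed auto
        also have "\<dots> < 1" using e by (simp add: ennreal_less_one_iff)
        finally show False using f x by (auto simp: cover_def)
      qed
      define V where "V = (\<lambda>n. {x. 1 - e < (\<Sum>i<n. f i x)})"
      have oV: "open (V n)" for n unfolding V_def
        by (intro open_Collect_less continuous_intros bounded_lipschitz_continuous[OF pL])
      have cV: "X \<subseteq> (\<Union>n\<in>UNIV. V n)" using ex by (auto simp: V_def)
      obtain N where "N \<subseteq> UNIV" and N: "finite N" "X \<subseteq> (\<Union>n\<in>N. V n)"
        by (rule compactE_image[OF compact_X oV cV])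
      define n where "n = Max (insert 0 N)"
      have "\<Lambda> (\<lambda>_. 1 - e) \<le> \<Lambda> (\<lambda>x. \<Sum>i<n. f i x)"
      proof (rule mono[OF bounded_lipschitz_const pL])
        fix x assume "x \<in> X"
        then obtain j where j: "j \<in> N" "1 - e < (\<Sum>i<j. f i x)" using N(2) by (auto simp: V_def)
        have "j \<le> n" using j N by (simp add: n_def)
        then have "(\<Sum>i<j. f i x) \<le> (\<Sum>i<n. f i x)" using f0 by (intro sum_mono2) auto
        then show "1 - e \<le> (\<Sum>i<n. f i x)" using j by simp
      qed
      also have "\<Lambda> (\<lambda>x. \<Sum>i<n. f i x) = (\<Sum>i<n. \<Lambda> (f i))" by (rule sum[OF fL])
      finally have "1 \<le> (\<Sum>i<n. \<Lambda> (f i)) + e" unfolding const by linarith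
      then have "ennreal 1 \<le> ennreal ((\<Sum>i<n. \<Lambda> (f i)) + e)" by (rule ennreal_leI)
      also have "\<dots> = (\<Sum>i<n. ennreal (\<Lambda> (f i))) + ennreal e"
        using nonneg[OF fL f0] e by (subst ennreal_plus) (auto simp: sum_nonneg sum_ennreal)
      also have "\<dots> \<le> (\<Sum>i. ennreal (\<Lambda> (f i))) + ennreal e"
        by (intro add_right_mono sum_le_suminf) auto
      finally show "1 \<le> (\<Sum>i. ennreal (\<Lambda> (f i))) + ennreal e" by simp
    qed
  qed
qed

section \<open>The representing measure\<close>

definition riesz_measure :: "'a measure" where "riesz_measure = measure_of UNIV (sets borel) cover_mass"

lemma riesz_measure_facts:
  shows sets_riesz_measure: "sets riesz_measure = sets borel" and emeasure_riesz_measure: "A \<in> sets borel \<Longrightarrow> emeasure riesz_measure A = cover_mass A"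
    and prob_riesz_measure: "prob_space riesz_measure" and riesz_measure_X: "emeasure riesz_measure (- X) = 0"
proof -
  interpret P: sigma_algebra "UNIV :: 'a set" "Pow UNIV" by (rule sigma_algebra_Pow)
  define L where "L = lambda_system UNIV (Pow UNIV) cover_mass"
  have ms: "measure_space UNIV L cover_mass" unfolding L_def by (rule P.caratheodory_lemma[OF cover_mass_outer(2)])
  then have sa: "sigma_algebra UNIV L" by (simp add: measure_space_def)
  have "U \<in> L" if U: "open U" for U
  proof (cases "U = UNIV")
    case True
    interpret La: sigma_algebra UNIV L by (rule sa)
    show ?thesis using La.top True by simp
  next
    case False
    have "cover_mass (U \<inter> T) + cover_mass ((UNIV - U) \<inter> T) = cover_mass T" for T
    proof (rule antisym)
      show "cover_mass (U \<inter> T) + cover_mass ((UNIV - U) \<inter> T) \<le> cover_mass T" by (rule open_caratheodory[OF U False])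
      have "cover_mass T \<le> cover_mass ((U \<inter> T) \<union> ((UNIV - U) \<inter> T))" by (rule cover_mass_mono) auto
      also have "\<dots> \<le> cover_mass (U \<inter> T) + cover_mass ((UNIV - U) \<inter> T)" by (rule cover_mass_union)
      finally show "cover_mass T \<le> cover_mass (U \<inter> T) + cover_mass ((UNIV - U) \<inter> T)" .
    qed
    then show ?thesis by (simp add: L_def lambda_system_def)
  qed
  then have "sigma_sets UNIV {U. open U} \<subseteq> L"
    by (intro sigma_algebra.sigma_sets_subset[OF sa]) auto
  then have bL: "sets borel \<subseteq> L" by (simp add: sets_borel)
  have sb: "sets (borel :: 'a measure) \<subseteq> Pow UNIV" by simp
  show s: "sets riesz_measure = sets borel" unfolding riesz_measure_def
    using sets.sigma_sets_eq[of "borel :: 'a measure"] by (simp add: sets_measure_of)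
  show em: "emeasure riesz_measure A = cover_mass A" if "A \<in> sets borel" for A
  proof (rule emeasure_measure_of[OF riesz_measure_def sb])
    show "positive (sets riesz_measure) cover_mass" by (simp add: positive_def cover_mass_empty)
    show "countably_additive (sets riesz_measure) cover_mass" unfolding countably_additive_def
    proof (intro allI impI)
      fix F :: "nat \<Rightarrow> 'a set" assume F: "range F \<subseteq> sets riesz_measure" "disjoint_family F" "\<Union> (range F) \<in> sets riesz_measure"
      have "range F \<subseteq> L" "\<Union> (range F) \<in> L" using F bL s by auto
      moreover have "countably_additive L cover_mass" using ms by (simp add: measure_space_def)
      ultimately show "(\<Sum>i. cover_mass (F i)) = cover_mass (\<Union> (range F))"
        using F(2) unfolding countably_additive_def by blast
    qed
    show "A \<in> sets riesz_measure" using that s by simp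
  qed
  have sp: "space riesz_measure = UNIV" using sets_eq_imp_space_eq[OF s] by simp
  have "cover_mass UNIV = cover_mass X" by (rule antisym; rule cover_mass_mono) auto
  then show "prob_space riesz_measure" using em[of UNIV] cover_mass_X sp by (intro prob_spaceI) simp
  have "- X \<in> sets borel" using compact_imp_closed[OF compact_X] by simp
  then show "emeasure riesz_measure (- X) = 0" using em cover_mass_empty[of "- X"] by simp
qed

lemma bounded_lipschitz_integrable:
  assumes "bounded_lipschitz f" shows "integrable riesz_measure f"
proof -
  interpret prob_space riesz_measure by (rule prob_riesz_measure)
  obtain B where "\<And>x. \<bar>f x\<bar> \<le> B" using assms by (auto simp: bounded_lipschitz_def)
  then show ?thesis
    using borel_measurable_continuous_onI[OF bounded_lipschitz_continuous[OF assms]] sets_riesz_measure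
    by (intro integrable_const_bound[of _ B]) (auto simp: measurable_cong_sets[OF sets_riesz_measure refl])
qed

text \<open>A layer cake with \<open>n\<close> layers of height \<open>1 / n\<close>. The layer
  \<open>F j\<close> is at most \<open>1 / n\<close> times the indicator of \<open>E j\<close>,
  while \<open>n * F j\<close> is at least 1 on \<open>E (Suc j)\<close> and so bounds its measure.
  The shift of the index leaves over the set \<open>E 0\<close>, whose contribution is at most
  \<open>1 / n\<close>.\<close>

lemma integral_riesz_measure_le:
  assumes f: "bounded_lipschitz f" "\<And>x. 0 \<le> f x" "\<And>x. f x \<le> 1"
  shows "(\<integral>x. f x \<partial>riesz_measure) \<le> \<Lambda> f"
proof (rule field_le_epsilon)
  interpret prob_space riesz_measure by (rule prob_riesz_measure)
  fix e :: real assume "e > 0"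
  then obtain n' where n': "inverse (real (Suc n')) < e" using reals_Archimedean by blast
  define n where "n = Suc n'"
  have n: "n > 0" "1 / real n < e" using n' by (auto simp: n_def inverse_eq_divide)
  define F where "F = (\<lambda>j x. min (f x) (real (Suc j) / real n) - min (f x) (real j / real n))"
  have FL: "bounded_lipschitz (F j)" for j
    unfolding F_def by (intro bounded_lipschitz_diff bounded_lipschitz_min f)
  have tele: "(\<Sum>j<n. F j x) = f x" for x
  proof -
    have "(\<Sum>j<n. F j x) = min (f x) (real n / real n) - min (f x) (real 0 / real n)"
      unfolding F_def by (rule sum_lessThan_telescope)
    also have "\<dots> = f x" using f(2,3)[of x] n by simp
    finally show ?thesis .
  qed
  define E where "E = (\<lambda>j. {x. real j / real n \<le> f x})"
  have Em: "E j \<in> sets riesz_measure" for j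
  proof -
    have "closed (E j)" unfolding E_def
      by (intro closed_Collect_le continuous_intros bounded_lipschitz_continuous f)
    then show ?thesis by (simp add: sets_riesz_measure)
  qed
  have step: "real j / real n \<le> real (Suc j) / real n" for j by (simp add: divide_right_mono)
  have step': "real j / real n < real (Suc j) / real n" for j using n by (simp add: divide_strict_right_mono)
  have F0: "0 \<le> F j x" for j x unfolding F_def using step[of j] by (simp add: min_def)
  have FE: "F j x \<le> (1 / real n) * indicator (E j) x" for j x
  proof (cases "x \<in> E j")
    case True
    have "real (Suc j) / real n - real j / real n = 1 / real n" by (simp add: diff_divide_distrib[symmetric])
    then show ?thesis using True unfolding F_def E_def by (simp add: min_def)
  next
    case False
    then show ?thesis using step[of j] unfolding F_def E_def by (simp add: min_def)
  qed
  have meas: "measure riesz_measure (E (Suc j)) \<le> real n * \<Lambda> (F j)" for j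
  proof -
    have L: "bounded_lipschitz (\<lambda>x. real n * F j x)" by (intro bounded_lipschitz_mult bounded_lipschitz_const FL)
    have "cover_mass (E (Suc j)) \<le> ennreal (\<Lambda> (\<lambda>x. real n * F j x))"
    proof (rule cover_mass_le1[OF L])
      fix x assume "x \<in> E (Suc j) \<inter> X"
      then have "F j x = real (Suc j) / real n - real j / real n"
        using step'[of j] unfolding F_def E_def by (simp add: min_def)
      then show "1 \<le> real n * F j x" using n by (simp add: diff_divide_distrib[symmetric])
    qed (use F0 in auto)
    then have "emeasure riesz_measure (E (Suc j)) \<le> ennreal (real n * \<Lambda> (F j))"
      using Em emeasure_riesz_measure by (simp add: sets_riesz_measure scale[OF FL])
    then show ?thesis using nonneg[OF FL F0] by (simp add: emeasure_eq_measure)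
  qed
  have "(\<integral>x. f x \<partial>riesz_measure) = (\<integral>x. (\<Sum>j<n. F j x) \<partial>riesz_measure)" by (simp add: tele)
  also have "\<dots> = (\<Sum>j<n. \<integral>x. F j x \<partial>riesz_measure)"
    by (intro Bochner_Integration.integral_sum bounded_lipschitz_integrable FL)
  also have "\<dots> \<le> (\<Sum>j<n. (1 / real n) * measure riesz_measure (E j))"
  proof (rule sum_mono)
    fix j
    have "(\<integral>x. F j x \<partial>riesz_measure) \<le> (\<integral>x. (1 / real n) * indicator (E j) x \<partial>riesz_measure)"
      using Em by (intro integral_mono bounded_lipschitz_integrable FL FE integrable_mult_right integrable_real_indicator)
        (auto simp: emeasure_eq_measure)
    also have "\<dots> = (1 / real n) * measure riesz_measure (E j)" using Em by simp
    finally show "(\<integral>x. F j x \<partial>riesz_measure) \<le> (1 / real n) * measure riesz_measure (E j)" .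
  qed
  also have "\<dots> = (1 / real n) * measure riesz_measure (E 0) + (\<Sum>j<n'. (1 / real n) * measure riesz_measure (E (Suc j)))"
    unfolding n_def by (rule sum.lessThan_Suc_shift)
  also have "\<dots> \<le> (1 / real n) * 1 + (\<Sum>j<n'. \<Lambda> (F j))"
  proof (intro add_mono sum_mono mult_left_mono prob_le_1)
    fix j
    have "(1 / real n) * measure riesz_measure (E (Suc j)) \<le> (1 / real n) * (real n * \<Lambda> (F j))"
      using meas by (intro mult_left_mono) auto
    then show "(1 / real n) * measure riesz_measure (E (Suc j)) \<le> \<Lambda> (F j)" using n by simp
  qed auto
  also have "(\<Sum>j<n'. \<Lambda> (F j)) \<le> (\<Sum>j<n. \<Lambda> (F j))"
    unfolding n_def using nonneg[OF FL F0] by simp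
  also have "(\<Sum>j<n. \<Lambda> (F j)) = \<Lambda> f" using sum[of "{..<n}" F] FL by (simp add: tele)
  finally show "(\<integral>x. f x \<partial>riesz_measure) \<le> \<Lambda> f + e" using n by simp
qed

text \<open>For values in \<open>[0, 1]\<close> the one-sided bound holds for \<open>g\<close> and
  for \<open>1 - g\<close>, and both sides of it assign 1 to the constant 1, whence equality. An
  affine change of scale reduces the general case to this.\<close>

lemma integral_riesz_measure:
  assumes f: "bounded_lipschitz f"
  shows "(\<integral>x. f x \<partial>riesz_measure) = \<Lambda> f"
proof -
  interpret prob_space riesz_measure by (rule prob_riesz_measure)
  have unit: "(\<integral>x. g x \<partial>riesz_measure) = \<Lambda> g" if g: "bounded_lipschitz g" "\<And>x. 0 \<le> g x" "\<And>x. g x \<le> 1" for g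
  proof (rule antisym)
    show "(\<integral>x. g x \<partial>riesz_measure) \<le> \<Lambda> g" by (rule integral_riesz_measure_le[OF g])
    have L: "bounded_lipschitz (\<lambda>x. 1 - g x)" by (intro bounded_lipschitz_diff bounded_lipschitz_const g)
    have "(\<integral>x. 1 - g x \<partial>riesz_measure) \<le> \<Lambda> (\<lambda>x. 1 - g x)" using g by (intro integral_riesz_measure_le L) auto
    then show "\<Lambda> g \<le> (\<integral>x. g x \<partial>riesz_measure)"
      using bounded_lipschitz_integrable[OF g(1)] prob_space by (simp add: diff bounded_lipschitz_const g const)
  qed
  obtain L B where B: "B \<ge> 0" "\<And>x. \<bar>f x\<bar> \<le> B" using bounded_lipschitz_obtain[OF f] by metis
  define M where "M = 2 * B + 1"
  have M: "M > 0" using B by (simp add: M_def)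
  define g where "g = (\<lambda>x. (1/M) * (f x + B))"
  have gL: "bounded_lipschitz g" unfolding g_def
    by (intro bounded_lipschitz_mult bounded_lipschitz_add bounded_lipschitz_const f)
  have "0 \<le> g x" "g x \<le> 1" for x
    using B(2)[of x] M by (auto simp: g_def abs_le_iff M_def)
  then have "(\<integral>x. g x \<partial>riesz_measure) = \<Lambda> g" by (intro unit gL)
  moreover have "\<Lambda> g = (1/M) * (\<Lambda> f + B)" unfolding g_def
    by (simp only: scale bounded_lipschitz_add f bounded_lipschitz_const add const)
  moreover have "(\<integral>x. g x \<partial>riesz_measure) = (1/M) * ((\<integral>x. f x \<partial>riesz_measure) + B)"
    unfolding g_def using bounded_lipschitz_integrable[OF f] prob_space by simp
  ultimately show ?thesis using M by simp
qed

end

section \<open>The Markov chain\<close>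

text \<open>Second countability: every point outside the support lies in a null set from the
  countable basis, and countably many null sets have a null union.\<close>

lemma AE_measure_support:
  fixes M :: "'a::second_countable_topology measure"
  assumes "sets M = sets borel"
  shows "AE x in M. x \<in> measure_support M"
proof -
  obtain B :: "'a set set" where B: "countable B" "topological_basis B"
    using ex_countable_basis by blast
  define N where "N = (\<Union>U\<in>{U\<in>B. emeasure M U = 0}. U)"
  have "N \<in> null_sets M" unfolding N_def
  proof (rule null_sets_UN')
    show "countable {U \<in> B. emeasure M U = 0}" using B(1) by simp
    fix U assume "U \<in> {U \<in> B. emeasure M U = 0}"
    then show "U \<in> null_sets M" using assms topological_basis_open[OF B(2)] by (auto simp: null_sets_def)
  qed
  moreover have "x \<in> measure_support M" if "x \<notin> N" for x
    unfolding measure_support_def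
  proof (intro CollectI allI impI)
    fix U assume U: "open U \<and> x \<in> U"
    then obtain V where V: "V \<in> B" "x \<in> V" "V \<subseteq> U" using topological_basisE[OF B(2)] by metis
    have "emeasure M V \<noteq> 0" using V that by (auto simp: N_def)
    moreover have "emeasure M V \<le> emeasure M U" using V U assms by (intro emeasure_mono) auto
    ultimately show "emeasure M U > 0" by (metis le_zero_eq not_gr_zero)
  qed
  ultimately show ?thesis by (intro AE_I'[of N]) auto
qed

text \<open>The indicator of a closed set is the pointwise limit of the bounded Lipschitz functions
  \<open>1 - dist_cutoff C n x\<close>, and closed sets form an intersection-stable
  generator.\<close>

lemma finite_measure_eq_bounded_lipschitz:
  fixes M N :: "'a::metric_space measure"
  assumes M: "finite_measure M" "sets M = sets borel" and N: "finite_measure N" "sets N = sets borel"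
    and eq: "\<And>f. bounded_lipschitz f \<Longrightarrow> (\<integral>x. f x \<partial>M) = (\<integral>x. f x \<partial>N)"
  shows "M = N"
proof (rule measure_eqI_generator_eq[where E = "Collect closed" and \<Omega> = UNIV and A = "\<lambda>_. UNIV"])
  interpret M: finite_measure M by fact
  interpret N: finite_measure N by fact
  show "Int_stable (Collect closed :: 'a set set)" by (auto simp: Int_stable_def)
  show "sets M = sigma_sets UNIV (Collect closed)" "sets N = sigma_sets UNIV (Collect closed)"
    using M(2) N(2) by (simp_all add: borel_eq_closed)
  have conv: "(\<lambda>n. \<integral>x. 1 - dist_cutoff C n x \<partial>L) \<longlonglongrightarrow> measure L C"
    if L: "finite_measure L" "sets L = sets borel" and C: "closed C" "C \<noteq> {}" for L and C :: "'a set"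
  proof -
    interpret L: finite_measure L by fact
    have CL: "C \<in> sets L" using C L by simp
    have "(\<lambda>n. \<integral>x. 1 - dist_cutoff C n x \<partial>L) \<longlonglongrightarrow> (\<integral>x. indicator C x \<partial>L)"
    proof (rule integral_dominated_convergence[where w = "\<lambda>_. 1"])
      show "AE x in L. (\<lambda>n. 1 - dist_cutoff C n x) \<longlonglongrightarrow> indicator C x"
      proof (intro AE_I2)
        fix x
        show "(\<lambda>n. 1 - dist_cutoff C n x) \<longlonglongrightarrow> indicator C x"
        proof (cases "x \<in> C")
          case False
          have "\<forall>\<^sub>F n in sequentially. 1 - dist_cutoff C n x = indicator C x"
            using dist_cutoff_tendsto[OF C False] by eventually_elim (use False in simp)
          then show ?thesis by (rule tendsto_eventually)
        qed (simp add: dist_cutoff_zero)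
      qed
      show "(\<lambda>x. 1 - dist_cutoff C n x) \<in> borel_measurable L" for n
        using borel_measurable_continuous_onI[OF bounded_lipschitz_continuous[OF
          bounded_lipschitz_diff[OF bounded_lipschitz_const dist_cutoff_lipschitz]]] L
        by (simp add: measurable_cong_sets[OF L(2) refl])
      show "AE x in L. norm (1 - dist_cutoff C n x) \<le> 1" for n
      proof (intro AE_I2)
        fix x show "norm (1 - dist_cutoff C n x) \<le> 1"
          using dist_cutoff_bounds[of C n x] by simp
      qed
    qed (use CL in auto)
    then show ?thesis using CL by simp
  qed
  fix C :: "'a set" assume "C \<in> Collect closed"
  then have C: "closed C" by simp
  show "emeasure M C = emeasure N C"
  proof (cases "C = {}")
    case False
    have "(\<integral>x. 1 - dist_cutoff C n x \<partial>M) = (\<integral>x. 1 - dist_cutoff C n x \<partial>N)" for n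
      by (intro eq bounded_lipschitz_diff bounded_lipschitz_const dist_cutoff_lipschitz)
    then have "measure M C = measure N C"
      using LIMSEQ_unique[OF conv[OF M C False]] conv[OF N C False] by simp
    then show ?thesis by (simp add: M.emeasure_eq_measure N.emeasure_eq_measure)
  qed simp
qed (use M in \<open>auto simp: finite_measure.emeasure_finite\<close>)

text \<open>Passage from measures on the whole type that are carried by \<open>X\<close> to measures
  whose space is \<open>X\<close>, the form used by \<open>borel_probs\<close>.\<close>

lemma borel_probs_restrict:
  assumes M: "prob_space M" "sets M = sets borel" and X: "X \<in> sets borel" "emeasure M (- X) = 0"
  shows "restrict_space M X \<in> borel_probs X"
    and "(f :: _ \<Rightarrow> real) \<in> borel_measurable borel \<Longrightarrow> (\<integral>x. f x \<partial>restrict_space M X) = (\<integral>x. f x \<partial>M)"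
    and "\<Gamma> \<in> sets (restrict_space borel X) \<Longrightarrow> emeasure (restrict_space M X) \<Gamma> = emeasure M \<Gamma>"
proof -
  interpret M: prob_space M by (rule M)
  have sp: "space M = UNIV" using sets_eq_imp_space_eq[OF M(2)] by simp
  have XM: "X \<in> sets M" "- X \<in> sets M" using X M by auto
  have ae: "AE x in M. x \<in> X"
    using X(2) XM by (intro AE_I'[of "- X"]) (auto simp: null_sets_def)
  have "emeasure M X = 1"
    using M.emeasure_eq_1_AE[OF XM(1) ae] .
  then have "prob_space (restrict_space M X)"
    using XM sp by (intro prob_spaceI) (simp add: emeasure_restrict_space space_restrict_space)
  moreover have "sets (restrict_space M X) = sets (restrict_space borel X)"
    using M(2) by (rule sets_restrict_space_cong)
  ultimately show "restrict_space M X \<in> borel_probs X" by (simp add: borel_probs_def)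
  show "emeasure (restrict_space M X) \<Gamma> = emeasure M \<Gamma>" if "\<Gamma> \<in> sets (restrict_space borel X)"
    using that XM sp by (subst emeasure_restrict_space) (auto simp: sets_restrict_space)
  show "(\<integral>x. f x \<partial>restrict_space M X) = (\<integral>x. f x \<partial>M)" if f: "f \<in> borel_measurable borel" for f :: "_ \<Rightarrow> real"
  proof -
    have "(\<integral>x. f x \<partial>restrict_space M X) = (\<integral>x. indicator X x *\<^sub>R f x \<partial>M)"
      using XM sp by (subst integral_restrict_space) auto
    also have "\<dots> = (\<integral>x. f x \<partial>M)"
    proof (rule integral_cong_AE)
      show "AE x in M. indicator X x *\<^sub>R f x = f x" using ae by eventually_elim simp
      show "(\<lambda>x. indicator X x *\<^sub>R f x) \<in> borel_measurable M"
        using f X(1) unfolding measurable_cong_sets[OF M(2) refl]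
        by (intro borel_measurable_scaleR borel_measurable_indicator) auto
      show "f \<in> borel_measurable M" using f unfolding measurable_cong_sets[OF M(2) refl] .
    qed
    finally show ?thesis .
  qed
qed

lemma borel_probs_facts:
  assumes "\<nu> \<in> borel_probs X"
  shows borel_probs_prob: "prob_space \<nu>" and borel_probs_sets: "sets \<nu> = sets (restrict_space borel X)"
    and borel_probs_space: "space \<nu> = X" and borel_probs_id: "(\<lambda>x. x) \<in> measurable \<nu> borel"
proof -
  show "prob_space \<nu>" and s: "sets \<nu> = sets (restrict_space borel X)" using assms by (auto simp: borel_probs_def)
  show "space \<nu> = X" using sets_eq_imp_space_eq[OF s] by (simp add: space_restrict_space)
  have "(\<lambda>x. x) \<in> measurable (restrict_space borel X) borel" by (rule measurable_restrict_space1) simp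
  then show "(\<lambda>x. x) \<in> measurable \<nu> borel" by (simp add: measurable_cong_sets[OF s refl])
qed

lemma borel_probs_eqI:
  fixes X :: "'a::metric_space set"
  assumes \<nu>: "\<nu>1 \<in> borel_probs X" "\<nu>2 \<in> borel_probs X" and X: "X \<in> sets borel"
    and eq: "\<And>f. bounded_lipschitz f \<Longrightarrow> (\<integral>x. f x \<partial>\<nu>1) = (\<integral>x. f x \<partial>\<nu>2)"
  shows "\<nu>1 = \<nu>2"
proof -
  let ?D = "\<lambda>\<nu>. distr \<nu> borel (\<lambda>x. x)"
  have ps: "prob_space (?D \<nu>1)" "prob_space (?D \<nu>2)"
    using prob_space.prob_space_distr[OF borel_probs_prob borel_probs_id] \<nu> by blast+
  have D: "?D \<nu>1 = ?D \<nu>2"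
  proof (rule finite_measure_eq_bounded_lipschitz)
    fix f :: "'a \<Rightarrow> real" assume f: "bounded_lipschitz f"
    have "f \<in> borel_measurable borel" using bounded_lipschitz_continuous[OF f] by (rule borel_measurable_continuous_onI)
    then show "(\<integral>x. f x \<partial>?D \<nu>1) = (\<integral>x. f x \<partial>?D \<nu>2)"
      using eq[OF f] \<nu> by (simp add: integral_distr borel_probs_id)
  qed (use ps in \<open>auto simp: prob_space_def\<close>)
  show ?thesis
  proof (rule measure_eqI)
    show "sets \<nu>1 = sets \<nu>2" using \<nu> by (simp add: borel_probs_sets)
    fix A assume A: "A \<in> sets \<nu>1"
    then have AX: "A \<in> sets borel" "A \<subseteq> X"
      using X \<nu> by (auto simp: borel_probs_sets sets_restrict_space)
    have "emeasure (?D \<nu>) A = emeasure \<nu> A" if "\<nu> \<in> borel_probs X" for \<nu>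
      using AX that by (subst emeasure_distr) (auto simp: borel_probs_id borel_probs_space Int_absorb2)
    then show "emeasure \<nu>1 A = emeasure \<nu>2 A" using D \<nu> by metis
  qed
qed

text \<open>The quotients in \<open>L_norm\<close> only see pairs at distance at most 1. For other
  pairs the bound on the values gives a difference of at most 2, whence the factor 2.\<close>

lemma L_norm_le_1:
  assumes "L_norm X f \<le> 1"
  shows "x \<in> X \<Longrightarrow> \<bar>f x\<bar> \<le> 1" and "x \<in> X \<Longrightarrow> y \<in> X \<Longrightarrow> \<bar>f x - f y\<bar> \<le> 2 * dist x y"
proof -
  have 1: "\<bar>f x\<bar> \<le> 1" if "x \<in> X" for x
  proof -
    have "ennreal \<bar>f x\<bar> \<le> (SUP z\<in>X. ennreal \<bar>f z\<bar>)" by (rule SUP_upper[OF that])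
    also have "\<dots> \<le> L_norm X f" by (simp add: L_norm_def)
    finally have "ennreal \<bar>f x\<bar> \<le> 1" using assms by (rule order_trans)
    then show ?thesis by simp
  qed
  then show "x \<in> X \<Longrightarrow> \<bar>f x\<bar> \<le> 1" .
  show "\<bar>f x - f y\<bar> \<le> 2 * dist x y" if xy: "x \<in> X" "y \<in> X"
  proof (cases "0 < dist x y \<and> dist x y \<le> 1")
    case True
    have "ennreal (\<bar>f x - f y\<bar> / dist x y) \<le> (SUP (z1, z2)\<in>{(z1, z2). z1 \<in> X \<and> z2 \<in> X \<and> 0 < dist z1 z2 \<and> dist z1 z2 \<le> 1}.
        ennreal (\<bar>f z1 - f z2\<bar> / dist z1 z2))"
      by (rule SUP_upper2[of "(x, y)"]) (use xy True in auto)
    also have "\<dots> \<le> L_norm X f" by (simp add: L_norm_def)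
    finally have "ennreal (\<bar>f x - f y\<bar> / dist x y) \<le> 1" using assms by (rule order_trans)
    then have "\<bar>f x - f y\<bar> / dist x y \<le> 1" by simp
    then have "\<bar>f x - f y\<bar> \<le> 1 * dist x y" using True by (simp add: pos_divide_le_eq)
    then show ?thesis by simp
  next
    case False
    then show ?thesis using 1[OF xy(1)] 1[OF xy(2)] by (cases "x = y") auto
  qed
qed

section \<open>The chain driven by the noise sequence\<close>

locale noise_driven_chain = mixing_noisy_map S \<l> K X
  for S :: "'x::{metric_space, second_countable_topology} \<times> 'e::{real_normed_vector, second_countable_topology} \<Rightarrow> 'x"
    and \<l> K X +
  fixes P :: "'w measure" and \<eta> :: "nat \<Rightarrow> 'w \<Rightarrow> 'e"
  assumes P: "prob_space P" and indep: "prob_space.indep_vars P (\<lambda>_. borel) \<eta> {1..}"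
    and law: "\<And>n. n \<ge> 1 \<Longrightarrow> distr P borel (\<eta> n) = \<l>"
begin

sublocale P: prob_space P by (rule P)

lemma eta_measurable: "n \<ge> 1 \<Longrightarrow> \<eta> n \<in> borel_measurable P"
  using indep unfolding P.indep_vars_def2 by auto

lemma S_measurable: "S \<in> measurable (borel \<Otimes>\<^sub>M borel) borel"
  using borel_measurable_continuous_onI[OF S_continuous] by (simp add: borel_prod)

lemma traj_measurable:
  assumes "z \<in> borel_measurable M" "\<And>k. k \<in> {1..n} \<Longrightarrow> e k \<in> borel_measurable M"
  shows "(\<lambda>\<omega>. traj S (z \<omega>) (\<lambda>k. e k \<omega>) n) \<in> borel_measurable M"
  using assms(2)
proof (induction n)
  case (Suc n)
  have "(\<lambda>\<omega>. (traj S (z \<omega>) (\<lambda>k. e k \<omega>) n, e (Suc n) \<omega>)) \<in> measurable M (borel \<Otimes>\<^sub>M borel)"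
    using Suc by (intro measurable_Pair) auto
  from measurable_compose[OF this S_measurable] show ?case by simp
qed (use assms in simp)

lemma traj_cong: "(\<And>k. k \<in> {1..n} \<Longrightarrow> \<zeta> k = \<zeta>' k) \<Longrightarrow> traj S z \<zeta> n = traj S z \<zeta>' n"
  by (induction n) auto

lemma traj_in_X: "z \<in> X \<Longrightarrow> (\<And>k. k \<ge> 1 \<Longrightarrow> \<zeta> k \<in> K) \<Longrightarrow> traj S z \<zeta> n \<in> X"
proof (induction n)
  case (Suc n)
  then have "(traj S z \<zeta> n, \<zeta> (Suc n)) \<in> X \<times> K" by simp
  then show ?case using X_inv by auto
qed simp

lemma AE_eta: "AE \<omega> in P. \<forall>k\<ge>1. \<eta> k \<omega> \<in> K"
proof -
  have "AE \<omega> in P. \<eta> k \<omega> \<in> K" if "k \<ge> 1" for k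
    using AE_K unfolding law[OF that, symmetric]
    by (subst (asm) AE_distr_iff) (use eta_measurable that K_compact in \<open>auto simp: compact_imp_closed\<close>)
  then show ?thesis by (subst AE_all_countable) auto
qed

text \<open>The last noise variable is independent of the earlier ones; integrating over it first
  replaces \<open>f\<close> by \<open>Q f\<close>. The induction therefore runs over all
  \<open>f\<close> at once.\<close>

lemma expectation_traj:
  assumes "Cb f"
  shows "(\<integral>\<omega>. f (traj S z (\<lambda>k. \<eta> k \<omega>) n) \<partial>P) = (Q ^^ n) f z"
  using assms
proof (induction n arbitrary: f)
  case 0
  then show ?case using P.prob_space by simp
next
  case (Suc n)
  let ?A = "{1..n}" and ?B = "{Suc n}"
  let ?MA = "Pi\<^sub>M ?A (\<lambda>_. borel :: 'e measure)" and ?MB = "Pi\<^sub>M ?B (\<lambda>_. borel :: 'e measure)"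
  let ?rA = "\<lambda>\<omega>. restrict (\<lambda>i. \<eta> i \<omega>) ?A" and ?rB = "\<lambda>\<omega>. restrict (\<lambda>i. \<eta> i \<omega>) ?B"
  have iv: "P.indep_var ?MA ?rA ?MB ?rB"
    by (rule P.indep_var_restrict[OF indep]) auto
  have mA: "?rA \<in> measurable P ?MA" and mB: "?rB \<in> measurable P ?MB"
    using iv by (auto dest: P.indep_var_rv1 P.indep_var_rv2)
  have joint: "distr P ?MA ?rA \<Otimes>\<^sub>M distr P ?MB ?rB = distr P (?MA \<Otimes>\<^sub>M ?MB) (\<lambda>\<omega>. (?rA \<omega>, ?rB \<omega>))"
    using iv unfolding P.indep_var_distribution_eq by blast
  interpret DA: prob_space "distr P ?MA ?rA" by (rule P.prob_space_distr[OF mA])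
  interpret DB: prob_space "distr P ?MB ?rB" by (rule P.prob_space_distr[OF mB])
  interpret pp: pair_prob_space "distr P ?MA ?rA" "distr P ?MB ?rB" ..
  obtain B where B: "\<And>x. \<bar>f x\<bar> \<le> B" using Suc.prems by (auto simp: Cb_def)
  have fm: "f \<in> borel_measurable borel" using Suc.prems by (auto simp: Cb_def intro: borel_measurable_continuous_onI)
  have tA: "(\<lambda>p. traj S z p n) \<in> borel_measurable ?MA"
    using traj_measurable[of "\<lambda>_. z" ?MA n "\<lambda>k p. p k"] by auto
  let ?h = "\<lambda>(p, q). f (S (traj S z p n, q (Suc n)))"
  have hm: "?h \<in> borel_measurable (?MA \<Otimes>\<^sub>M ?MB)"
  proof -
    have "(\<lambda>r. (traj S z (fst r) n, snd r (Suc n))) \<in> measurable (?MA \<Otimes>\<^sub>M ?MB) (borel \<Otimes>\<^sub>M borel)"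
      by (intro measurable_Pair measurable_compose[OF measurable_fst tA]
          measurable_compose[OF measurable_snd measurable_component_singleton]) auto
    from measurable_compose[OF measurable_compose[OF this S_measurable] fm]
    show ?thesis by (simp add: case_prod_beta)
  qed
  have eq: "f (traj S z (\<lambda>k. \<eta> k \<omega>) (Suc n)) = ?h (?rA \<omega>, ?rB \<omega>)" for \<omega>
  proof -
    have "traj S z (\<lambda>k. \<eta> k \<omega>) n = traj S z (?rA \<omega>) n" by (rule traj_cong) simp
    then show ?thesis by simp
  qed
  have CQ: "Cb (Q f)" using Suc.prems by (rule Cb_Q)
  have Qm: "Q f \<in> borel_measurable borel" using CQ by (auto simp: Cb_def intro: borel_measurable_continuous_onI)
  have inner: "(\<integral>q. ?h (p, q) \<partial>distr P ?MB ?rB) = Q f (traj S z p n)" for p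
  proof -
    have fS: "(\<lambda>e. f (S (traj S z p n, e))) \<in> borel_measurable borel" by (rule Cb_measurable[OF Suc.prems])
    have "(\<integral>q. ?h (p, q) \<partial>distr P ?MB ?rB) = (\<integral>\<omega>. f (S (traj S z p n, \<eta> (Suc n) \<omega>)) \<partial>P)"
      using mB measurable_compose[OF measurable_component_singleton[of "Suc n" ?B "\<lambda>_. borel"] fS]
      by (subst integral_distr) auto
    also have "\<dots> = (\<integral>e. f (S (traj S z p n, e)) \<partial>distr P borel (\<eta> (Suc n)))"
      using eta_measurable fS by (subst integral_distr) auto
    also have "\<dots> = Q f (traj S z p n)" using law[of "Suc n"] by (simp add: Q_def)
    finally show ?thesis .
  qed
  have "(\<integral>\<omega>. f (traj S z (\<lambda>k. \<eta> k \<omega>) (Suc n)) \<partial>P) = (\<integral>r. ?h r \<partial>distr P (?MA \<Otimes>\<^sub>M ?MB) (\<lambda>\<omega>. (?rA \<omega>, ?rB \<omega>)))"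
    unfolding eq using mA mB hm by (subst integral_distr) auto
  also have "\<dots> = (\<integral>p. (\<integral>q. ?h (p, q) \<partial>distr P ?MB ?rB) \<partial>distr P ?MA ?rA)"
    unfolding joint[symmetric]
  proof (rule pp.integral_fst'[symmetric])
    show "integrable (distr P ?MA ?rA \<Otimes>\<^sub>M distr P ?MB ?rB) ?h"
    proof (rule pp.P.integrable_const_bound[of _ B])
      show "?h \<in> borel_measurable (distr P ?MA ?rA \<Otimes>\<^sub>M distr P ?MB ?rB)"
        using hm by (simp cong: measurable_cong_sets sets_pair_measure_cong)
    qed (use B in auto)
  qed
  also have "\<dots> = (\<integral>p. Q f (traj S z p n) \<partial>distr P ?MA ?rA)" unfolding inner ..
  also have "\<dots> = (\<integral>\<omega>. Q f (traj S z (?rA \<omega>) n) \<partial>P)"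
    using mA measurable_compose[OF tA Qm] by (subst integral_distr) auto
  also have "\<dots> = (\<integral>\<omega>. Q f (traj S z (\<lambda>k. \<eta> k \<omega>) n) \<partial>P)"
    by (intro Bochner_Integration.integral_cong refl arg_cong[where f = "Q f"] traj_cong) simp
  also have "\<dots> = (Q ^^ n) (Q f) z" by (rule Suc.IH[OF CQ])
  also have "\<dots> = (Q ^^ Suc n) f z" by (simp add: funpow_swap1)
  finally show ?case .
qed

lemma X_borel: "X \<in> sets borel"
  using compact_imp_closed[OF X_compact] by simp

text \<open>\<open>dual_semigroup\<close> is a \<open>measure_of\<close> whose set function is not
  known to be countably additive beforehand. It is identified with the image \<open>D\<close> of the
  product of \<open>\<nu>\<close> and \<open>P\<close> under the trajectory map, restricted to
  \<open>X\<close>.\<close>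

lemma dual_semigroup_facts:
  assumes \<nu>: "\<nu> \<in> borel_probs X"
  shows dual_semigroup_borel_probs: "dual_semigroup P \<eta> S X n \<nu> \<in> borel_probs X"
    and integral_dual_semigroup: "Cb f \<Longrightarrow> (\<integral>x. f x \<partial>dual_semigroup P \<eta> S X n \<nu>) = (\<integral>x. (Q ^^ n) f x \<partial>\<nu>)"
proof -
  interpret N: prob_space \<nu> using \<nu> by (rule borel_probs_prob)
  interpret pp: pair_prob_space \<nu> P ..
  note sp = borel_probs_space[OF \<nu>] and id = borel_probs_id[OF \<nu>]
  let ?T = "\<lambda>p. traj S (fst p) (\<lambda>k. \<eta> k (snd p)) n"
  have Tm: "?T \<in> borel_measurable (\<nu> \<Otimes>\<^sub>M P)"
    by (intro traj_measurable measurable_compose[OF measurable_fst id] measurable_compose[OF measurable_snd eta_measurable]) auto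
  define D where "D = distr (\<nu> \<Otimes>\<^sub>M P) borel ?T"
  have D: "prob_space D" "sets D = sets borel"
    unfolding D_def using pp.P.prob_space_distr[OF Tm] by auto
  have em: "emeasure D \<Gamma> = (\<integral>\<^sup>+ z. transition P \<eta> S n z \<Gamma> \<partial>\<nu>)" if \<Gamma>: "\<Gamma> \<in> sets borel" for \<Gamma>
  proof -
    have "emeasure D \<Gamma> = emeasure (\<nu> \<Otimes>\<^sub>M P) (?T -` \<Gamma> \<inter> space (\<nu> \<Otimes>\<^sub>M P))"
      unfolding D_def using Tm \<Gamma> by (rule emeasure_distr)
    also have "\<dots> = (\<integral>\<^sup>+ z. emeasure P (Pair z -` (?T -` \<Gamma> \<inter> space (\<nu> \<Otimes>\<^sub>M P))) \<partial>\<nu>)"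
      by (rule P.emeasure_pair_measure_alt) (rule measurable_sets[OF Tm \<Gamma>])
    also have "\<dots> = (\<integral>\<^sup>+ z. transition P \<eta> S n z \<Gamma> \<partial>\<nu>)"
      unfolding transition_def
      by (intro nn_integral_cong arg_cong[where f = "emeasure P"]) (auto simp: space_pair_measure)
    finally show ?thesis .
  qed
  \<comment> \<open>Almost surely all noise values lie in \<open>K\<close> simultaneously, so the
    chain started in \<open>X\<close> does not leave it.\<close>
  have "AE p in \<nu> \<Otimes>\<^sub>M P. ?T p \<in> X"
  proof -
    have "AE z in \<nu>. AE \<omega> in P. ?T (z, \<omega>) \<in> X"
    proof (rule AE_I2)
      fix z assume "z \<in> space \<nu>"
      then have z: "z \<in> X" by (simp add: sp)
      show "AE \<omega> in P. ?T (z, \<omega>) \<in> X" using AE_eta by eventually_elim (auto intro!: traj_in_X z)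
    qed
    moreover have "{p \<in> space (\<nu> \<Otimes>\<^sub>M P). ?T p \<in> X} \<in> sets (\<nu> \<Otimes>\<^sub>M P)"
      using measurable_sets[OF Tm X_borel] by (simp add: vimage_def Int_def conj_commute)
    ultimately show ?thesis by (intro pp.AE_pair_measure)
  qed
  then have "AE x in D. x \<in> X" unfolding D_def using Tm X_borel by (subst AE_distr_iff) auto
  then have DX: "emeasure D (- X) = 0"
    using AE_iff_null_sets[of "- X" D] X_borel D(2) by (auto simp: null_sets_def)
  note R = borel_probs_restrict[OF D X_borel DX]
  have "dual_semigroup P \<eta> S X n \<nu> = restrict_space D X"
  proof -
    have sR: "sets (restrict_space D X) = sets (restrict_space borel X)" using D(2) by (rule sets_restrict_space_cong)
    have spR: "space (restrict_space D X) = X" using sets_eq_imp_space_eq[OF sR] by (simp add: space_restrict_space)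
    have "restrict_space D X = measure_of X (sets (restrict_space borel X)) (emeasure (restrict_space D X))"
      using measure_of_of_measure[of "restrict_space D X"] by (simp add: sR spR)
    also have "\<dots> = dual_semigroup P \<eta> S X n \<nu>" unfolding dual_semigroup_def
    proof (rule measure_of_eq)
      show "sets (restrict_space borel X) \<subseteq> Pow X" by (auto simp: sets_restrict_space)
      fix \<Gamma> assume "\<Gamma> \<in> sigma_sets X (sets (restrict_space borel X))"
      then have \<Gamma>: "\<Gamma> \<in> sets (restrict_space borel X)"
        using sets.sigma_sets_eq[of "restrict_space borel X"] by (simp add: space_restrict_space)
      then have "\<Gamma> \<in> sets borel" using X_borel by (auto simp: sets_restrict_space)
      then show "emeasure (restrict_space D X) \<Gamma> = (\<integral>\<^sup>+ z. transition P \<eta> S n z \<Gamma> \<partial>\<nu>)"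
        using R(3)[OF \<Gamma>] em by simp
    qed
    finally show ?thesis by simp
  qed
  note dual = this
  show "dual_semigroup P \<eta> S X n \<nu> \<in> borel_probs X" unfolding dual by (rule R(1))
  assume f: "Cb f"
  obtain B where B: "\<And>x. \<bar>f x\<bar> \<le> B" using f by (auto simp: Cb_def)
  have fm: "f \<in> borel_measurable borel" using f by (auto simp: Cb_def intro: borel_measurable_continuous_onI)
  have "(\<integral>x. f x \<partial>dual_semigroup P \<eta> S X n \<nu>) = (\<integral>x. f x \<partial>D)" unfolding dual by (rule R(2)[OF fm])
  also have "\<dots> = (\<integral>p. f (?T p) \<partial>(\<nu> \<Otimes>\<^sub>M P))" unfolding D_def using Tm fm by (rule integral_distr)
  also have "\<dots> = (\<integral>z. (\<integral>\<omega>. f (?T (z, \<omega>)) \<partial>P) \<partial>\<nu>)"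
  proof (rule pp.integral_fst'[symmetric])
    show "integrable (\<nu> \<Otimes>\<^sub>M P) (\<lambda>p. f (?T p))"
      using measurable_compose[OF Tm fm] B by (intro pp.P.integrable_const_bound[of _ B]) auto
  qed
  also have "\<dots> = (\<integral>x. (Q ^^ n) f x \<partial>\<nu>)" using expectation_traj[OF f] by simp
  finally show "(\<integral>x. f x \<partial>dual_semigroup P \<eta> S X n \<nu>) = (\<integral>x. (Q ^^ n) f x \<partial>\<nu>)" .
qed

lemma Cb_bounded_lipschitz: "bounded_lipschitz f \<Longrightarrow> Cb f"
  using bounded_lipschitz_continuous by (auto simp: Cb_def bounded_lipschitz_def)

lemma Q_add: "Cb f \<Longrightarrow> Cb g \<Longrightarrow> Q (\<lambda>x. f x + g x) = (\<lambda>x. Q f x + Q g x)"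
  unfolding Q_def using Cb_integrable by (simp add: fun_eq_iff)

lemma Qn_add:
  assumes "Cb f" "Cb g" shows "(Q ^^ n) (\<lambda>x. f x + g x) = (\<lambda>x. (Q ^^ n) f x + (Q ^^ n) g x)"
proof (induction n)
  case (Suc n)
  then show ?case using Q_add[OF Cb_Qn[OF assms(1)] Cb_Qn[OF assms(2)]] by simp
qed simp

text \<open>The base point is arbitrary; once oscillations on \<open>X\<close> decay, the limit is
  the same from every point of \<open>X\<close>.\<close>

definition limit_functional :: "('x \<Rightarrow> real) \<Rightarrow> real" where
  "limit_functional f = lim (\<lambda>n. (Q ^^ n) f (SOME z. z \<in> X))"

text \<open>The value of \<open>Q ^^ (k + n)\<close> applied to \<open>f\<close> at a point of
  \<open>X\<close> lies between the bounds of \<open>(Q ^^ n) f\<close> on \<open>X\<close>. The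
  oscillation of the latter thus controls all later values, which gives the Cauchy property and the
  rate together.\<close>

lemma limit_functional_rate:
  assumes f: "Cb f" and M: "M \<ge> 0" and \<gamma>: "\<gamma> > 0"
    and osc: "\<And>n z z'. z \<in> X \<Longrightarrow> z' \<in> X \<Longrightarrow> \<bar>(Q ^^ n) f z - (Q ^^ n) f z'\<bar> \<le> M * exp (- \<gamma> * real n)"
  shows "(\<lambda>n. (Q ^^ n) f (SOME z. z \<in> X)) \<longlonglongrightarrow> limit_functional f"
    and "z \<in> X \<Longrightarrow> \<bar>(Q ^^ n) f z - limit_functional f\<bar> \<le> M * exp (- \<gamma> * real n)"
proof -
  define z0 where "z0 = (SOME z. z \<in> X)"
  have z0: "z0 \<in> X" unfolding z0_def using X_nonempty by (simp add: some_in_eq)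
  have step: "\<bar>(Q ^^ n) f z - (Q ^^ (k + n)) f z0\<bar> \<le> M * exp (- \<gamma> * real n)" if z: "z \<in> X" for n k z
  proof -
    have "(Q ^^ n) f z - M * exp (- \<gamma> * real n) \<le> (Q ^^ k) ((Q ^^ n) f) z0"
    proof (rule Qn_ge[OF Cb_Qn[OF f] _ z0])
      fix x assume "x \<in> X"
      then show "(Q ^^ n) f z - M * exp (- \<gamma> * real n) \<le> (Q ^^ n) f x" using osc[OF z, of x n] by linarith
    qed
    moreover have "(Q ^^ k) ((Q ^^ n) f) z0 \<le> (Q ^^ n) f z + M * exp (- \<gamma> * real n)"
    proof (rule Qn_le[OF Cb_Qn[OF f] _ z0])
      fix x assume "x \<in> X"
      then show "(Q ^^ n) f x \<le> (Q ^^ n) f z + M * exp (- \<gamma> * real n)" using osc[OF z, of x n] by linarith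
    qed
    ultimately show ?thesis by (simp add: funpow_add abs_le_iff)
  qed
  have e0: "(\<lambda>n. M * exp (- \<gamma> * real n)) \<longlonglongrightarrow> 0"
  proof -
    have "(\<lambda>n. exp (- \<gamma>) ^ n) \<longlonglongrightarrow> 0" using \<gamma> by (intro LIMSEQ_power_zero) simp
    moreover have "exp (- \<gamma>) ^ n = exp (- \<gamma> * real n)" for n by (simp add: exp_of_nat_mult[symmetric] mult.commute)
    ultimately have "(\<lambda>n. exp (- \<gamma> * real n)) \<longlonglongrightarrow> 0" by simp
    from tendsto_mult_right_zero[OF this, of M] show ?thesis .
  qed
  have "Cauchy (\<lambda>n. (Q ^^ n) f z0)"
  proof (rule metric_CauchyI)
    fix e :: real assume e: "e > 0"
    then obtain N where N: "M * exp (- \<gamma> * real N) < e/2"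
      using order_tendstoD(2)[OF e0, of "e/2"] by (auto simp: eventually_sequentially)
    have "dist ((Q ^^ n) f z0) ((Q ^^ n') f z0) < e" if n: "n \<ge> N" "n' \<ge> N" for n n'
    proof -
      have "\<bar>(Q ^^ N) f z0 - (Q ^^ j) f z0\<bar> < e/2" if "j \<ge> N" for j
        using step[OF z0, of N "j - N"] N that by simp
      from this[OF n(1)] this[OF n(2)] show ?thesis unfolding dist_real_def by linarith
    qed
    then show "\<exists>N. \<forall>m\<ge>N. \<forall>n\<ge>N. dist ((Q ^^ m) f z0) ((Q ^^ n) f z0) < e" by blast
  qed
  then have "convergent (\<lambda>n. (Q ^^ n) f z0)" by (rule Cauchy_convergent)
  then show lim: "(\<lambda>n. (Q ^^ n) f (SOME z. z \<in> X)) \<longlonglongrightarrow> limit_functional f"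
    unfolding limit_functional_def z0_def[symmetric] by (simp add: convergent_LIMSEQ_iff)
  show "\<bar>(Q ^^ n) f z - limit_functional f\<bar> \<le> M * exp (- \<gamma> * real n)" if z: "z \<in> X"
  proof -
    have "(\<lambda>k. (Q ^^ (k + n)) f z0) \<longlonglongrightarrow> limit_functional f"
      using lim unfolding z0_def[symmetric] by (rule LIMSEQ_ignore_initial_segment)
    then have "(\<lambda>k. \<bar>(Q ^^ n) f z - (Q ^^ (k + n)) f z0\<bar>) \<longlonglongrightarrow> \<bar>(Q ^^ n) f z - limit_functional f\<bar>"
      by (intro tendsto_intros)
    then show ?thesis using step[OF z] by (intro LIMSEQ_le_const2) auto
  qed
qed

lemma exponential_mixing:
  "\<exists>\<mu>. \<mu> \<in> borel_probs X \<and> stationary P \<eta> S X \<mu> \<and>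
           (\<forall>\<nu>\<in>borel_probs X. stationary P \<eta> S X \<nu> \<longrightarrow> \<nu> = \<mu>) \<and>
           (\<exists>C>0. \<exists>\<gamma>>0. \<forall>n. \<forall>\<nu>\<in>borel_probs X.
              dual_lipschitz X (dual_semigroup P \<eta> S X n \<nu>) \<mu> \<le> C * exp (- \<gamma> * real n))"
proof -
  obtain C \<gamma> where C: "C > 0" "\<gamma> > 0" and dec: "\<And>f n z z'. Cb f \<Longrightarrow>
      (\<forall>x\<in>X. \<forall>y\<in>X. \<bar>f x - f y\<bar> \<le> min 2 (2 * dist x y)) \<Longrightarrow> z\<in>X \<Longrightarrow> z'\<in>X \<Longrightarrow>
      \<bar>(Q ^^ n) f z - (Q ^^ n) f z'\<bar> \<le> C * exp (- \<gamma> * real n)"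
    using osc_decay by metis
  let ?\<Lambda> = limit_functional
  have rate1: "\<exists>M\<ge>0. \<forall>n. \<forall>z\<in>X. \<forall>z'\<in>X. \<bar>(Q ^^ n) f z - (Q ^^ n) f z'\<bar> \<le> M * exp (- \<gamma> * real n)"
    if bl: "bounded_lipschitz f" for f
  proof -
    obtain L B where f: "L \<ge> 0" "B \<ge> 0" "\<And>x y. \<bar>f x - f y\<bar> \<le> L * dist x y" "\<And>x. \<bar>f x\<bar> \<le> B"
      by (rule bounded_lipschitz_obtain[OF bl]) blast
    \<comment> \<open>Dividing by \<open>M\<close> brings \<open>f\<close> within the bounds
      required by \<open>dec\<close>, at the price of a constant that depends on \<open>f\<close>.
      This is enough for existence of the limit and for uniqueness; the uniform rate is obtained
      from \<open>dec\<close> directly.\<close>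
    define M where "M = L + B + 1"
    have M: "M > 0" "L \<le> M" "B \<le> M" using f by (auto simp: M_def)
    have "\<forall>x\<in>X. \<forall>y\<in>X. \<bar>(0 + (1/M) * f x) - (0 + (1/M) * f y)\<bar> \<le> min 2 (2 * dist x y)"
    proof (intro ballI)
      fix x y
      have a: "\<bar>(0 + (1/M) * f x) - (0 + (1/M) * f y)\<bar> = \<bar>f x - f y\<bar> / M"
        using M(1) by (simp add: diff_divide_distrib[symmetric])
      have "L * dist x y \<le> M * dist x y" using M by (intro mult_right_mono) auto
      also have "\<dots> \<le> 2 * dist x y * M" using M by simp
      finally have "\<bar>f x - f y\<bar> \<le> 2 * dist x y * M" using f(3)[of x y] by linarith
      moreover have "\<bar>f x - f y\<bar> \<le> 2 * M" using f(4)[of x] f(4)[of y] M by linarith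
      ultimately show "\<bar>(0 + (1/M) * f x) - (0 + (1/M) * f y)\<bar> \<le> min 2 (2 * dist x y)"
        unfolding a using M(1) by (simp add: pos_divide_le_eq)
    qed
    from dec[OF Cb_affine[OF Cb_bounded_lipschitz[OF bl]] this]
    have *: "\<bar>(0 + (1/M) * (Q ^^ n) f z) - (0 + (1/M) * (Q ^^ n) f z')\<bar> \<le> C * exp (- \<gamma> * real n)"
      if "z \<in> X" "z' \<in> X" for n z z'
      using that unfolding Qn_affine[OF Cb_bounded_lipschitz[OF bl]] by blast
    have "\<bar>(Q ^^ n) f z - (Q ^^ n) f z'\<bar> \<le> (M * C) * exp (- \<gamma> * real n)" if "z \<in> X" "z' \<in> X" for n z z'
    proof -
      have "\<bar>(0 + (1/M) * (Q ^^ n) f z) - (0 + (1/M) * (Q ^^ n) f z')\<bar> = \<bar>(Q ^^ n) f z - (Q ^^ n) f z'\<bar> / M"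
        using M(1) by (simp add: diff_divide_distrib[symmetric])
      then show ?thesis using *[OF that, of n] M(1) by (simp add: pos_divide_le_eq mult_ac)
    qed
    then show ?thesis using M(1) C(1) by (intro exI[of _ "M * C"]) auto
  qed
  have lim: "(\<lambda>n. (Q ^^ n) f (SOME z. z \<in> X)) \<longlonglongrightarrow> ?\<Lambda> f" if bl: "bounded_lipschitz f" for f
  proof -
    obtain M where M: "M \<ge> 0" "\<And>n z z'. z\<in>X \<Longrightarrow> z'\<in>X \<Longrightarrow> \<bar>(Q ^^ n) f z - (Q ^^ n) f z'\<bar> \<le> M * exp (- \<gamma> * real n)"
      using rate1[OF bl] by metis
    show ?thesis using limit_functional_rate(1)[OF Cb_bounded_lipschitz[OF bl] M(1) C(2) M(2)] .
  qed
  have z0: "(SOME z. z \<in> X) \<in> X" using X_nonempty by (simp add: some_in_eq)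
  interpret F: lipschitz_functional X ?\<Lambda>
  proof
    show "compact X" by (rule X_compact)
    show "?\<Lambda> (\<lambda>x. f x + g x) = ?\<Lambda> f + ?\<Lambda> g" if "bounded_lipschitz f" "bounded_lipschitz g" for f g
    proof (rule LIMSEQ_unique[OF lim[OF bounded_lipschitz_add[OF that]]])
      show "(\<lambda>n. (Q ^^ n) (\<lambda>x. f x + g x) (SOME z. z \<in> X)) \<longlonglongrightarrow> ?\<Lambda> f + ?\<Lambda> g"
        unfolding Qn_add[OF that[THEN Cb_bounded_lipschitz]] by (intro tendsto_intros lim that)
    qed
    show "?\<Lambda> (\<lambda>x. c * f x) = c * ?\<Lambda> f" if f: "bounded_lipschitz f" for c f
    proof (rule LIMSEQ_unique[OF lim[OF bounded_lipschitz_mult[OF bounded_lipschitz_const f]]])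
      have "(Q ^^ n) (\<lambda>x. c * f x) = (\<lambda>x. c * (Q ^^ n) f x)" for n
        using Qn_affine[OF Cb_bounded_lipschitz[OF f], of n 0 c] by simp
      then show "(\<lambda>n. (Q ^^ n) (\<lambda>x. c * f x) (SOME z. z \<in> X)) \<longlonglongrightarrow> c * ?\<Lambda> f"
        by (simp add: tendsto_mult_left lim f)
    qed
    show "?\<Lambda> f \<le> ?\<Lambda> g" if "bounded_lipschitz f" "bounded_lipschitz g" "\<And>x. x \<in> X \<Longrightarrow> f x \<le> g x" for f g
    proof (rule LIMSEQ_le[OF lim[OF that(1)] lim[OF that(2)]])
      show "\<exists>N. \<forall>n\<ge>N. (Q ^^ n) f (SOME z. z \<in> X) \<le> (Q ^^ n) g (SOME z. z \<in> X)"
        using Qn_mono[OF that(1,2)[THEN Cb_bounded_lipschitz] that(3) z0] by blast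
    qed
    show "?\<Lambda> (\<lambda>_. 1) = 1"
    proof (rule LIMSEQ_unique[OF lim[OF bounded_lipschitz_const]])
      show "(\<lambda>n. (Q ^^ n) (\<lambda>_. 1) (SOME z. z \<in> X)) \<longlonglongrightarrow> 1" by (simp add: Qn_const)
    qed
  qed
  define \<mu> where "\<mu> = restrict_space F.riesz_measure X"
  note R = borel_probs_restrict[OF F.prob_riesz_measure F.sets_riesz_measure X_borel F.riesz_measure_X, folded \<mu>_def]
  have bm: "f \<in> borel_measurable borel" if "Cb f" for f :: "'x \<Rightarrow> real"
    using that by (auto simp: Cb_def intro: borel_measurable_continuous_onI)
  have int_mu: "(\<integral>x. f x \<partial>\<mu>) = ?\<Lambda> f" if "bounded_lipschitz f" for f
    using R(2)[OF bm[OF Cb_bounded_lipschitz[OF that]]] F.integral_riesz_measure[OF that] by simp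
  have int_X: "(\<integral>x. f x \<partial>\<nu>) = (\<integral>x. h x \<partial>\<nu>)" if "\<nu> \<in> borel_probs X" "\<And>x. x \<in> X \<Longrightarrow> f x = h x" for \<nu> and f h :: "'x \<Rightarrow> real"
    using that by (intro Bochner_Integration.integral_cong) (auto simp: borel_probs_space)
  have nu_rate: "\<bar>(\<integral>x. (Q ^^ n) f x \<partial>\<nu>) - ?\<Lambda> f\<bar> \<le> M * exp (- \<gamma> * real n)"
    if \<nu>: "\<nu> \<in> borel_probs X" and f: "Cb f" and M: "M \<ge> 0"
      and osc: "\<And>n z z'. z \<in> X \<Longrightarrow> z' \<in> X \<Longrightarrow> \<bar>(Q ^^ n) f z - (Q ^^ n) f z'\<bar> \<le> M * exp (- \<gamma> * real n)" for \<nu> f M n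
  proof -
    interpret N: prob_space \<nu> using \<nu> by (rule borel_probs_prob)
    obtain B where B: "\<And>x. \<bar>(Q ^^ n) f x\<bar> \<le> B" using Cb_Qn[OF f] by (auto simp: Cb_def)
    have i: "integrable \<nu> ((Q ^^ n) f)"
      using measurable_compose[OF borel_probs_id[OF \<nu>] bm[OF Cb_Qn[OF f]]] B by (intro N.integrable_const_bound[of _ B]) auto
    have "(\<integral>x. (Q ^^ n) f x \<partial>\<nu>) - ?\<Lambda> f = (\<integral>x. (Q ^^ n) f x - ?\<Lambda> f \<partial>\<nu>)"
      using i N.prob_space by simp
    also have "\<bar>\<dots>\<bar> \<le> (\<integral>x. \<bar>(Q ^^ n) f x - ?\<Lambda> f\<bar> \<partial>\<nu>)" by (rule integral_abs_bound)
    also have "\<dots> \<le> (\<integral>x. M * exp (- \<gamma> * real n) \<partial>\<nu>)"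
      using limit_functional_rate(2)[OF f M C(2) osc] i
      by (intro integral_mono) (auto simp: borel_probs_space[OF \<nu>])
    also have "\<dots> = M * exp (- \<gamma> * real n)" using N.prob_space by simp
    finally show ?thesis .
  qed
  have stat: "stationary P \<eta> S X \<mu>" unfolding stationary_def
  proof (rule borel_probs_eqI[OF dual_semigroup_borel_probs[OF R(1)] R(1) X_borel])
    fix f :: "'x \<Rightarrow> real" assume bl: "bounded_lipschitz f"
    obtain L B where f: "L-lipschitz_on UNIV f" "\<forall>x. \<bar>f x\<bar> \<le> B" using bl by (auto simp: bounded_lipschitz_def)
    have L: "L \<ge> 0" using f(1) by (rule lipschitz_on_nonneg)
    have B: "B \<ge> 0" using f(2) by (meson abs_ge_zero order_trans)
    obtain c where c: "c \<ge> 0" "\<And>z z' f \<Lambda> B. z\<in>X \<Longrightarrow> z'\<in>X \<Longrightarrow> \<Lambda>-lipschitz_on UNIV f \<Longrightarrow> (\<forall>x. \<bar>f x :: real\<bar> \<le> B) \<Longrightarrow>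
        \<bar>Q f z - Q f z'\<bar> \<le> (c * B + 1 * \<Lambda>) * dist z z'"
      using Lasota_Yorke[of 1] by (metis zero_less_one)
    have Cbf: "Cb f" using bl by (rule Cb_bounded_lipschitz)
    obtain B' where B': "\<And>x. \<bar>Q f x\<bar> \<le> B'" using Cb_Q[OF Cbf] by (auto simp: Cb_def)
    have "B' \<ge> 0" using B' by (meson abs_ge_zero order_trans)
    \<comment> \<open>\<open>Q f\<close> is known to be Lipschitz on \<open>X\<close> only, by
      \<open>Lasota_Yorke\<close>, while the representation of the functional concerns functions
      that are Lipschitz everywhere. An extension \<open>G\<close> that agrees with
      \<open>Q f\<close> on \<open>X\<close> has the same iterates there.\<close>
    have "\<exists>G. (c * B + 1 * L)-lipschitz_on UNIV G \<and> (\<forall>x. \<bar>G x\<bar> \<le> B') \<and> (\<forall>x\<in>X. G x = Q f x)"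
      using c(2)[OF _ _ f] B' \<open>B' \<ge> 0\<close> c(1) L B by (intro McShane_extension X_nonempty) auto
    then obtain G where G: "bounded_lipschitz G" "\<And>x. x \<in> X \<Longrightarrow> G x = Q f x"
      unfolding bounded_lipschitz_def by blast
    have "(\<integral>x. f x \<partial>dual_semigroup P \<eta> S X 1 \<mu>) = (\<integral>x. (Q ^^ 1) f x \<partial>\<mu>)"
      by (rule integral_dual_semigroup[OF R(1) Cbf])
    also have "\<dots> = (\<integral>x. G x \<partial>\<mu>)" using G(2) by (intro int_X[OF R(1)]) simp
    also have "\<dots> = ?\<Lambda> G" by (rule int_mu[OF G(1)])
    also have "?\<Lambda> G = ?\<Lambda> f"
    proof (rule LIMSEQ_unique[OF lim[OF G(1)]])
      have "(Q ^^ n) G (SOME z. z \<in> X) = (Q ^^ Suc n) f (SOME z. z \<in> X)" for n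
        using Qn_mono[OF Cb_bounded_lipschitz[OF G(1)] Cb_Q[OF Cbf] _ z0, of n]
          Qn_mono[OF Cb_Q[OF Cbf] Cb_bounded_lipschitz[OF G(1)] _ z0, of n] G(2)
        by (simp add: funpow_swap1 antisym)
      then show "(\<lambda>n. (Q ^^ n) G (SOME z. z \<in> X)) \<longlonglongrightarrow> ?\<Lambda> f" using LIMSEQ_Suc[OF lim[OF bl]] by simp
    qed
    also have "\<dots> = (\<integral>x. f x \<partial>\<mu>)" by (rule int_mu[OF bl, symmetric])
    finally show "(\<integral>x. f x \<partial>dual_semigroup P \<eta> S X 1 \<mu>) = (\<integral>x. f x \<partial>\<mu>)" .
  qed
  have uniq: "\<nu> = \<mu>" if \<nu>: "\<nu> \<in> borel_probs X" and st: "stationary P \<eta> S X \<nu>" for \<nu>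
  proof (rule borel_probs_eqI[OF \<nu> R(1) X_borel])
    fix f :: "'x \<Rightarrow> real" assume bl: "bounded_lipschitz f"
    have Cbf: "Cb f" using bl by (rule Cb_bounded_lipschitz)
    have inv: "(\<integral>x. (Q ^^ n) f x \<partial>\<nu>) = (\<integral>x. f x \<partial>\<nu>)" for n
    proof (induction n)
      case (Suc n)
      have "(\<integral>x. (Q ^^ Suc n) f x \<partial>\<nu>) = (\<integral>x. (Q ^^ 1) ((Q ^^ n) f) x \<partial>\<nu>)" by simp
      also have "\<dots> = (\<integral>x. (Q ^^ n) f x \<partial>dual_semigroup P \<eta> S X 1 \<nu>)"
        by (rule integral_dual_semigroup[OF \<nu> Cb_Qn[OF Cbf], symmetric])
      also have "dual_semigroup P \<eta> S X 1 \<nu> = \<nu>" using st by (simp add: stationary_def)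
      finally show ?case using Suc by simp
    qed simp
    obtain M where M: "M \<ge> 0" "\<And>n z z'. z\<in>X \<Longrightarrow> z'\<in>X \<Longrightarrow> \<bar>(Q ^^ n) f z - (Q ^^ n) f z'\<bar> \<le> M * exp (- \<gamma> * real n)"
      using rate1[OF bl] by metis
    \<comment> \<open>Stationarity makes the left side independent of \<open>n\<close>, so letting
      \<open>n\<close> tend to infinity identifies the integral with the limit.\<close>
    have le: "\<bar>(\<integral>x. f x \<partial>\<nu>) - ?\<Lambda> f\<bar> \<le> M * exp (- \<gamma> * real n)" for n
      using nu_rate[OF \<nu> Cbf M, of n] by (simp add: inv)
    have "(\<lambda>n. M * exp (- \<gamma>) ^ n) \<longlonglongrightarrow> M * 0"
      using C(2) by (intro tendsto_intros LIMSEQ_power_zero) simp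
    moreover have "exp (- \<gamma>) ^ n = exp (- \<gamma> * real n)" for n by (simp add: exp_of_nat_mult[symmetric] mult.commute)
    ultimately have "\<bar>(\<integral>x. f x \<partial>\<nu>) - ?\<Lambda> f\<bar> \<le> 0"
      using le by (intro LIMSEQ_le_const[of "\<lambda>n. M * exp (- \<gamma>) ^ n"]) auto
    then show "(\<integral>x. f x \<partial>\<nu>) = (\<integral>x. f x \<partial>\<mu>)" using int_mu[OF bl] by simp
  qed
  have conv: "dual_lipschitz X (dual_semigroup P \<eta> S X n \<nu>) \<mu> \<le> C * exp (- \<gamma> * real n)"
    if \<nu>: "\<nu> \<in> borel_probs X" for n \<nu>
    unfolding dual_lipschitz_def
  proof (rule cSUP_least)
    have "L_norm X (\<lambda>_. 0) \<le> 1" unfolding L_norm_def by (simp add: case_prod_beta bot_ennreal SUP_constant)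
    then show "{f. L_norm X f \<le> 1} \<noteq> {}" by blast
    fix f assume "f \<in> {f. L_norm X f \<le> 1}"
    then have f: "L_norm X f \<le> 1" by simp
    \<comment> \<open>\<open>L_norm\<close> constrains \<open>f\<close> on \<open>X\<close> only.
      The extension obeys exactly the bounds required by \<open>dec\<close>, so \<open>C\<close> and
      \<open>\<gamma>\<close> serve all test functions and all initial laws.\<close>
    have "\<exists>G. 2-lipschitz_on UNIV G \<and> (\<forall>x. \<bar>G x\<bar> \<le> 1) \<and> (\<forall>x\<in>X. G x = f x)"
      using L_norm_le_1[OF f] by (intro McShane_extension X_nonempty) auto
    then obtain G where G: "2-lipschitz_on UNIV G" "\<And>x. \<bar>G x\<bar> \<le> 1" "\<And>x. x \<in> X \<Longrightarrow> G x = f x" by blast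
    have bl: "bounded_lipschitz G" using G unfolding bounded_lipschitz_def by blast
    have Cbg: "Cb G" using bl by (rule Cb_bounded_lipschitz)
    have "\<forall>x\<in>X. \<forall>y\<in>X. \<bar>G x - G y\<bar> \<le> min 2 (2 * dist x y)"
    proof (intro ballI)
      fix x y
      have "\<bar>G x - G y\<bar> \<le> 2" using G(2)[of x] G(2)[of y] by linarith
      then show "\<bar>G x - G y\<bar> \<le> min 2 (2 * dist x y)" using lipschitz_onD[OF G(1), of x y] by (simp add: dist_real_def)
    qed
    note osc = dec[OF Cbg this]
    have "(\<integral>x. f x \<partial>dual_semigroup P \<eta> S X n \<nu>) = (\<integral>x. G x \<partial>dual_semigroup P \<eta> S X n \<nu>)"
      using G(3) by (intro int_X[OF dual_semigroup_borel_probs[OF \<nu>]]) simp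
    also have "\<dots> = (\<integral>x. (Q ^^ n) G x \<partial>\<nu>)" by (rule integral_dual_semigroup[OF \<nu> Cbg])
    finally have 1: "(\<integral>x. f x \<partial>dual_semigroup P \<eta> S X n \<nu>) = \<dots>" .
    have "(\<integral>x. f x \<partial>\<mu>) = (\<integral>x. G x \<partial>\<mu>)" using G(3) by (intro int_X[OF R(1)]) simp
    then have 2: "(\<integral>x. f x \<partial>\<mu>) = ?\<Lambda> G" using int_mu[OF bl] by simp
    show "\<bar>(\<integral>x. f x \<partial>dual_semigroup P \<eta> S X n \<nu>) - (\<integral>x. f x \<partial>\<mu>)\<bar> \<le> C * exp (- \<gamma> * real n)"
      unfolding 1 2 by (rule nu_rate[OF \<nu> Cbg _ osc]) (use C in auto)
  qed
  show ?thesis using R(1) stat uniq conv C by blast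
qed

end

theorem theorem3p1:
  fixes A :: "('m::polish_space, 'd::real_normed_vector) chart set"
    and g :: "'m \<Rightarrow> (('m, 'd) chart \<Rightarrow> 'd) \<Rightarrow> (('m, 'd) chart \<Rightarrow> 'd) \<Rightarrow> real"
    and S :: "('h::{real_inner,banach,polish_space} \<times> 'm) \<times> 'e::{real_inner,banach,polish_space} \<Rightarrow> 'h \<times> 'm"
    and P :: "'w measure"
    and \<eta> :: "nat \<Rightarrow> 'w \<Rightarrow> 'e"
    and \<l> :: "'e measure"
    and K :: "'e set"
    and X :: "('h \<times> 'm) set"
  assumes M: "compact_riemannian_manifold A g"
    and S_cont: "continuous_on UNIV S"
    and P: "prob_space P"
    and indep: "prob_space.indep_vars P (\<lambda>_. borel) \<eta> {1..}"
    and law: "\<forall>n\<ge>1. distr P borel (\<eta> n) = \<l>"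
    and K: "K = measure_support \<l>" "compact K"
    and X: "compact X" "S ` (X \<times> K) \<subseteq> X"
    and H1: "\<exists>(\<iota> :: 'v::{real_inner,banach} \<Rightarrow> 'h) (F :: ('h \<times> 'm) \<times> 'e \<Rightarrow> 'v \<times> 'm).
               compact_embedding \<iota> \<and> (\<forall>w. S w = (\<iota> (fst (F w)), snd (F w))) \<and> C2_bounded A F"
    and H2: "\<exists>zhat\<in>X. \<forall>\<epsilon>>0. \<exists>m\<ge>1. \<forall>z\<in>X. \<exists>\<zeta>.
               (\<forall>k\<in>{1..m}. \<zeta> k \<in> K) \<and> dist (traj S z \<zeta> m) zhat < \<epsilon>"
    and H3: "\<forall>z\<in>X. measure \<l> {e \<in> K. noise_deriv_dense A g S z e} = 1"
    and H4: "decomposable_noise P \<eta>"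
  shows "\<exists>\<mu>. \<mu> \<in> borel_probs X \<and> stationary P \<eta> S X \<mu> \<and>
           (\<forall>\<nu>\<in>borel_probs X. stationary P \<eta> S X \<nu> \<longrightarrow> \<nu> = \<mu>) \<and>
           (\<exists>C>0. \<exists>\<gamma>>0. \<forall>n. \<forall>\<nu>\<in>borel_probs X.
              dual_lipschitz X (dual_semigroup P \<eta> S X n \<nu>) \<mu> \<le> C * exp (- \<gamma> * real n))"
proof -
  interpret P: prob_space P by (rule P)
  have em: "\<eta> 1 \<in> borel_measurable P" using indep unfolding P.indep_vars_def2 by auto
  have l1: "distr P borel (\<eta> 1) = \<l>" using law by simp
  have pl: "prob_space \<l>" using P.prob_space_distr[OF em] l1 by simp
  have sl: "sets \<l> = sets borel" using l1 by (metis sets_distr)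
  have aeK: "AE e in \<l>. e \<in> K" using AE_measure_support[OF sl] K(1) by simp
  obtain \<iota> :: "'v \<Rightarrow> 'h" and F :: "('h \<times> 'm) \<times> 'e \<Rightarrow> 'v \<times> 'm" where
    F: "compact_embedding \<iota>" "\<And>w. S w = (\<iota> (fst (F w)), snd (F w))" "C2_bounded A F"
    using H1 by metis
  interpret sm: smooth_system A g S \<iota> F
    by unfold_locales (use M S_cont F in \<open>simp_all add: compact_riemannian_manifold_def\<close>)
  have dense: "closure {v. shift_regular \<l> v} = UNIV"
  proof -
    \<comment> \<open>Compact support of the law bounds the noise almost surely; this is what gives
      the coefficient densities bounded support.\<close>
    obtain R0 where "\<And>e. e \<in> K \<Longrightarrow> norm e \<le> R0" using compact_imp_bounded[OF K(2)] by (auto simp: bounded_iff)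
    then have "AE \<omega> in P. norm (\<eta> 1 \<omega>) \<le> R0"
      using aeK K(2) em unfolding l1[symmetric]
      by (subst (asm) AE_distr_iff) (auto simp: compact_imp_closed elim: eventually_mono)
    from decomposable_noise_shift_regular[OF P H4 em this] show ?thesis unfolding l1 .
  qed
  have "X \<noteq> {}" using H2 by blast
  then have base: "noisy_map S \<l> K X"
    by (intro noisy_map.intro pl sl S_cont K(2) aeK X)
  have "contracting_noisy_map S \<l> K X"
  proof (intro contracting_noisy_map.intro base contracting_noisy_map_axioms.intro sm.locally_Lipschitz)
    fix z0 :: "'h \<times> 'm" assume z0: "z0 \<in> X"
    interpret L: prob_space \<l> by (rule pl)
    let ?D = "{e \<in> K. noise_deriv_dense A g S z0 e}"
    have m1: "measure \<l> ?D = 1" using H3 z0 by blast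
    \<comment> \<open>A nonmeasurable set would have \<open>measure\<close> 0, so the value 1
      already implies measurability.\<close>
    then have "?D \<in> sets \<l>" using measure_notin_sets by fastforce
    then have "AE e in \<l>. e \<in> ?D" using m1 L.AE_prob_1 by blast
    then show "AE \<eta>0 in \<l>. \<forall>\<epsilon>>0. \<exists>r>0. \<exists>W R. finite W \<and> W \<subseteq> {v. shift_regular \<l> v} \<and> R \<ge> 0 \<and>
      (\<forall>z\<in>ball z0 r. \<forall>z'\<in>ball z0 r. \<exists>v\<in>W. \<exists>t. 0 \<le> t \<and> t \<le> R * dist z z' \<and>
       (\<forall>\<eta>\<in>ball \<eta>0 r. dist (S (z, \<eta>)) (S (z', \<eta> + t *\<^sub>R v)) \<le> \<epsilon> * dist z z'))"
    proof eventually_elim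
      case (elim e)
      then have d: "noise_deriv_dense A g S z0 e" by blast
      show ?case by (intro allI impI sm.contracting_shift[OF d dense])
    qed
  qed
  then have "mixing_noisy_map S \<l> K X"
    by (intro mixing_noisy_map.intro mixing_noisy_map_axioms.intro K(1) H2)
  then have "noise_driven_chain S \<l> K X P \<eta>"
    by (intro noise_driven_chain.intro noise_driven_chain_axioms.intro P indep law[rule_format])
  then interpret noise_driven_chain S \<l> K X P \<eta> .
  show ?thesis by (rule exponential_mixing)
qed

end
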